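(* Let $q=2^{r}$ with $r\ge 1$. Assume that either $n\ge 3$ is an odd integer (and $q$ is arbitrary), or $n=1$ and $q\ge 8$. Write $A=A(n,q)$, $B=B(n,q)$, $N=N(n,q)=|DC(n,q)|=A(n,q)B(n,q)$. Let $\{C_j(n,q)\}_{j=0}^{N}$ and $\{\widehat{C}_j(n,q)\}_{j=0}^{N}$ be the weight distributions of the binary linear codes $C(DC(n,q))$ and $C(\widehat{DC}(n,q))$, respectively, and put $D_j(n,q)=C_j(n,q)-\widehat{C}_j(n,q)$. Then for every $h=1,3,5,\dots$, $$T_1K^{h}=-\sum_{\substack{0\le l\le h-2\\ l\ \mathrm{odd}}}\binom{h}{l}B^{h-l}\,T_1K^{l}+qA^{-h}\sum_{j=0}^{\min\{N,h\}}(-1)^jD_j(n,q)\sum_{t=j}^{h}t!\,S(h,t)\,2^{h-t-1}\binom{N-j}{N-t},$$ where the first sum is $0$ if $h=1$. Moreover, the weight distributions are given, for $j=0,\dots,N$, by $$C_j(n,q)=\sum\binom{q^{-1}A(B+1)}{\nu_1}\prod_{\mathrm{tr}((\beta-1)^{-1})=0}\binom{q^{-1}A(B+q+1)}{\nu_\beta}\prod_{\mathrm{tr}((\beta-1)^{-1})=1}\binom{q^{-1}A(B-q+1)}{\nu_\beta},$$ $$\widehat{C}_j(n,q)=\sum\binom{q^{-1}A(B+1)}{\nu_0}\prod_{\mathrm{tr}(\beta^{-1})=0}\binom{q^{-1}A(B+q+1)}{\nu_\beta}\prod_{\mathrm{tr}(\beta^{-1})=1}\binom{q^{-1}A(B-q+1)}{\nu_\beta},$$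 where in both formulas the outer sum is over all families of nonnegative integers $\{\nu_\beta\}_{\beta\in\mathbb{F}_q}$ satisfying $\sum_{\beta\in\mathbb{F}_q}\nu_\beta=j$ and $\sum_{\beta\in\mathbb{F}_q}\nu_\beta\beta=0$ (in $\mathbb{F}_q$); in the first formula the products are over $\beta\in\mathbb{F}_q\setminus\{1\}$ with the indicated trace condition, and in the second over $\beta\in\mathbb{F}_q\setminus\{0\}$ with the indicated trace condition.
   Context: Numbers. For odd $n\ge1$, $$A(n,q)=q^{\frac14(5n^2-1)}\begin{bmatrix}n\\1\end{bmatrix}_q\prod_{j=1}^{(n-1)/2}(q^{2j-1}-1),\qquad B(n,q)=q^{\frac14(n-1)^2}(q^n-1)\prod_{j=1}^{(n-1)/2}(q^{2j}-1),$$ with $\begin{bmatrix}n\\1\end{bmatrix}_q=(q^n-1)/(q-1)$ (empty products are $1$). Binomial coefficients $\binom{b}{a}$ are $0$ if $a>b$ or $a<0$. $S(h,t)=\frac1{t!}\sum_{j=0}^t(-1)^{t-j}\binom tj j^h$ is the Stirling number of the second kind. Kloosterman sums. $\mathrm{tr}:\mathbb{F}_q\to\mathbb{F}_2$ is $\mathrm{tr}(x)=x+x^2+\cdots+x^{2^{r-1}}$, and $\lambda(x)=(-1)^{\mathrm{tr}(x)}$ is the canonical additive character of $\mathbb{F}_q$. For $a\in\mathbb{F}_q^*$, $K(\lambda;a)=\sum_{\alpha\in\mathbb{F}_q^*}\lambda(\alpha+a\alpha^{-1})$. For $h\ge0$, $T_1K^h=\sum_{a\in\mathbb{F}_q^*,\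 \mathrm{tr}(a)=1}K(\lambda;a)^h$. Groups. $\mathrm{Tr}$ is the trace of a square matrix. A square matrix over $\mathbb{F}_q$ is alternating if it is symmetric with zero diagonal (characteristic $2$). $O(2n+1,q)$ is the group of isometries of the quadratic form $\theta(\sum_{i=1}^{2n+1}x_ie^i)=\sum_{i=1}^n x_ix_{n+i}+x_{2n+1}^2$ on $\mathbb{F}_q^{(2n+1)\times1}$ with standard basis $e^1,\dots,e^{2n+1}$. Its maximal parabolic subgroup $P=P(2n+1,q)$ is the set of all $$\begin{bmatrix}M&0&0\\0&{}^tM^{-1}&0\\0&0&1\end{bmatrix}\begin{bmatrix}1_n&E&0\\0&1_n&0\\0&h&1\end{bmatrix}$$ with $M\in GL(n,q)$, $E$ an $n\times n$ matrix and $h$ a $1\times n$ row over $\mathbb{F}_q$ with $E+{}^th\,h$ alternating. For $0\le s\le n$ put $$\sigma_s=\begin{bmatrix}0&0&1_s&0&0\\0&1_{n-s}&0&0&0\\1_s&0&0&0&0\\0&0&0&1_{n-s}&0\\0&0&0&0&1\end{bmatrix}\in O(2n+1,q),\qquad \sigma_s'=\begin{bmatrix}0&0&1_s&0\\0&1_{n-s}&0&0\\1_s&0&0&0\\0&0&0&1_{n-s}\end{bmatrix}.$$ $Sp(2n,q)=\{w\in GL(2n,q): {}^twJw=J\}$ with $J=\begin{bmatrix}0&1_n\\1_n&0\end{bmatrix}$, and $P'=P'(2n,q)$ is its subgroup of all $\begin{bmatrix}M&0\\0&{}^tM^{-1}\end{bmatrix}\begin{bmatrix}1_n&E\\0&1_n\end{bmatrix}$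 with $M\in GL(n,q)$, ${}^tE=E$. Then $\sigma_s'\in Sp(2n,q)$. Double cosets: $DC(n,q)=P\sigma_{n-1}P\subset O(2n+1,q)$ and $\widehat{DC}(n,q)=P'\sigma'_{n-1}P'\subset Sp(2n,q)$; both have $N(n,q)=A(n,q)B(n,q)$ elements. Codes. For $X=DC(n,q)$ or $X=\widehat{DC}(n,q)$, fix an ordering $g_1,\dots,g_N$ of the elements of $X$, and let $C(X)=\{u\in\mathbb{F}_2^{N}:\sum_{i=1}^{N}u_i\,\mathrm{Tr}(g_i)=0\text{ in }\mathbb{F}_q\}$. The weight distribution of a binary code of length $N$ is the sequence whose $j$-th term ($0\le j\le N$) is the number of codewords of Hamming weight $j$. *)

theory Defs
  imports
    "HOL-Library.Cardinality"
    "HOL-Library.Z2"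
    "HOL-Combinatorics.Stirling"
    "Jordan_Normal_Form.Matrix"
begin

section \<open>The numbers A(n,q) and B(n,q)\<close>

text \<open>
  For odd \<open>n\<close> all divisions below are exact and no subtraction truncates (for \<open>q \<ge> 2\<close>).
\<close>

definition num_A :: "nat \<Rightarrow> nat \<Rightarrow> nat" where
  "num_A n q = q ^ ((5 * n\<^sup>2 - 1) div 4) * ((q ^ n - 1) div (q - 1))
     * (\<Prod>j=1..(n - 1) div 2. q ^ (2 * j - 1) - 1)"

definition num_B :: "nat \<Rightarrow> nat \<Rightarrow> nat" where
  "num_B n q = q ^ ((n - 1)\<^sup>2 div 4) * (q ^ n - 1)
     * (\<Prod>j=1..(n - 1) div 2. q ^ (2 * j) - 1)"

text \<open>
  Binomial coefficient with integer arguments, \<open>0\<close> for a negative lower argument. It is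
  needed for \<open>binom (N - j) (N - t)\<close> with \<open>t > N\<close>, where the truncated \<open>N - t\<close> on naturals
  would give \<open>1\<close>.
\<close>

definition int_binom :: "int \<Rightarrow> int \<Rightarrow> nat" where
  "int_binom b a = (if 0 \<le> a \<and> a \<le> b then nat b choose nat a else 0)"


section \<open>Trace, canonical additive character and Kloosterman sums\<close>

text \<open>
  The finite field with \<open>q = 2 ^ r\<close> elements is a type \<open>'a\<close> of sort \<open>{field, finite}\<close> with
  \<open>CARD('a) = 2 ^ r\<close>. The trace to the prime field is taken with values in \<open>'a\<close>.
\<close>

definition field_tr :: "nat \<Rightarrow> 'a :: field \<Rightarrow> 'a" where
  "field_tr r x = (\<Sum>i<r. x ^ (2 ^ i))"

definition add_char :: "nat \<Rightarrow> 'a :: field \<Rightarrow> real" where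
  "add_char r x = (if field_tr r x = 0 then 1 else - 1)"

definition kloosterman :: "nat \<Rightarrow> 'a :: {field, finite} \<Rightarrow> real" where
  "kloosterman r a = (\<Sum>\<alpha>\<in>UNIV - {0}. add_char r (\<alpha> + a * inverse \<alpha>))"

definition T1K :: "'a :: {field, finite} itself \<Rightarrow> nat \<Rightarrow> nat \<Rightarrow> real" where
  "T1K _ r h = (\<Sum>a\<in>{a :: 'a. a \<noteq> 0 \<and> field_tr r a = 1}. kloosterman r a ^ h)"


section \<open>Parabolic subgroups and double cosets\<close>

definition mat_trace :: "'a :: comm_monoid_add mat \<Rightarrow> 'a" where
  "mat_trace A = (\<Sum>i<dim_row A. A $$ (i, i))"

definition alternating_mat :: "'a :: zero mat \<Rightarrow> bool" where
  "alternating_mat A \<longleftrightarrow>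
     square_mat A \<and> transpose_mat A = A \<and> (\<forall>i<dim_row A. A $$ (i, i) = 0)"

text \<open>
  The block matrix with rows \<open>(A, B, 0)\<close>, \<open>(C, D, 0)\<close>, \<open>(0, h, 1)\<close>, where \<open>A, B, C, D\<close> are
  \<open>n \<times> n\<close> and \<open>h\<close> is a \<open>1 \<times> n\<close> row.
\<close>

definition odd_block_mat ::
    "nat \<Rightarrow> 'a :: {zero, one} mat \<Rightarrow> 'a mat \<Rightarrow> 'a mat \<Rightarrow> 'a mat \<Rightarrow> 'a mat \<Rightarrow> 'a mat" where
  "odd_block_mat n A B C D h =
     four_block_mat (four_block_mat A B C D) (0\<^sub>m (2 * n) 1)
       (four_block_mat (0\<^sub>m 1 n) h (0\<^sub>m 0 n) (0\<^sub>m 0 n)) (1\<^sub>m 1)"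

text \<open>
  In the two subgroups below \<open>M'\<close> is the inverse of \<open>M\<close>, so \<open>M\<close> ranges over \<open>GL(n,q)\<close>.
\<close>

definition parabolic_O :: "nat \<Rightarrow> 'a :: field mat set" where
  "parabolic_O n =
     {odd_block_mat n M (0\<^sub>m n n) (0\<^sub>m n n) (transpose_mat M') (0\<^sub>m 1 n)
        * odd_block_mat n (1\<^sub>m n) E (0\<^sub>m n n) (1\<^sub>m n) h | M M' E h.
        M \<in> carrier_mat n n \<and> M' \<in> carrier_mat n n \<and> inverts_mat M M' \<and> inverts_mat M' M \<and>
        E \<in> carrier_mat n n \<and> h \<in> carrier_mat 1 n \<and>
        alternating_mat (E + transpose_mat h * h)}"

definition parabolic_Sp :: "nat \<Rightarrow> 'a :: field mat set" where
  "parabolic_Sp n =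
     {four_block_mat M (0\<^sub>m n n) (0\<^sub>m n n) (transpose_mat M')
        * four_block_mat (1\<^sub>m n) E (0\<^sub>m n n) (1\<^sub>m n) | M M' E.
        M \<in> carrier_mat n n \<and> M' \<in> carrier_mat n n \<and> inverts_mat M M' \<and> inverts_mat M' M \<and>
        E \<in> carrier_mat n n \<and> transpose_mat E = E}"

definition sigma_O :: "nat \<Rightarrow> nat \<Rightarrow> 'a :: field mat" where
  "sigma_O n s =
     odd_block_mat n
       (diag_block_mat [0\<^sub>m s s, 1\<^sub>m (n - s)]) (diag_block_mat [1\<^sub>m s, 0\<^sub>m (n - s) (n - s)])
       (diag_block_mat [1\<^sub>m s, 0\<^sub>m (n - s) (n - s)]) (diag_block_mat [0\<^sub>m s s, 1\<^sub>m (n - s)])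
       (0\<^sub>m 1 n)"

definition sigma_Sp :: "nat \<Rightarrow> nat \<Rightarrow> 'a :: field mat" where
  "sigma_Sp n s =
     four_block_mat
       (diag_block_mat [0\<^sub>m s s, 1\<^sub>m (n - s)]) (diag_block_mat [1\<^sub>m s, 0\<^sub>m (n - s) (n - s)])
       (diag_block_mat [1\<^sub>m s, 0\<^sub>m (n - s) (n - s)]) (diag_block_mat [0\<^sub>m s s, 1\<^sub>m (n - s)])"

definition DC_O :: "nat \<Rightarrow> 'a :: field mat set" where
  "DC_O n = {p * sigma_O n (n - 1) * p' | p p'. p \<in> parabolic_O n \<and> p' \<in> parabolic_O n}"

definition DC_Sp :: "nat \<Rightarrow> 'a :: field mat set" where
  "DC_Sp n = {p * sigma_Sp n (n - 1) * p' | p p'. p \<in> parabolic_Sp n \<and> p' \<in> parabolic_Sp n}"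


section \<open>Codes and their weight distributions\<close>

text \<open>
  The code attached to an enumeration \<open>g 0, \<dots>, g (N - 1)\<close> of matrices: binary words
  orthogonal, over the big field, to the vector of traces.
\<close>

definition trace_code :: "nat \<Rightarrow> (nat \<Rightarrow> 'a :: field mat) \<Rightarrow> bit vec set" where
  "trace_code N g =
     {u \<in> carrier_vec N. (\<Sum>i<N. of_bit (u $ i) * mat_trace (g i)) = 0}"

definition hamming_weight :: "bit vec \<Rightarrow> nat" where
  "hamming_weight u = card {i. i < dim_vec u \<and> u $ i \<noteq> 0}"

definition weight_dist :: "bit vec set \<Rightarrow> nat \<Rightarrow> nat" where
  "weight_dist C j = card {u \<in> C. hamming_weight u = j}"

text \<open>
  Index set of the weight formulas: families of natural numbers \<open>\<nu>\<close>, indexed by the field,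
  with total \<open>j\<close> and \<open>\<Sum>\<beta>. \<nu> \<beta> \<cdot> \<beta> = 0\<close> in the field; it is finite.
\<close>

definition weight_families :: "nat \<Rightarrow> ('a :: {field, finite} \<Rightarrow> nat) set" where
  "weight_families j =
     {\<nu>. (\<Sum>\<beta>\<in>UNIV. \<nu> \<beta>) = j \<and> (\<Sum>\<beta>\<in>UNIV. of_nat (\<nu> \<beta>) * \<beta>) = 0}"

lemma finite_weight_families: "finite (weight_families j :: ('a :: {field, finite} \<Rightarrow> nat) set)"
proof (rule finite_subset)
  show "(weight_families j :: ('a \<Rightarrow> nat) set) \<subseteq> PiE UNIV (\<lambda>_. {..j})"
    by (auto simp: weight_families_def PiE_UNIV_domain intro: member_le_sum)
  show "finite (PiE (UNIV :: 'a set) (\<lambda>_. {..j}))"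
    by (intro finite_PiE) auto
qed

end

theory Submission
  imports Defs
    "HOL-Computational_Algebra.Polynomial"
    "HOL-Algebra.Group"
    "Jordan_Normal_Form.Determinant"
begin

text \<open>
  Both codes consist of the words \<open>u\<close> with \<open>\<Sum>i. u i * t i = 0\<close>, where \<open>t i\<close> is the trace of the
  \<open>i\<close>-th group element. So all that matters about a double coset is how often each field element
  occurs as a trace, and the proof has two halves: find this distribution, and extract the
  weights and the moments from it.

  \<^bold>\<open>The distribution of the trace.\<close> Consider first the symplectic double coset \<open>P' \<sigma> P'\<close>, with
  \<open>n = k + 1\<close> and \<open>k = n - 1\<close> even. As the trace is a class function, counting pairs shows that
  it suffices to know the distribution of \<open>Tr (\<sigma> p)\<close> for \<open>p\<close> in \<open>P'\<close>, together with the order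
  of \<open>P' \<inter> \<sigma> P' \<sigma>\<close> (\<open>card_double_coset_fibre\<close>). An element \<open>p\<close> is given by an invertible
  matrix \<open>M\<close> and a symmetric matrix \<open>E\<close>, and \<open>Tr (\<sigma> p)\<close> is the sum of the last diagonal entries
  of \<open>M\<close> and of its inverse and of a linear functional of \<open>E\<close>. In characteristic two this
  functional vanishes on all symmetric matrices exactly when the first \<open>k\<close> rows of \<open>M\<close> form an
  alternating matrix followed by a zero column; then \<open>Tr (\<sigma> p) = m + 1/m\<close> for the corner entry
  \<open>m\<close> of \<open>M\<close>. For every other \<open>M\<close> the trace is uniformly distributed over \<open>E\<close>. Hence the number
  of elements of trace \<open>\<beta>\<close> is a constant plus \<open>A\<close> times the number of solutions of
  \<open>x + 1/x = \<beta>\<close> (\<open>card_DC_Sp_trace\<close>). The values of \<open>A\<close> and \<open>B\<close> come from the recursions for the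
  number of invertible and of invertible alternating matrices: \<open>B\<close> is the quotient of the order
  of \<open>GL n\<close> by the number of \<open>M\<close> with vanishing functional and fixed corner entry.

  Deleting the last row and column of an element of the orthogonal group gives a symplectic
  matrix whose trace is smaller by one. This is a bijection between the two double cosets
  (\<open>bij_betw_DC_O_DC_Sp\<close>): an isometry is block triangular, and the squares of the
  entries of its last row are prescribed by the rest, while squaring permutes the field. So the
  orthogonal distribution is the symplectic one, shifted by one.

  \<^bold>\<open>Weights and moments.\<close> The size and the sum of a set of indices depend only on the
  number of indices of each trace, so the number of words of given weight is a sum of products
  of binomial coefficients. The explicit ones follow from the fact that \<open>x + 1/x = \<beta>\<close>
  has two solutions or none, according to the field trace of \<open>1/\<beta>\<close>, by the additive form of
  Hilbert 90. For the recursion, let \<open>w(a)\<close> be the number of indices with \<open>\<lambda>(a t i) = - 1\<close>.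
  Orthogonality of the characters \<open>x \<mapsto> \<lambda>(a x)\<close> expresses \<open>\<Sum>a. w(a) ^ h\<close> by the weight
  distribution (\<open>power_moment_identity\<close>). On the other hand the constant part of the trace
  distribution disappears from a nontrivial character sum, so that \<open>w(a) = A/2 * (B - K(a\<^sup>2))\<close> in
  the symplectic and \<open>w(a) = A/2 * (B - \<lambda>(a) K(a\<^sup>2))\<close> in the orthogonal case, for \<open>a \<noteq> 0\<close>. These
  differ only if \<open>a\<close> has field trace one, and then the difference of the \<open>h\<close>-th powers keeps
  twice the odd powers of \<open>K(a\<^sup>2)\<close>. Summing over \<open>a\<close> and isolating the term \<open>l = h\<close> gives the
  recursion.
\<close>

section \<open>Finite fields of characteristic two\<close>

lemma char_two_of_card:
  assumes card: "CARD('a :: {field, finite}) = 2 ^ r"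
  shows "(2 :: 'a) = 0"
proof -
  have "(\<Sum>x\<in>UNIV. x + 1 :: 'a) = (\<Sum>x\<in>UNIV. x)"
    by (rule sum.reindex_bij_witness[of _ "\<lambda>x. x - 1" "\<lambda>x. x + 1"]) auto
  then have "of_nat CARD('a) = (0 :: 'a)"
    by (simp add: sum.distrib)
  then have "(2 :: 'a) ^ r = 0"
    by (simp add: card)
  then show ?thesis
    by simp
qed

lemma finite_field_power_card:
  fixes x :: "'a :: {field, finite}"
  shows "x ^ CARD('a) = x"
proof (cases "x = 0")
  case False
  let ?U = "UNIV - {0 :: 'a}"
  have "(\<Prod>y\<in>?U. x * y) = \<Prod>?U"
    by (rule prod.reindex_bij_witness[of _ "\<lambda>y. y / x" "\<lambda>y. x * y"]) (use False in auto)
  then have "x ^ (CARD('a) - 1) * \<Prod>?U = 1 * \<Prod>?U"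
    by (simp add: prod.distrib)
  then have "x ^ (CARD('a) - 1) = 1"
    by (subst (asm) mult_cancel_right) auto
  then have "x * x ^ (CARD('a) - 1) = x"
    by simp
  moreover have "CARD('a) = Suc (CARD('a) - 1)"
    by (simp add: card_gt_0_iff)
  ultimately show ?thesis
    by (metis power_Suc)
qed (simp add: power_0_left)

context
  assumes char2: "(2 :: 'a :: field) = 0"
begin

lemma char2_add_self: "x + x = (0 :: 'a)"
  by (metis char2 mult_2 mult_zero_left)

lemma char2_uminus: "- x = (x :: 'a)"
  using char2_add_self[of x] by (simp add: eq_neg_iff_add_eq_0)

lemma char2_minus: "x - y = x + (y :: 'a)"
  using char2_uminus[of y] by (metis diff_conv_add_uminus)

lemma char2_add_eq_0_iff: "x + y = 0 \<longleftrightarrow> x = (y :: 'a)"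
  by (metis char2_minus eq_iff_diff_eq_0)

lemma char2_square_add: "(x + y)\<^sup>2 = x\<^sup>2 + (y :: 'a)\<^sup>2"
proof -
  have "(x + y)\<^sup>2 = x\<^sup>2 + y\<^sup>2 + (x * y + x * y)"
    by (simp add: power2_eq_square algebra_simps)
  then show ?thesis
    by (simp add: char2_add_self)
qed

lemma char2_power_two_power_add: "(x + y) ^ (2 ^ i) = x ^ (2 ^ i) + (y :: 'a) ^ (2 ^ i)"
proof (induction i)
  case (Suc i)
  have "(x + y) ^ (2 ^ Suc i) = ((x + y) ^ (2 ^ i))\<^sup>2"
    by (simp add: power_mult [symmetric] mult.commute)
  then show ?case
    by (simp add: Suc.IH char2_square_add power_mult [symmetric] mult.commute)
qed simp

lemma char2_square_inject: "x\<^sup>2 = y\<^sup>2 \<longleftrightarrow> x = (y :: 'a)"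
  by (metis char2_add_eq_0_iff char2_square_add power_eq_0_iff power_zero_numeral)

text \<open>
  Each off-diagonal term is matched by its mirror image and the pair cancels; this is what
  makes alternating matrices behave differently from symmetric ones.
\<close>

lemma char2_sum_symmetric:
  fixes f :: "nat \<Rightarrow> nat \<Rightarrow> 'a"
  assumes "\<And>i j. i < n \<Longrightarrow> j < n \<Longrightarrow> f i j = f j i"
  shows "(\<Sum>i<n. \<Sum>j<n. f i j) = (\<Sum>i<n. f i i)"
  using assms
proof (induction n)
  case (Suc n)
  have "(\<Sum>i<n. f i n) = (\<Sum>j<n. f n j)"
    using Suc.prems by (intro sum.cong) auto
  then show ?case
    using Suc.IH Suc.prems char2_add_self[of "\<Sum>j<n. f n j"]
    by (simp add: sum.distrib add.assoc[symmetric])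
qed simp

lemma field_tr_add: "field_tr r (x + y) = field_tr r x + field_tr r (y :: 'a)"
  by (simp add: field_tr_def char2_power_two_power_add sum.distrib)

end

lemma field_tr_0 [simp]: "field_tr r 0 = 0"
  by (simp add: field_tr_def power_0_left)

context
  fixes r :: nat
  assumes card: "CARD('a :: {field, finite}) = 2 ^ r"
begin

lemmas char2_field = char_two_of_card[OF card]

lemma two_power_exponent_pos: "r > 0"
proof (rule ccontr)
  assume "\<not> r > 0"
  then have "CARD('a) = 1"
    using card by simp
  then show False
    using card_1_singletonE[of "UNIV :: 'a set"] by (metis UNIV_I singletonD zero_neq_one)
qed

lemma field_tr_square: "field_tr r ((x :: 'a)\<^sup>2) = field_tr r x"
proof -
  have "field_tr r (x\<^sup>2) = (\<Sum>i<r. x ^ (2 ^ Suc i))"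
    by (simp add: field_tr_def power_mult)
  also have "\<dots> + x ^ (2 ^ 0) = (\<Sum>i<Suc r. x ^ (2 ^ i))"
    by (subst sum.lessThan_Suc_shift) (simp add: add.commute)
  also have "\<dots> = field_tr r x + x ^ (2 ^ 0)"
    using finite_field_power_card[of x] by (simp add: field_tr_def card)
  finally show ?thesis
    by simp
qed

lemma field_tr_in_prime_field: "field_tr r (x :: 'a) = 0 \<or> field_tr r x = 1"
proof -
  have sq: "(\<Sum>i\<in>I. f i)\<^sup>2 = (\<Sum>i\<in>I. (f i)\<^sup>2)" for f :: "nat \<Rightarrow> 'a" and I
    by (induction I rule: infinite_finite_induct) (auto simp: char2_square_add[OF char2_field])
  have "(field_tr r x)\<^sup>2 = field_tr r (x\<^sup>2)"
    by (simp add: field_tr_def sq power_mult [symmetric] mult.commute)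
  then have "field_tr r x * (field_tr r x - 1) = 0"
    by (simp only: field_tr_square) (simp add: power2_eq_square algebra_simps)
  then show ?thesis
    by auto
qed

lemma square_surj: "surj (\<lambda>x :: 'a. x\<^sup>2)"
  by (intro finite_UNIV_inj_surj injI) (simp_all add: char2_square_inject[OF char2_field])

text \<open>The trace is a polynomial function of degree \<open>2 ^ (r - 1)\<close>, so it has few zeros.\<close>

lemma card_field_tr_kernel_le: "card {x :: 'a. field_tr r x = 0} \<le> 2 ^ (r - 1)"
proof -
  define p :: "'a poly" where "p = (\<Sum>i<r. monom 1 (2 ^ i))"
  have "coeff p 1 = (\<Sum>i<r. if i = 0 then 1 else 0)"
    unfolding p_def coeff_sum coeff_monom by (intro sum.cong) auto
  also have "\<dots> = 1"
    using two_power_exponent_pos by simp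
  finally have p0: "p \<noteq> 0"
    by auto
  have deg: "degree p \<le> 2 ^ (r - 1)"
    unfolding p_def
  proof (intro degree_sum_le)
    fix i assume "i \<in> {..<r}"
    then have "(2 :: nat) ^ i \<le> 2 ^ (r - 1)"
      by (intro power_increasing) auto
    then show "degree (monom (1 :: 'a) (2 ^ i)) \<le> 2 ^ (r - 1)"
      using degree_monom_le order_trans by blast
  qed simp
  have "{x :: 'a. field_tr r x = 0} = {x. poly p x = 0}"
    by (simp add: p_def field_tr_def poly_sum poly_monom)
  then show ?thesis
    using card_poly_roots_bound[OF p0] deg by simp
qed

lemma artin_schreier_translate:
  assumes "x0\<^sup>2 + x0 = (c :: 'a)"
  shows "x\<^sup>2 + x = c \<longleftrightarrow> x = x0 \<or> x = x0 + 1"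
proof -
  note two = char2_field
  have "x\<^sup>2 + x = c \<longleftrightarrow> (x\<^sup>2 + x) + (x0\<^sup>2 + x0) = 0"
    by (simp add: assms char2_add_eq_0_iff[OF two])
  also have "(x\<^sup>2 + x) + (x0\<^sup>2 + x0) = (x + x0) * (x + (x0 + 1))"
    using two by (simp add: power2_eq_square algebra_simps)
  finally show ?thesis
    by (simp add: char2_add_eq_0_iff[OF two])
qed

text \<open>
  The additive form of Hilbert 90. The image of \<open>x \<mapsto> x\<^sup>2 + x\<close> has index \<open>2\<close>, since the
  kernel is \<open>{0, 1}\<close>, and it lies in the kernel of the trace, which is no larger.
\<close>

lemma artin_schreier_solvable:
  assumes "field_tr r (c :: 'a) = 0"
  obtains x where "x\<^sup>2 + x = c"
proof -
  let ?f = "\<lambda>x :: 'a. x\<^sup>2 + x"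
  note two = char2_field
  have fib: "card {x. ?f x = y} \<le> 2" for y
  proof (cases "\<exists>x. ?f x = y")
    case True
    then obtain x0 where x0: "?f x0 = y" ..
    have "{x. ?f x = y} \<subseteq> {x0, x0 + 1}"
      using artin_schreier_translate[of x0] x0 by auto
    then have "card {x. ?f x = y} \<le> card {x0, x0 + 1}"
      by (intro card_mono) auto
    then show ?thesis
      by simp
  qed simp
  have "CARD('a) = (\<Sum>y\<in>range ?f. card {x. ?f x = y})"
    by (subst card_UN_disjoint[symmetric]) (auto intro!: arg_cong[of _ _ card])
  also have "\<dots> \<le> 2 * card (range ?f)"
    using sum_bounded_above[of "range ?f" "\<lambda>y. card {x. ?f x = y}" 2] fib
    by (simp add: mult.commute)
  finally have "2 ^ r \<le> 2 * card (range ?f)"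
    by (simp add: card)
  then have "2 ^ (r - 1) \<le> card (range ?f)"
    using two_power_exponent_pos by (cases r) auto
  moreover have "range ?f \<subseteq> {x. field_tr r x = 0}"
    by (auto simp: field_tr_add[OF two] field_tr_square char2_add_self[OF two])
  ultimately have "range ?f = {x. field_tr r x = 0}"
    using card_field_tr_kernel_le by (intro card_seteq) auto
  then have "c \<in> range ?f"
    using assms by simp
  then show ?thesis
    using that by auto
qed

lemma card_artin_schreier_solutions:
  "card {x :: 'a. x\<^sup>2 + x = c} = (if field_tr r c = 0 then 2 else 0)"
proof (cases "field_tr r c = 0")
  case True
  obtain x0 where x0: "x0\<^sup>2 + x0 = c"
    using artin_schreier_solvable[OF True] .
  then have "{x. x\<^sup>2 + x = c} = {x0, x0 + 1}"
    using artin_schreier_translate by auto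
  then show ?thesis
    using True by simp
next
  case False
  have "x\<^sup>2 + x \<noteq> c" for x
    using False by (auto simp: field_tr_add[OF char2_field] field_tr_square
        char2_add_self[OF char2_field])
  then show ?thesis
    using False by simp
qed

text \<open>
  The substitution \<open>m = \<beta> x\<close> turns the equation into \<open>x\<^sup>2 + x = 1/\<beta>\<^sup>2\<close>, and \<open>1/\<beta>\<^sup>2\<close> has the same
  trace as \<open>1/\<beta>\<close>.
\<close>

lemma card_add_inverse_eq:
  "card {m :: 'a. m \<noteq> 0 \<and> m + inverse m = \<beta>} =
     (if \<beta> = 0 then 1 else if field_tr r (inverse \<beta>) = 0 then 2 else 0)"
proof (cases "\<beta> = 0")
  case True
  have "{m :: 'a. m \<noteq> 0 \<and> m + inverse m = 0} = {1}"
  proof safe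
    fix m :: 'a assume m: "m \<noteq> 0" "m + inverse m = 0"
    then have "m * (m + inverse m) = 0"
      by simp
    then have "m\<^sup>2 + 1\<^sup>2 = 0"
      using m(1) by (simp only: distrib_left right_inverse) (simp add: power2_eq_square)
    then have "m\<^sup>2 = 1\<^sup>2"
      by (simp only: char2_add_eq_0_iff[OF char2_field])
    then show "m = 1"
      by (simp only: char2_square_inject[OF char2_field])
  qed (simp_all add: char2_field)
  then show ?thesis
    using True by simp
next
  case False
  have eqv: "m + inverse m = \<beta> \<longleftrightarrow> (m / \<beta>)\<^sup>2 + m / \<beta> = (inverse \<beta>)\<^sup>2" if "m \<noteq> 0" for m
  proof -
    have "m + inverse m = \<beta> \<longleftrightarrow> m\<^sup>2 + 1 = \<beta> * m"
      using that by (simp add: field_simps power2_eq_square)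
    also have "\<dots> \<longleftrightarrow> (inverse \<beta>)\<^sup>2 * (m\<^sup>2 + 1) = (inverse \<beta>)\<^sup>2 * (\<beta> * m)"
      using False by simp
    also have "(inverse \<beta>)\<^sup>2 * (\<beta> * m) = m / \<beta>"
      using False by (simp add: power2_eq_square divide_inverse)
    also have "(inverse \<beta>)\<^sup>2 * (m\<^sup>2 + 1) = (m / \<beta>)\<^sup>2 + (inverse \<beta>)\<^sup>2"
      by (simp add: power2_eq_square divide_inverse algebra_simps)
    also have "(m / \<beta>)\<^sup>2 + (inverse \<beta>)\<^sup>2 = m / \<beta> \<longleftrightarrow>
        ((m / \<beta>)\<^sup>2 + m / \<beta>) + (inverse \<beta>)\<^sup>2 = 0"
      by (subst char2_add_eq_0_iff[OF char2_field, symmetric]) (simp only: add_ac)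
    also have "\<dots> \<longleftrightarrow> (m / \<beta>)\<^sup>2 + m / \<beta> = (inverse \<beta>)\<^sup>2"
      by (rule char2_add_eq_0_iff[OF char2_field])
    finally show ?thesis .
  qed
  have "bij_betw (\<lambda>m. m / \<beta>) {m :: 'a. m \<noteq> 0 \<and> m + inverse m = \<beta>}
      {x. x\<^sup>2 + x = (inverse \<beta>)\<^sup>2}"
  proof (rule bij_betw_byWitness[of _ "\<lambda>x. x * \<beta>"])
    show "(\<lambda>x. x * \<beta>) ` {x. x\<^sup>2 + x = (inverse \<beta>)\<^sup>2} \<subseteq> {m. m \<noteq> 0 \<and> m + inverse m = \<beta>}"
    proof safe
      fix x assume x: "x\<^sup>2 + x = (inverse \<beta>)\<^sup>2"
      then have "x \<noteq> 0"
        using False by auto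
      then show "x * \<beta> + inverse (x * \<beta>) = \<beta>"
        using False x eqv[of "x * \<beta>"] by simp
    qed (use False in auto)
  qed (use False eqv in auto)
  then show ?thesis
    using False by (simp add: bij_betw_same_card card_artin_schreier_solutions field_tr_square)
qed

lemma add_char_add: "add_char r (x + y) = add_char r x * add_char r (y :: 'a)"
  using field_tr_in_prime_field[of x] field_tr_in_prime_field[of y]
  by (auto simp: add_char_def field_tr_add[OF char2_field] char2_field)

lemma add_char_0: "add_char r 0 = 1"
  by (simp add: add_char_def)

lemma add_char_sum: "add_char r (\<Sum>i\<in>I. f i) = (\<Prod>i\<in>I. add_char r (f i :: 'a))"
  by (induction I rule: infinite_finite_induct) (simp_all add: add_char_add add_char_0)

text \<open>
  Translating the summation variable by an element of trace one changes the sign of the sum.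
\<close>

lemma sum_add_char: "(\<Sum>a\<in>UNIV. add_char r (a * s)) = (if s = (0 :: 'a) then 2 ^ r else 0)"
proof (cases "s = 0")
  case True
  then show ?thesis
    by (simp add: add_char_def card)
next
  case False
  have "(2 :: nat) ^ (r - 1) < 2 ^ r"
    using two_power_exponent_pos by (intro power_strict_increasing) auto
  then have "card {x :: 'a. field_tr r x = 0} < CARD('a)"
    unfolding card using card_field_tr_kernel_le by (rule le_less_trans[rotated])
  then obtain y :: 'a where y: "field_tr r y \<noteq> 0"
    by fastforce
  let ?S = "\<Sum>a\<in>UNIV. add_char r (a * s)"
  have "?S = (\<Sum>a\<in>UNIV. add_char r ((a + y / s) * s))"
    by (rule sum.reindex_bij_witness[of _ "\<lambda>a. a + y / s" "\<lambda>a. a - y / s"]) auto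
  also have "\<dots> = - ?S"
    using False y by (simp add: distrib_right add_char_add sum_negf) (simp add: add_char_def sum_negf)
  finally show ?thesis
    using False by simp
qed

lemma sum_add_char_add_inverse:
  assumes "a \<noteq> (0 :: 'a)"
  shows "(\<Sum>m\<in>UNIV - {0}. add_char r (a * (m + inverse m))) = kloosterman r (a\<^sup>2)"
  unfolding kloosterman_def
  by (rule sum.reindex_bij_witness[of _ "\<lambda>x. x / a" "\<lambda>m. a * m"])
     (use assms in \<open>auto simp: field_simps power2_eq_square\<close>)

end

section \<open>Trace codes: weight distributions and power moments\<close>

text \<open>
  A binary word is determined by its support.
\<close>

lemma weight_dist_trace_code:
  "weight_dist (trace_code N g) j =
     card {S. S \<subseteq> {..<N} \<and> card S = j \<and> (\<Sum>i\<in>S. mat_trace (g i)) = 0}"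
proof -
  have sum_supp: "(\<Sum>i<N. of_bit (u $ i) * mat_trace (g i)) =
      (\<Sum>i\<in>{i. i < N \<and> u $ i \<noteq> 0}. mat_trace (g i))" for u :: "bit vec"
  proof -
    have "(\<Sum>i<N. of_bit (u $ i) * mat_trace (g i)) =
        (\<Sum>i<N. if u $ i \<noteq> 0 then mat_trace (g i) else 0)"
      by (intro sum.cong) auto
    also have "\<dots> = (\<Sum>i\<in>{i \<in> {..<N}. u $ i \<noteq> 0}. mat_trace (g i))"
      by (rule sum.inter_filter[symmetric]) simp
    finally show ?thesis
      by simp
  qed
  have code_iff: "u \<in> trace_code N g \<longleftrightarrow> u \<in> carrier_vec N \<and>
      (\<Sum>i\<in>{i. i < N \<and> u $ i \<noteq> 0}. mat_trace (g i)) = 0" for u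
    by (simp only: trace_code_def mem_Collect_eq sum_supp)
  have "bij_betw (\<lambda>u. {i. i < N \<and> u $ i \<noteq> 0}) {u \<in> trace_code N g. hamming_weight u = j}
      {S. S \<subseteq> {..<N} \<and> card S = j \<and> (\<Sum>i\<in>S. mat_trace (g i)) = 0}"
  proof (rule bij_betw_byWitness[of _ "\<lambda>S. vec N (\<lambda>i. of_bool (i \<in> S))"])
    show "(\<lambda>S. vec N (\<lambda>i. of_bool (i \<in> S))) `
        {S. S \<subseteq> {..<N} \<and> card S = j \<and> (\<Sum>i\<in>S. mat_trace (g i)) = 0}
        \<subseteq> {u \<in> trace_code N g. hamming_weight u = j}"
    proof safe
      fix S assume S: "S \<subseteq> {..<N}" "(\<Sum>i\<in>S. mat_trace (g i)) = 0"
      let ?u = "vec N (\<lambda>i. of_bool (i \<in> S)) :: bit vec"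
      have supp: "{i. i < N \<and> ?u $ i \<noteq> 0} = S"
        using S by auto
      then show "hamming_weight ?u = card S"
        by (simp add: hamming_weight_def)
      show "?u \<in> trace_code N g"
        unfolding code_iff supp using S by simp
    qed
  qed (auto simp: code_iff hamming_weight_def intro!: eq_vecI)
  then show ?thesis
    unfolding weight_dist_def by (rule bij_betw_same_card)
qed

lemma sum_over_values:
  fixes f :: "'b :: finite \<Rightarrow> 'c :: comm_semiring_1"
  assumes "finite S"
  shows "(\<Sum>i\<in>S. f (t i)) = (\<Sum>\<beta>\<in>UNIV. of_nat (card {i \<in> S. t i = \<beta>}) * f \<beta>)"
proof -
  have "(\<Sum>i\<in>S. f (t i)) = (\<Sum>\<beta>\<in>UNIV. \<Sum>i\<in>{i \<in> S. t i = \<beta>}. f (t i))"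
    by (rule sum.group[symmetric]) (use assms in auto)
  then show ?thesis
    by simp
qed

text \<open>
  A subset is chosen by choosing its intersections with the fibres of \<open>t\<close> independently.
\<close>

lemma card_subsets_with_value_counts:
  fixes t :: "'i \<Rightarrow> 'b :: finite"
  assumes "finite I"
  shows "card {S. S \<subseteq> I \<and> (\<forall>\<beta>. card {i \<in> S. t i = \<beta>} = \<nu> \<beta>)} =
    (\<Prod>\<beta>\<in>UNIV. card {i \<in> I. t i = \<beta>} choose \<nu> \<beta>)"
proof -
  let ?P = "\<lambda>\<beta>. {T. T \<subseteq> {i \<in> I. t i = \<beta>} \<and> card T = \<nu> \<beta>}"
  have "bij_betw (\<lambda>S \<beta>. {i \<in> S. t i = \<beta>}) {S. S \<subseteq> I \<and> (\<forall>\<beta>. card {i \<in> S. t i = \<beta>} = \<nu> \<beta>)}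
      (PiE UNIV ?P)"
  proof (rule bij_betw_byWitness[of _ "\<lambda>f. \<Union>\<beta>. f \<beta>"])
    have restrict: "{i \<in> \<Union>\<beta>. f \<beta>. t i = \<beta>} = f \<beta>" if "f \<in> PiE UNIV ?P" for f \<beta>
      using that by (fastforce simp: PiE_UNIV_domain)
    then show "\<forall>f\<in>PiE UNIV ?P. (\<lambda>\<beta>. {i \<in> \<Union>\<beta>. f \<beta>. t i = \<beta>}) = f"
      by blast
    show "(\<lambda>f. \<Union>\<beta>. f \<beta>) ` PiE UNIV ?P
        \<subseteq> {S. S \<subseteq> I \<and> (\<forall>\<beta>. card {i \<in> S. t i = \<beta>} = \<nu> \<beta>)}"
    proof (intro image_subsetI CollectI conjI allI)
      fix f \<beta> assume f: "f \<in> PiE UNIV ?P"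
      show "(\<Union>\<beta>. f \<beta>) \<subseteq> I"
        using f by (fastforce simp: PiE_UNIV_domain)
      show "card {i \<in> \<Union>\<beta>. f \<beta>. t i = \<beta>} = \<nu> \<beta>"
        unfolding restrict[OF f] using f by (auto simp: PiE_UNIV_domain)
    qed
  qed (auto simp: PiE_UNIV_domain)
  then have "card {S. S \<subseteq> I \<and> (\<forall>\<beta>. card {i \<in> S. t i = \<beta>} = \<nu> \<beta>)} = card (PiE UNIV ?P)"
    by (rule bij_betw_same_card)
  also have "\<dots> = (\<Prod>\<beta>\<in>UNIV. card {i \<in> I. t i = \<beta>} choose \<nu> \<beta>)"
    using assms by (simp add: card_PiE n_subsets)
  finally show ?thesis .
qed

text \<open>
  The size and the sum of \<open>S\<close> depend only on how many of its indices carry each value.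
\<close>

lemma card_zero_sum_subsets:
  fixes t :: "'i \<Rightarrow> 'a :: {field, finite}"
  assumes "finite I"
  shows "card {S. S \<subseteq> I \<and> card S = j \<and> (\<Sum>i\<in>S. t i) = 0} =
    (\<Sum>\<nu>\<in>weight_families j. \<Prod>\<beta>\<in>UNIV. card {i \<in> I. t i = \<beta>} choose \<nu> \<beta>)"
proof -
  let ?A = "\<lambda>\<nu>. {S. S \<subseteq> I \<and> (\<forall>\<beta>. card {i \<in> S. t i = \<beta>} = \<nu> \<beta>)}"
  have fam: "(card S = j \<and> (\<Sum>i\<in>S. t i) = 0) \<longleftrightarrow>
      (\<lambda>\<beta>. card {i \<in> S. t i = \<beta>}) \<in> weight_families j" if "S \<subseteq> I" for S
  proof -
    have "finite S"
      using that assms finite_subset by blast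
    then show ?thesis
      using sum_over_values[of S "\<lambda>_. 1 :: nat" t] sum_over_values[of S "\<lambda>x. x" t]
      by (simp add: weight_families_def)
  qed
  have "{S. S \<subseteq> I \<and> card S = j \<and> (\<Sum>i\<in>S. t i) = 0} = (\<Union>\<nu>\<in>weight_families j. ?A \<nu>)"
  proof (intro equalityI subsetI)
    fix S assume "S \<in> {S. S \<subseteq> I \<and> card S = j \<and> (\<Sum>i\<in>S. t i) = 0}"
    then show "S \<in> (\<Union>\<nu>\<in>weight_families j. ?A \<nu>)"
      using fam[of S] by (intro UN_I[of "\<lambda>\<beta>. card {i \<in> S. t i = \<beta>}"]) auto
  next
    fix S assume "S \<in> (\<Union>\<nu>\<in>weight_families j. ?A \<nu>)"
    then obtain \<nu> where \<nu>: "\<nu> \<in> weight_families j" "S \<subseteq> I" "\<nu> = (\<lambda>\<beta>. card {i \<in> S. t i = \<beta>})"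
      by auto
    then show "S \<in> {S. S \<subseteq> I \<and> card S = j \<and> (\<Sum>i\<in>S. t i) = 0}"
      using fam[of S] by simp
  qed
  also have "card \<dots> = (\<Sum>\<nu>\<in>weight_families j. card (?A \<nu>))"
    using assms by (intro card_UN_disjoint) (auto simp: finite_weight_families)
  finally show ?thesis
    by (simp add: card_subsets_with_value_counts[OF assms])
qed

text \<open>
  Induction on \<open>h\<close>: the factor \<open>x\<close> is absorbed by
  \<open>x * (x choose t) = (t + 1) * (x choose (t + 1)) + t * (x choose t)\<close>, which matches the recursion
  of the Stirling numbers.
\<close>

lemma power_eq_sum_Stirling:
  "x ^ h = (\<Sum>t\<le>h. fact t * Stirling h t * (x choose t))"
proof (induction h)
  case (Suc h)
  have absorb: "x * (x choose t) = Suc t * (x choose Suc t) + t * (x choose t)" for t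
  proof (cases "t \<le> x")
    case True
    have "Suc t * (x choose Suc t) = (x - t) * (x choose t)"
      by (metis binomial_absorb_comp binomial_absorption)
    then show ?thesis
      using True by (simp add: add_mult_distrib[symmetric])
  qed (simp add: not_le binomial_eq_0)
  have "x ^ Suc h = (\<Sum>t\<le>h. fact t * Stirling h t * (x * (x choose t)))"
    by (simp add: Suc.IH sum_distrib_left mult_ac)
  also have "\<dots> = (\<Sum>t\<le>h. fact (Suc t) * Stirling h t * (x choose Suc t))
      + (\<Sum>t\<le>h. fact t * (t * Stirling h t) * (x choose t))"
    unfolding absorb sum.distrib[symmetric] by (intro sum.cong) (simp_all add: algebra_simps)
  also have "(\<Sum>t\<le>h. fact t * (t * Stirling h t) * (x choose t)) =
      (\<Sum>t\<le>Suc h. fact t * (t * Stirling h t) * (x choose t))"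
    by simp
  also have "\<dots> = (\<Sum>t\<le>h. fact (Suc t) * (Suc t * Stirling h (Suc t)) * (x choose Suc t))"
    by (subst sum.atMost_Suc_shift) simp
  also have "(\<Sum>t\<le>h. fact (Suc t) * Stirling h t * (x choose Suc t)) + \<dots> =
      (\<Sum>t\<le>h. fact (Suc t) * Stirling (Suc h) (Suc t) * (x choose Suc t))"
    unfolding sum.distrib[symmetric] by (intro sum.cong) (simp_all add: algebra_simps)
  also have "\<dots> = (\<Sum>t\<le>Suc h. fact t * Stirling (Suc h) t * (x choose t))"
    by (subst sum.atMost_Suc_shift) simp
  finally show ?case .
qed simp

lemma prod_one_minus:
  fixes f :: "'i \<Rightarrow> 'c :: comm_ring_1"
  assumes "finite T"
  shows "(\<Prod>i\<in>T. 1 - f i) = (\<Sum>S\<in>Pow T. (- 1) ^ card S * (\<Prod>i\<in>S. f i))"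
  using assms
proof (induction T)
  case (insert x T)
  have "inj_on (insert x) (Pow T)"
    using insert.hyps by (auto simp: inj_on_def)
  moreover have "Pow T \<inter> insert x ` Pow T = {}"
    using insert.hyps by auto
  moreover have "(\<Sum>S\<in>Pow T. (- 1) ^ card (insert x S) * (\<Prod>i\<in>insert x S. f i)) =
      (\<Sum>S\<in>Pow T. - f x * ((- 1) ^ card S * (\<Prod>i\<in>S. f i)))"
  proof (intro sum.cong refl)
    fix S assume "S \<in> Pow T"
    then have "finite S" "x \<notin> S"
      using insert.hyps finite_subset by auto
    then show "(- 1) ^ card (insert x S) * (\<Prod>i\<in>insert x S. f i) =
        - f x * ((- 1) ^ card S * (\<Prod>i\<in>S. f i))"
      by simp
  qed
  ultimately show ?case
    using insert by (simp add: Pow_insert sum.union_disjoint sum.reindex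
        sum_negf sum_distrib_left left_diff_distrib sum_subtractf)
qed simp

lemma card_supersets_of_size:
  assumes "finite I" "S \<subseteq> I" "card S \<le> t"
  shows "card {T. S \<subseteq> T \<and> T \<subseteq> I \<and> card T = t} = (card I - card S) choose (t - card S)"
proof -
  have fin: "finite S"
    using assms finite_subset by blast
  have "bij_betw (\<lambda>T. T - S) {T. S \<subseteq> T \<and> T \<subseteq> I \<and> card T = t}
      {U. U \<subseteq> I - S \<and> card U = t - card S}"
  proof (rule bij_betw_byWitness[of _ "\<lambda>U. U \<union> S"])
    show "(\<lambda>U. U \<union> S) ` {U. U \<subseteq> I - S \<and> card U = t - card S}
        \<subseteq> {T. S \<subseteq> T \<and> T \<subseteq> I \<and> card T = t}"
    proof safe
      fix U assume U: "U \<subseteq> I - S" "card U = t - card S"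
      then have "card (U \<union> S) = card U + card S"
        using assms(1) fin by (intro card_Un_disjoint) (auto intro: finite_subset)
      then show "card (U \<union> S) = t"
        using U assms by simp
    qed (use assms in auto)
  qed (use fin in \<open>auto simp: card_Diff_subset\<close>)
  then have "card {T. S \<subseteq> T \<and> T \<subseteq> I \<and> card T = t} = card {U. U \<subseteq> I - S \<and> card U = t - card S}"
    by (rule bij_betw_same_card)
  then show ?thesis
    using assms fin by (simp add: n_subsets card_Diff_subset)
qed

context
  fixes r :: nat
  assumes card: "CARD('a :: {field, finite}) = 2 ^ r"
begin

text \<open>
  For a set \<open>T\<close> of \<open>t\<close> indices the product of the factors \<open>1 - \<lambda>(a s i)\<close> is \<open>2 ^ t\<close> if \<open>\<lambda>(a s i) = - 1\<close>
  on all of \<open>T\<close>, and zero otherwise. Expanding the product over the subsets \<open>S\<close> of \<open>T\<close> and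
  summing over \<open>a\<close> leaves, by orthogonality, the subsets with sum zero, each of which lies in
  \<open>(|I| - |S|) choose (t - |S|)\<close> sets \<open>T\<close>.
\<close>

lemma sum_choose_char_weight:
  fixes s :: "'i \<Rightarrow> 'a"
  assumes "finite I"
  shows "2 ^ t * (\<Sum>a\<in>UNIV. real (card {i \<in> I. add_char r (a * s i) = - 1} choose t)) =
    2 ^ r * (\<Sum>S | S \<subseteq> I \<and> card S \<le> t \<and> (\<Sum>i\<in>S. s i) = 0.
      (- 1) ^ card S * real ((card I - card S) choose (t - card S)))"
proof -
  let ?\<T> = "{T. T \<subseteq> I \<and> card T = t}"
  let ?l = "\<lambda>a x. add_char r (a * x :: 'a)"
  have finT: "finite ?\<T>"
    using assms by simp
  have choose: "2 ^ t * real (card {i \<in> I. ?l a (s i) = - 1} choose t) =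
      (\<Sum>T\<in>?\<T>. \<Prod>i\<in>T. 1 - ?l a (s i))" for a
  proof -
    have "(\<Prod>i\<in>T. 1 - ?l a (s i)) = (if T \<subseteq> {i \<in> I. ?l a (s i) = - 1} then 2 ^ t else 0)"
      if "T \<in> ?\<T>" for T
    proof (cases "T \<subseteq> {i \<in> I. ?l a (s i) = - 1}")
      case True
      have "(\<Prod>i\<in>T. 1 - ?l a (s i)) = (\<Prod>i\<in>T. 2)"
      proof (rule prod.cong[OF refl])
        fix i assume "i \<in> T"
        then have "?l a (s i) = - 1"
          using True by blast
        then show "1 - ?l a (s i) = 2"
          by simp
      qed
      then show ?thesis
        using True that by simp
    next
      case False
      then obtain i where i: "i \<in> T" "i \<notin> {i \<in> I. ?l a (s i) = - 1}"
        by (meson subsetI)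
      moreover have "T \<subseteq> I"
        using that by simp
      ultimately have "?l a (s i) \<noteq> - 1"
        by (simp add: subset_iff)
      then have "1 - ?l a (s i) = 0"
        unfolding add_char_def by (simp split: if_splits)
      then have "(\<Prod>i\<in>T. 1 - ?l a (s i)) = 0"
        using i(1) finite_subset[OF \<open>T \<subseteq> I\<close> assms] by (intro prod_zero bexI[of _ i])
      then show ?thesis
        using False by simp
    qed
    then have "(\<Sum>T\<in>?\<T>. \<Prod>i\<in>T. 1 - ?l a (s i)) =
        (\<Sum>T\<in>?\<T>. if T \<subseteq> {i \<in> I. ?l a (s i) = - 1} then 2 ^ t else 0)"
      by (rule sum.cong[OF refl])
    also have "\<dots> = (\<Sum>T\<in>{T \<in> ?\<T>. T \<subseteq> {i \<in> I. ?l a (s i) = - 1}}. 2 ^ t)"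
      by (rule sum.inter_filter[symmetric, OF finT])
    also have "{T \<in> ?\<T>. T \<subseteq> {i \<in> I. ?l a (s i) = - 1}} =
        {T. T \<subseteq> {i \<in> I. ?l a (s i) = - 1} \<and> card T = t}"
      by auto
    also have "(\<Sum>T\<in>\<dots>. 2 ^ t) = 2 ^ t * real (card {i \<in> I. ?l a (s i) = - 1} choose t)"
      using assms by (simp add: n_subsets)
    finally show ?thesis ..
  qed
  have "2 ^ t * (\<Sum>a\<in>UNIV. real (card {i \<in> I. ?l a (s i) = - 1} choose t)) =
      (\<Sum>a\<in>UNIV. \<Sum>T\<in>?\<T>. \<Sum>S\<in>Pow T. (- 1) ^ card S * ?l a (\<Sum>i\<in>S. s i))"
  proof (subst sum_distrib_left, unfold choose, intro sum.cong refl)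
    fix a T assume "T \<in> ?\<T>"
    then have "finite T"
      using assms by (auto intro: finite_subset)
    then show "(\<Prod>i\<in>T. 1 - ?l a (s i)) = (\<Sum>S\<in>Pow T. (- 1) ^ card S * ?l a (\<Sum>i\<in>S. s i))"
      by (simp add: prod_one_minus add_char_sum[OF card] sum_distrib_left)
  qed
  also have "\<dots> = (\<Sum>T\<in>?\<T>. \<Sum>S\<in>Pow T. (- 1) ^ card S * (\<Sum>a\<in>UNIV. ?l a (\<Sum>i\<in>S. s i)))"
    unfolding sum_distrib_left by (subst sum.swap, intro sum.cong refl, rule sum.swap)
  also have "\<dots> = (\<Sum>T\<in>?\<T>. \<Sum>S\<in>Pow T. if (\<Sum>i\<in>S. s i) = 0 then 2 ^ r * (- 1) ^ card S else 0)"
    by (intro sum.cong refl) (simp add: sum_add_char[OF card])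
  also have "\<dots> = (\<Sum>T\<in>?\<T>. \<Sum>S | S \<in> Pow I \<and> S \<subseteq> T.
      if (\<Sum>i\<in>S. s i) = 0 then 2 ^ r * (- 1) ^ card S else 0)"
    by (intro sum.cong refl) auto
  also have "\<dots> = (\<Sum>S\<in>Pow I. \<Sum>T | T \<in> ?\<T> \<and> S \<subseteq> T.
      if (\<Sum>i\<in>S. s i) = 0 then 2 ^ r * (- 1) ^ card S else 0)"
    using finT assms by (intro sum.swap_restrict) auto
  also have "\<dots> = (\<Sum>S\<in>Pow I. if card S \<le> t \<and> (\<Sum>i\<in>S. s i) = 0
      then 2 ^ r * ((- 1) ^ card S * real ((card I - card S) choose (t - card S))) else 0)"
  proof (intro sum.cong refl)
    fix S assume S: "S \<in> Pow I"
    have "card {T. T \<in> ?\<T> \<and> S \<subseteq> T} =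
        (if card S \<le> t then (card I - card S) choose (t - card S) else 0)"
    proof (cases "card S \<le> t")
      case True
      have "{T. T \<in> ?\<T> \<and> S \<subseteq> T} = {T. S \<subseteq> T \<and> T \<subseteq> I \<and> card T = t}"
        by auto
      then show ?thesis
        using True S card_supersets_of_size[OF assms, of S t] by simp
    next
      case False
      then have "{T. T \<in> ?\<T> \<and> S \<subseteq> T} = {}"
        using assms by (auto dest: card_mono[rotated] intro: finite_subset)
      then show ?thesis
        using False by (simp only: card.empty) simp
    qed
    then show "(\<Sum>T | T \<in> ?\<T> \<and> S \<subseteq> T.
        if (\<Sum>i\<in>S. s i) = 0 then 2 ^ r * (- 1) ^ card S else 0) =
        (if card S \<le> t \<and> (\<Sum>i\<in>S. s i) = 0
          then 2 ^ r * ((- 1) ^ card S * real ((card I - card S) choose (t - card S))) else 0)"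
      by simp
  qed
  also have "\<dots> = (\<Sum>S\<in>{S \<in> Pow I. card S \<le> t \<and> (\<Sum>i\<in>S. s i) = 0}.
      2 ^ r * ((- 1) ^ card S * real ((card I - card S) choose (t - card S))))"
    using assms by (intro sum.inter_filter[symmetric]) simp
  also have "{S \<in> Pow I. card S \<le> t \<and> (\<Sum>i\<in>S. s i) = 0} =
      {S. S \<subseteq> I \<and> card S \<le> t \<and> (\<Sum>i\<in>S. s i) = 0}"
    by auto
  finally show ?thesis
    by (simp add: sum_distrib_left)
qed

text \<open>
  The power moments of Pless, for the words \<open>i \<mapsto> tr(a s i)\<close> of the dual code. The sum
  runs over the field elements \<open>a\<close> and not over the distinct words, so that the factor is the
  order of the field and not that of the dual code.
\<close>

lemma power_moment_identity:
  fixes s :: "nat \<Rightarrow> 'a" and N :: nat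
  defines "c \<equiv> \<lambda>j. card {S. S \<subseteq> {..<N} \<and> card S = j \<and> (\<Sum>i\<in>S. s i) = 0}"
  shows "(\<Sum>a\<in>UNIV. real (card {i \<in> {..<N}. add_char r (a * s i) = - 1}) ^ h) =
    2 ^ r * (\<Sum>j=0..min N h. (- 1) ^ j * real (c j) *
      (\<Sum>t=j..h. fact t * real (Stirling h t) / 2 ^ t
         * real (int_binom (int N - int j) (int N - int t))))"
proof -
  let ?w = "\<lambda>a. card {i \<in> {..<N}. add_char r (a * s i) = - 1}"
  have binom: "int_binom (int N - int j) (int N - int t) = (N - j) choose (t - j)"
    if "j \<le> t" "j \<le> N" for j t
  proof (cases "t \<le> N")
    case True
    then have "nat (int N - int j) = N - j" "nat (int N - int t) = N - t"
      by auto
    then have "int_binom (int N - int j) (int N - int t) = (N - j) choose (N - t)"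
      using that True by (simp add: int_binom_def)
    also have "\<dots> = (N - j) choose (N - j - (N - t))"
      using that True by (intro binomial_symmetric) auto
    finally show ?thesis
      using that True by simp
  qed (use that in \<open>simp add: int_binom_def\<close>)
  have inner: "2 ^ t * (\<Sum>a\<in>UNIV. real (?w a choose t)) =
      2 ^ r * (\<Sum>j=0..min N t. (- 1) ^ j * real (c j) * real ((N - j) choose (t - j)))" for t
  proof -
    let ?Z = "{S. S \<subseteq> {..<N} \<and> card S \<le> t \<and> (\<Sum>i\<in>S. s i) = 0}"
    have cardN: "card S \<le> N" if "S \<in> ?Z" for S
      using that card_mono[of "{..<N}" S] by simp
    have "(\<Sum>S\<in>?Z. (- 1) ^ card S * real ((N - card S) choose (t - card S))) =
        (\<Sum>j=0..min N t. \<Sum>S\<in>{S \<in> ?Z. card S = j}.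
          (- 1) ^ card S * real ((N - card S) choose (t - card S)))"
      by (rule sum.group[symmetric]) (use cardN in auto)
    also have "\<dots> = (\<Sum>j=0..min N t. (- 1) ^ j * real (c j) * real ((N - j) choose (t - j)))"
    proof (intro sum.cong refl)
      fix j assume "j \<in> {0..min N t}"
      then have "{S \<in> ?Z. card S = j} =
          {S. S \<subseteq> {..<N} \<and> card S = j \<and> (\<Sum>i\<in>S. s i) = 0}"
        by auto
      then have "c j = card {S \<in> ?Z. card S = j}"
        by (simp add: c_def)
      then show "(\<Sum>S\<in>{S \<in> ?Z. card S = j}.
          (- 1) ^ card S * real ((N - card S) choose (t - card S))) =
          (- 1) ^ j * real (c j) * real ((N - j) choose (t - j))"
        by simp
    qed
    finally show "2 ^ t * (\<Sum>a\<in>UNIV. real (?w a choose t)) =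
        2 ^ r * (\<Sum>j=0..min N t. (- 1) ^ j * real (c j) * real ((N - j) choose (t - j)))"
      using sum_choose_char_weight[of "{..<N}" t s] by simp
  qed
  define F where "F = (\<lambda>j. (- 1) ^ j * real (c j))"
  define G where "G = (\<lambda>t. fact t * real (Stirling h t) / 2 ^ t)"
  have "(\<Sum>a\<in>UNIV. real (?w a) ^ h) =
      (\<Sum>a\<in>UNIV. \<Sum>t\<le>h. fact t * real (Stirling h t) * real (?w a choose t))"
  proof (intro sum.cong refl)
    fix a
    have "real (?w a) ^ h = real (?w a ^ h)"
      by simp
    then show "real (?w a) ^ h = (\<Sum>t\<le>h. fact t * real (Stirling h t) * real (?w a choose t))"
      unfolding power_eq_sum_Stirling by simp
  qed
  also have "\<dots> = (\<Sum>t\<le>h. fact t * real (Stirling h t) / 2 ^ t *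
      (2 ^ t * (\<Sum>a\<in>UNIV. real (?w a choose t))))"
    by (subst sum.swap) (simp add: sum_distrib_left mult.assoc)
  also have "\<dots> = (\<Sum>t\<le>h. G t * (2 ^ r * (\<Sum>j=0..min N t. F j * real ((N - j) choose (t - j)))))"
    by (simp only: inner F_def G_def)
  also have "\<dots> = 2 ^ r * (\<Sum>t\<le>h. \<Sum>j=0..min N t. F j * (G t * real ((N - j) choose (t - j))))"
    by (simp add: sum_distrib_left mult_ac)
  also have "(\<Sum>t\<le>h. \<Sum>j=0..min N t. F j * (G t * real ((N - j) choose (t - j)))) =
      (\<Sum>t\<le>h. \<Sum>j | j \<in> {0..min N h} \<and> j \<le> t. F j * (G t * real ((N - j) choose (t - j))))"
    by (intro sum.cong) auto
  also have "\<dots> = (\<Sum>j=0..min N h. \<Sum>t | t \<in> {..h} \<and> j \<le> t. F j * (G t * real ((N - j) choose (t - j))))"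
    by (rule sum.swap_restrict) auto
  also have "\<dots> = (\<Sum>j=0..min N h. F j *
      (\<Sum>t=j..h. G t * real (int_binom (int N - int j) (int N - int t))))"
    unfolding sum_distrib_left by (intro sum.cong) (auto simp: binom)
  finally show ?thesis
    by (simp only: F_def G_def)
qed

end

section \<open>Counting symmetric and nonsingular matrices\<close>

lemma finite_carrier_mat: "finite (carrier_mat n m :: 'a :: finite mat set)"
proof (rule finite_subset)
  show "(carrier_mat n m :: 'a mat set) \<subseteq>
      (\<lambda>f. mat n m f) ` (PiE ({..<n} \<times> {..<m}) (\<lambda>_. UNIV))"
  proof
    fix A :: "'a mat" assume "A \<in> carrier_mat n m"
    then have "A = mat n m (restrict (\<lambda>ij. A $$ ij) ({..<n} \<times> {..<m}))"
      by (intro eq_matI) auto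
    then show "A \<in> (\<lambda>f. mat n m f) ` (PiE ({..<n} \<times> {..<m}) (\<lambda>_. UNIV))"
      by (metis (no_types, lifting) UNIV_I image_eqI restrict_PiE_iff)
  qed
qed (intro finite_imageI finite_PiE, auto)

lemma bij_betw_vec: "bij_betw (\<lambda>f. vec n f) (PiE {..<n} (\<lambda>_. UNIV)) (carrier_vec n :: 'a vec set)"
  by (rule bij_betw_byWitness[of _ "\<lambda>v. restrict (\<lambda>i. v $ i) {..<n}"])
     (auto simp: PiE_def extensional_def fun_eq_iff intro!: eq_vecI)

lemma card_carrier_vec: "card (carrier_vec n :: 'a :: finite vec set) = CARD('a) ^ n"
  using bij_betw_same_card[OF bij_betw_vec[of n, where ?'a = 'a]] by (simp add: card_PiE)

lemma finite_carrier_vec: "finite (carrier_vec n :: 'a :: finite vec set)"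
  using bij_betw_finite[OF bij_betw_vec[of n, where ?'a = 'a]] by (simp add: finite_PiE)

lemma index_mult_mat_sum:
  assumes "A \<in> carrier_mat n m" "B \<in> carrier_mat m l" "i < n" "j < l"
  shows "(A * B) $$ (i, j) = (\<Sum>a<m. A $$ (i, a) * B $$ (a, j))"
  using assms by (auto simp: scalar_prod_def atLeast0LessThan intro!: sum.cong)

lemma card_equal_fibres:
  assumes "finite X" "finite V" "f ` X \<subseteq> V" "\<And>v. v \<in> V \<Longrightarrow> card {x \<in> X. f x = v} = c"
  shows "card X = card V * c"
proof -
  have "card X = (\<Sum>v\<in>V. card {x \<in> X. f x = v})"
    using sum.group[OF assms(1-3), of "\<lambda>_. 1 :: nat"] by simp
  then show ?thesis
    using assms(4) by simp
qed


definition GL :: "nat \<Rightarrow> 'a :: field mat set" where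
  "GL n = {M \<in> carrier_mat n n. det M \<noteq> 0}"

definition symmetric_mats :: "nat \<Rightarrow> 'a mat set" where
  "symmetric_mats n = {E \<in> carrier_mat n n. transpose_mat E = E}"

definition GL_alternating :: "nat \<Rightarrow> 'a :: field mat set" where
  "GL_alternating n = {M \<in> GL n. alternating_mat M}"

definition leading_block :: "nat \<Rightarrow> 'a mat \<Rightarrow> 'a mat" where
  "leading_block k M = mat k k (\<lambda>(i, j). M $$ (i, j))"

lemma leading_block_carrier [simp]: "leading_block k M \<in> carrier_mat k k"
  by (simp add: leading_block_def)

lemma leading_block_dim [simp]:
  "dim_row (leading_block k M) = k" "dim_col (leading_block k M) = k"
  by (simp_all add: leading_block_def)

lemma leading_block_index [simp]:
  "i < k \<Longrightarrow> j < k \<Longrightarrow> leading_block k M $$ (i, j) = M $$ (i, j)"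
  by (simp add: leading_block_def)

lemma GL_carrier: "M \<in> GL n \<Longrightarrow> M \<in> carrier_mat n n"
  by (simp add: GL_def)

lemma GL_inverse:
  assumes "M \<in> GL n"
  obtains M' where "M' \<in> GL n" "M * M' = 1\<^sub>m n" "M' * M = 1\<^sub>m n"
proof -
  obtain M' where M': "M' \<in> carrier_mat n n" "M * M' = 1\<^sub>m n" "M' * M = 1\<^sub>m n"
    using det_non_zero_imp_unit[of M n "()"] assms
    by (auto simp: GL_def Units_def ring_mat_def)
  then have "det M * det M' = 1"
    using assms det_mult[of M n M'] by (simp add: GL_def)
  then have "M' \<in> GL n"
    using M' by (auto simp: GL_def)
  then show ?thesis
    using M' that by blast
qed

lemma GL_I:
  assumes "M \<in> carrier_mat n n" "M' \<in> carrier_mat n n" "M * M' = 1\<^sub>m n"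
  shows "M \<in> GL n"
proof -
  have "det M * det M' = 1"
    using assms det_mult[of M n M'] by simp
  then show ?thesis
    using assms by (auto simp: GL_def)
qed

lemma GL_mult: "M \<in> GL n \<Longrightarrow> M' \<in> GL n \<Longrightarrow> M * M' \<in> GL n"
  by (auto simp: GL_def det_mult)

lemma GL_transpose: "M \<in> GL n \<Longrightarrow> transpose_mat M \<in> GL n"
  by (auto simp: GL_def det_transpose)

lemma finite_GL: "finite (GL n :: 'a :: {field, finite} mat set)"
  by (rule finite_subset[OF _ finite_carrier_mat[of n n]]) (auto simp: GL_def)

lemma finite_symmetric_mats: "finite (symmetric_mats n :: 'a :: finite mat set)"
  by (rule finite_subset[OF _ finite_carrier_mat[of n n]]) (auto simp: symmetric_mats_def)

lemma symmetric_mats_iff: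
  "E \<in> symmetric_mats n \<longleftrightarrow>
     E \<in> carrier_mat n n \<and> (\<forall>i<n. \<forall>j<n. E $$ (i, j) = E $$ (j, i))"
  unfolding symmetric_mats_def
  by (auto simp: mat_eq_iff)

lemma alternating_mat_iff:
  assumes "A \<in> carrier_mat n n"
  shows "alternating_mat A \<longleftrightarrow>
    (\<forall>i<n. \<forall>j<n. A $$ (i, j) = A $$ (j, i)) \<and> (\<forall>i<n. A $$ (i, i) = 0)"
  using assms by (auto simp: alternating_mat_def mat_eq_iff)

text \<open>
  A symmetric matrix is determined by its leading block and its last column, which are
  independent of each other.
\<close>

lemma card_symmetric_mats_leading_block:
  fixes S :: "'a :: finite mat set"
  assumes "S \<subseteq> symmetric_mats k"
  shows "card {E \<in> symmetric_mats (Suc k). leading_block k E \<in> S} = card S * CARD('a) ^ Suc k"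
proof -
  let ?f = "\<lambda>(E', v). mat (Suc k) (Suc k)
      (\<lambda>(i, j). if i < k \<and> j < k then E' $$ (i, j) else if j = k then v $ i else v $ j)"
  have "bij_betw (\<lambda>E. (leading_block k E, col E k))
      {E \<in> symmetric_mats (Suc k). leading_block k E \<in> S}
      (S \<times> (carrier_vec (Suc k) :: 'a vec set))"
  proof (rule bij_betw_byWitness[of _ ?f])
    show "\<forall>E\<in>{E \<in> symmetric_mats (Suc k). leading_block k E \<in> S}.
        ?f (leading_block k E, col E k) = E"
    proof
      fix E assume "E \<in> {E \<in> symmetric_mats (Suc k). leading_block k E \<in> S}"
      then have E: "E \<in> carrier_mat (Suc k) (Suc k)"
        "\<And>i j. i < Suc k \<Longrightarrow> j < Suc k \<Longrightarrow> E $$ (i, j) = E $$ (j, i)"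
        by (auto simp: symmetric_mats_iff)
      show "?f (leading_block k E, col E k) = E"
        using E(1) by (intro eq_matI) (auto simp: less_Suc_eq E(2)[of k])
    qed
    have inv: "?f (E', v) \<in> symmetric_mats (Suc k) \<and> leading_block k (?f (E', v)) = E' \<and>
        col (?f (E', v)) k = v" if "E' \<in> S" "v \<in> carrier_vec (Suc k)" for E' v
    proof -
      have E': "E' \<in> carrier_mat k k" "\<And>i j. i < k \<Longrightarrow> j < k \<Longrightarrow> E' $$ (i, j) = E' $$ (j, i)"
        using that assms by (auto simp: symmetric_mats_iff subset_iff)
      show ?thesis
        using that(2) E' by (auto simp: symmetric_mats_iff less_Suc_eq intro!: eq_matI eq_vecI)
    qed
    then show "\<forall>p\<in>S \<times> carrier_vec (Suc k). (leading_block k (?f p), col (?f p) k) = p"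
      by (simp only: Ball_def mem_Times_iff split_paired_All fst_conv snd_conv) blast
    show "?f ` (S \<times> carrier_vec (Suc k)) \<subseteq> {E \<in> symmetric_mats (Suc k). leading_block k E \<in> S}"
    proof (rule image_subsetI)
      fix p assume "p \<in> S \<times> (carrier_vec (Suc k) :: 'a vec set)"
      then obtain E' v where p: "p = (E', v)" "E' \<in> S" "v \<in> carrier_vec (Suc k)"
        by auto
      show "?f p \<in> {E \<in> symmetric_mats (Suc k). leading_block k E \<in> S}"
        unfolding p(1) mem_Collect_eq using inv[OF p(2,3)] p(2) by (simp only:)
    qed
  qed (auto simp: symmetric_mats_def intro: carrier_vecI)
  then have "card {E \<in> symmetric_mats (Suc k). leading_block k E \<in> S} =
      card (S \<times> (carrier_vec (Suc k) :: 'a vec set))"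
    by (rule bij_betw_same_card)
  then show ?thesis
    by (simp only: card_cartesian_product card_carrier_vec)
qed

lemma leading_block_symmetric:
  "E \<in> symmetric_mats (Suc k) \<Longrightarrow> leading_block k E \<in> symmetric_mats k"
  by (auto simp: symmetric_mats_iff)

lemma card_symmetric_mats:
  "card (symmetric_mats n :: 'a :: finite mat set) = CARD('a) ^ (n * (n + 1) div 2)"
proof (induction n)
  case 0
  have "(symmetric_mats 0 :: 'a mat set) = {mat 0 0 (\<lambda>_. undefined)}"
    by (auto simp: symmetric_mats_iff)
  then show ?case
    by simp
next
  case (Suc k)
  have "(symmetric_mats (Suc k) :: 'a mat set) =
      {E \<in> symmetric_mats (Suc k). leading_block k E \<in> symmetric_mats k}"
    using leading_block_symmetric by auto
  then have "card (symmetric_mats (Suc k) :: 'a mat set) =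
      CARD('a) ^ (k * (k + 1) div 2) * CARD('a) ^ Suc k"
    using card_symmetric_mats_leading_block[of "symmetric_mats k :: 'a mat set" k] Suc by simp
  moreover have "Suc k * (Suc k + 1) div 2 = k * (k + 1) div 2 + Suc k"
    by simp
  ultimately show ?case
    by (simp only: power_add)
qed

lemma last_column_zero_block:
  assumes "M \<in> carrier_mat (Suc k) (Suc k)" "\<forall>i<k. M $$ (i, k) = 0"
  shows "M = four_block_mat (leading_block k M) (0\<^sub>m k 1)
    (mat 1 k (\<lambda>(i, j). M $$ (k, j))) (mat 1 1 (\<lambda>_. M $$ (k, k)))"
  using assms by (intro eq_matI) (auto simp: less_Suc_eq)

lemma det_last_column_zero:
  assumes "M \<in> carrier_mat (Suc k) (Suc k)" "\<forall>i<k. M $$ (i, k) = 0"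
  shows "det M = det (leading_block k M) * M $$ (k, k)"
proof -
  have "det M = det (leading_block k M) * det (mat 1 1 (\<lambda>_. M $$ (k, k)))"
    by (subst last_column_zero_block[OF assms], rule det_four_block_mat_upper_right_zero_col) auto
  then show ?thesis
    by (simp add: det_single)
qed

text \<open>
  Block triangular matrices: the determinant is that of the leading block times the corner
  entry, and the rest of the last row is free.
\<close>

lemma card_GL_last_column_zero:
  fixes S :: "'a :: {field, finite} mat set" and T :: "'a set"
  assumes "S \<subseteq> GL k" "0 \<notin> T"
  shows "card {M \<in> GL (Suc k). (\<forall>i<k. M $$ (i, k) = 0) \<and> leading_block k M \<in> S \<and> M $$ (k, k) \<in> T} =
    card S * CARD('a) ^ k * card T"
proof -
  let ?X = "{M \<in> GL (Suc k). (\<forall>i<k. M $$ (i, k) = 0) \<and> leading_block k M \<in> S \<and> M $$ (k, k) \<in> T}"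
  let ?f = "\<lambda>(M', v, m). mat (Suc k) (Suc k) (\<lambda>(i, j). if i < k
      then if j < k then M' $$ (i, j) else 0 else if j < k then v $ j else m)"
  have "bij_betw (\<lambda>M. (leading_block k M, vec k (\<lambda>j. M $$ (k, j)), M $$ (k, k))) ?X
      (S \<times> (carrier_vec k :: 'a vec set) \<times> T)"
  proof (rule bij_betw_byWitness[of _ ?f])
    show "\<forall>M\<in>?X. ?f (leading_block k M, vec k (\<lambda>j. M $$ (k, j)), M $$ (k, k)) = M"
      by (auto simp: GL_def less_Suc_eq intro!: eq_matI)
    have inv: "?f (M', v, m) \<in> ?X \<and> leading_block k (?f (M', v, m)) = M' \<and>
        vec k (\<lambda>j. ?f (M', v, m) $$ (k, j)) = v \<and> ?f (M', v, m) $$ (k, k) = m"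
      if "M' \<in> S" "v \<in> carrier_vec k" "m \<in> T" for M' v m
    proof -
      have M': "M' \<in> carrier_mat k k" "det M' \<noteq> 0"
        using that assms by (auto simp: GL_def)
      then have lead: "leading_block k (?f (M', v, m)) = M'"
        by (intro eq_matI) auto
      moreover have "det (?f (M', v, m)) = det M' * m"
        by (subst det_last_column_zero[of _ k]) (simp_all only: lead, simp_all)
      moreover have "m \<noteq> 0"
        using that assms by auto
      ultimately show ?thesis
        using that M' by (auto simp: GL_def intro!: eq_vecI)
    qed
    then show "\<forall>p\<in>S \<times> carrier_vec k \<times> T. (leading_block k (?f p),
        vec k (\<lambda>j. ?f p $$ (k, j)), ?f p $$ (k, k)) = p"
      by (simp only: Ball_def mem_Times_iff split_paired_All fst_conv snd_conv) blast
    show "?f ` (S \<times> carrier_vec k \<times> T) \<subseteq> ?X"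
    proof (rule image_subsetI)
      fix p assume "p \<in> S \<times> (carrier_vec k :: 'a vec set) \<times> T"
      then obtain M' v m where p: "p = (M', v, m)" "M' \<in> S" "v \<in> carrier_vec k" "m \<in> T"
        by auto
      show "?f p \<in> ?X"
        unfolding p(1) using inv[OF p(2-4)] by (simp only:)
    qed
  qed auto
  then have "card ?X = card (S \<times> (carrier_vec k :: 'a vec set) \<times> T)"
    by (rule bij_betw_same_card)
  then show ?thesis
    by (simp only: card_cartesian_product card_carrier_vec mult.assoc)
qed

text \<open>
  If the last entry of \<open>v\<close> is nonzero, the identity matrix with last column \<open>v\<close> does it; in
  general, a transposition of rows first moves a nonzero entry to the end.
\<close>

lemma GL_transitive:
  fixes v :: "'a :: field vec"
  assumes v: "v \<in> carrier_vec (Suc k)" "v \<noteq> 0\<^sub>v (Suc k)"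
  obtains g where "g \<in> GL (Suc k)" "col g k = v"
proof -
  have base: "\<exists>g \<in> GL (Suc k). col g k = w" if w: "w \<in> carrier_vec (Suc k)" "w $ k \<noteq> 0"
    for w :: "'a vec"
  proof -
    let ?g = "four_block_mat (1\<^sub>m k) (mat k 1 (\<lambda>(i, j). w $ i)) (0\<^sub>m 1 k) (mat 1 1 (\<lambda>_. w $ k))"
    have "det ?g = det (1\<^sub>m k :: 'a mat) * det (mat 1 1 (\<lambda>_. w $ k))"
      by (rule det_four_block_mat_lower_left_zero) auto
    then have "det ?g \<noteq> 0"
      using w by (simp add: det_single)
    moreover have "col ?g k = w"
      using w by (intro eq_vecI) (auto simp: less_Suc_eq)
    moreover have "?g \<in> carrier_mat (Suc k) (Suc k)"
      by (rule carrier_matI) auto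
    ultimately show ?thesis
      by (auto simp: GL_def)
  qed
  obtain l where l: "l < Suc k" "v $ l \<noteq> 0"
    using v by (metis eq_vecI carrier_vecD index_zero_vec)
  show ?thesis
  proof (cases "l = k")
    case True
    then show ?thesis
      using base[OF v(1)] l that by auto
  next
    case False
    define P :: "'a mat" where "P = swaprows_mat (Suc k) k l"
    have P: "P \<in> carrier_mat (Suc k) (Suc k)" "det P = - 1" "P * P = 1\<^sub>m (Suc k)"
      using l False by (simp_all add: P_def det_swaprows_mat swaprows_mat_inv)
    have row: "(P *\<^sub>v v) $ k = v $ l"
    proof -
      have "row P k = unit_vec (Suc k) l"
        unfolding P_def using l by (intro eq_vecI) (auto simp: unit_vec_def)
      then show ?thesis
        using P v(1) l by (simp add: P_def)
    qed
    obtain g where g: "g \<in> GL (Suc k)" "col g k = P *\<^sub>v v"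
      using base[of "P *\<^sub>v v"] row l P v by auto
    have "P * g \<in> GL (Suc k)"
      using P g by (auto simp: GL_def det_mult)
    moreover have "col (P * g) k = P *\<^sub>v col g k"
      using P g by (intro col_mult2) (auto simp: GL_def)
    moreover have "P *\<^sub>v (P *\<^sub>v v) = v"
      using P v by (simp add: assoc_mult_mat_vec[symmetric])
    ultimately show ?thesis
      using that g by simp
  qed
qed

lemma last_column_nonzero:
  assumes "M \<in> GL (Suc k)"
  shows "col M k \<noteq> 0\<^sub>v (Suc k)"
proof
  assume "col M k = 0\<^sub>v (Suc k)"
  moreover have M: "M \<in> carrier_mat (Suc k) (Suc k)"
    using assms by (rule GL_carrier)
  ultimately have "M $$ (i, k) = 0" if "i < Suc k" for i
    using that by (metis index_col carrier_matD index_zero_vec(1) lessI)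
  then have "det M = 0"
    by (subst laplace_expansion_column[OF M, of k]) auto
  then show False
    using assms by (simp add: GL_def)
qed

text \<open>
  Invertible matrices are sorted by their last column. Left multiplication is transitive on
  nonzero vectors, so every fibre is as large as that over the last unit vector, whose elements
  are block triangular with corner entry one.
\<close>

lemma card_GL_Suc:
  "card (GL (Suc k) :: 'a :: {field, finite} mat set) =
     (CARD('a) ^ Suc k - 1) * (card (GL k :: 'a mat set) * CARD('a) ^ k)"
proof -
  let ?n = "Suc k"
  let ?e = "unit_vec ?n k :: 'a vec"
  have fibre: "card {M \<in> GL ?n. col M k = v} = card (GL k :: 'a mat set) * CARD('a) ^ k"
    if v: "v \<in> carrier_vec ?n - {0\<^sub>v ?n}" for v :: "'a vec"
  proof -
    obtain g where g: "g \<in> GL ?n" "col g k = v"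
      using v GL_transitive[of v k] by auto
    obtain g' where g': "g' \<in> GL ?n" "g * g' = 1\<^sub>m ?n" "g' * g = 1\<^sub>m ?n"
      using GL_inverse[OF g(1)] .
    note c = GL_carrier[OF g(1)] GL_carrier[OF g'(1)]
    have ge: "g *\<^sub>v ?e = v"
      using c(1) g(2) by (intro eq_vecI) auto
    have g'v: "g' *\<^sub>v v = ?e"
      unfolding ge[symmetric] using c g'(3) by (simp add: assoc_mult_mat_vec[symmetric])
    have "bij_betw (\<lambda>M. g * M) {M \<in> GL ?n. col M k = ?e} {M \<in> GL ?n. col M k = v}"
    proof (rule bij_betw_byWitness[of _ "\<lambda>M. g' * M"])
      show "\<forall>M\<in>{M \<in> GL ?n. col M k = ?e}. g' * (g * M) = M"
        using c g' by (auto simp: assoc_mult_mat[symmetric] dest!: GL_carrier)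
      show "\<forall>M\<in>{M \<in> GL ?n. col M k = v}. g * (g' * M) = M"
        using c g' by (auto simp: assoc_mult_mat[symmetric] dest!: GL_carrier)
      show "(\<lambda>M. g * M) ` {M \<in> GL ?n. col M k = ?e} \<subseteq> {M \<in> GL ?n. col M k = v}"
        using c g ge by (auto simp: GL_mult col_mult2[OF c(1) GL_carrier])
      show "(\<lambda>M. g' * M) ` {M \<in> GL ?n. col M k = v} \<subseteq> {M \<in> GL ?n. col M k = ?e}"
        using c g' g'v by (auto simp: GL_mult col_mult2[OF c(2) GL_carrier])
    qed
    then have "card {M \<in> GL ?n. col M k = v} = card {M \<in> GL ?n. col M k = ?e}"
      by (simp add: bij_betw_same_card)
    also have "{M \<in> GL ?n. col M k = ?e} =
        {M \<in> GL ?n. (\<forall>i<k. M $$ (i, k) = 0) \<and> leading_block k M \<in> GL k \<and> M $$ (k, k) \<in> {1}}"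
    proof (intro Collect_cong conj_cong refl)
      fix M :: "'a mat" assume M: "M \<in> GL ?n"
      then have c: "M \<in> carrier_mat ?n ?n"
        by (rule GL_carrier)
      have "col M k = ?e \<longleftrightarrow> (\<forall>i<?n. M $$ (i, k) = (if i = k then 1 else 0))"
        using c by (auto simp: vec_eq_iff unit_vec_def)
      also have "\<dots> \<longleftrightarrow> (\<forall>i<k. M $$ (i, k) = 0) \<and> M $$ (k, k) \<in> {1}"
        by (auto simp: less_Suc_eq)
      also have "\<dots> \<longleftrightarrow> (\<forall>i<k. M $$ (i, k) = 0) \<and> leading_block k M \<in> GL k \<and> M $$ (k, k) \<in> {1}"
        using det_last_column_zero[OF c] M by (auto simp: GL_def)
      finally show "col M k = ?e \<longleftrightarrow> \<dots>" .
    qed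
    also have "card \<dots> = card (GL k :: 'a mat set) * CARD('a) ^ k * card {1 :: 'a}"
      by (rule card_GL_last_column_zero) auto
    finally show ?thesis
      by simp
  qed
  have "card (GL ?n :: 'a mat set) =
      card (carrier_vec ?n - {0\<^sub>v ?n} :: 'a vec set) * (card (GL k :: 'a mat set) * CARD('a) ^ k)"
    by (rule card_equal_fibres[of _ _ "\<lambda>M. col M k"])
       (use fibre last_column_nonzero in
         \<open>auto simp: finite_GL finite_carrier_vec intro!: carrier_vecI dest: GL_carrier\<close>)
  then show ?thesis
    by (simp only: card_Diff_singleton zero_carrier_vec card_carrier_vec finite_carrier_vec)
qed

section \<open>Counting nonsingular alternating matrices\<close>

text \<open>
  Two Laplace expansions, along the last column and then along the last row, strip off a
  hyperbolic plane.
\<close>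

lemma det_last_row_and_column_unit:
  fixes A :: "'a :: field mat"
  assumes A: "A \<in> carrier_mat (Suc (Suc k)) (Suc (Suc k))"
    and col: "\<And>i. i < Suc (Suc k) \<Longrightarrow> A $$ (i, Suc k) = (if i = k then 1 else 0)"
    and row: "\<And>j. j < Suc (Suc k) \<Longrightarrow> A $$ (Suc k, j) = (if j = k then 1 else 0)"
  shows "det A = - det (leading_block k A)"
proof -
  let ?B = "mat_delete A k (Suc k)"
  have B: "?B \<in> carrier_mat (Suc k) (Suc k)"
    using A by (simp add: mat_delete_def)
  have "det A = (\<Sum>i<Suc (Suc k). if i = k then cofactor A k (Suc k) else 0)"
    by (subst laplace_expansion_column[OF A, of "Suc k"]) (auto simp: col intro!: sum.cong)
  also have "\<dots> = - det ?B"
    by (simp add: cofactor_def)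
  also have "det ?B = det (transpose_mat ?B)"
    using det_transpose[OF B] by simp
  also have "\<dots> = det (leading_block k (transpose_mat ?B)) * transpose_mat ?B $$ (k, k)"
    using A by (intro det_last_column_zero) (auto simp: mat_delete_def row)
  also have "transpose_mat ?B $$ (k, k) = 1"
    using A by (simp add: mat_delete_def row)
  also have "leading_block k (transpose_mat ?B) = transpose_mat (leading_block k A)"
    using A by (intro eq_matI) (auto simp: mat_delete_def)
  finally show ?thesis
    by (simp add: det_transpose[OF leading_block_carrier])
qed

definition congruence :: "'a :: comm_ring_1 mat \<Rightarrow> 'a mat \<Rightarrow> 'a mat" where
  "congruence D A = D * A * transpose_mat D"

lemma congruence_carrier [simp]:
  "D \<in> carrier_mat n n \<Longrightarrow> A \<in> carrier_mat n n \<Longrightarrow> congruence D A \<in> carrier_mat n n"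
  by (simp add: congruence_def)

lemma congruence_mult:
  assumes "D \<in> carrier_mat n n" "D' \<in> carrier_mat n n" "A \<in> carrier_mat n n"
  shows "congruence D' (congruence D A) = congruence (D' * D) A"
proof -
  have "D' * (D * A * transpose_mat D) * transpose_mat D' =
      D' * D * A * (transpose_mat D * transpose_mat D')"
    using assms by (simp add: assoc_mult_mat[of _ n n _ n _ n])
  then show ?thesis
    using assms by (simp add: congruence_def transpose_mult[of D' n n D n])
qed

lemma congruence_one: "A \<in> carrier_mat n n \<Longrightarrow> congruence (1\<^sub>m n) A = A"
  by (simp add: congruence_def)

lemma congruence_symmetric:
  assumes "D \<in> carrier_mat n n" "A \<in> symmetric_mats n"
  shows "congruence D A \<in> symmetric_mats n"
  using assms
  by (auto simp: symmetric_mats_def congruence_def transpose_mult[of _ n n _ n] assoc_mult_mat[of _ n n _ n _ n])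

lemma alternating_imp_symmetric:
  "A \<in> carrier_mat n n \<Longrightarrow> alternating_mat A \<Longrightarrow> A \<in> symmetric_mats n"
  by (simp add: alternating_mat_def symmetric_mats_def)

context
  assumes char2: "(2 :: 'a :: field) = 0"
begin

text \<open>
  In a diagonal entry of the product the contributions of the off-diagonal entries cancel in
  pairs.
\<close>

lemma congruence_alternating:
  assumes D: "D \<in> carrier_mat n n" and A: "A \<in> carrier_mat n n" "alternating_mat (A :: 'a mat)"
  shows "alternating_mat (congruence D A)"
proof -
  have sym: "congruence D A \<in> symmetric_mats n"
    using congruence_symmetric[OF D] alternating_imp_symmetric[OF A] by blast
  have alt: "A $$ (a, b) = A $$ (b, a)" "A $$ (a, a) = 0" if "a < n" "b < n" for a b
    using A that by (auto simp: alternating_mat_iff)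
  have "congruence D A $$ (i, i) = 0" if i: "i < n" for i
  proof -
    have "congruence D A $$ (i, i) = (\<Sum>b<n. \<Sum>a<n. D $$ (i, a) * A $$ (a, b) * D $$ (i, b))"
    proof -
      have "congruence D A $$ (i, i) = (\<Sum>b<n. (D * A) $$ (i, b) * D $$ (i, b))"
        unfolding congruence_def using D A i
        by (subst index_mult_mat_sum[of _ n n _ n]) (auto intro!: sum.cong)
      also have "\<dots> = (\<Sum>b<n. \<Sum>a<n. D $$ (i, a) * A $$ (a, b) * D $$ (i, b))"
        using D A i by (intro sum.cong refl) (subst index_mult_mat_sum[of _ n n _ n], auto simp: sum_distrib_right)
      finally show ?thesis .
    qed
    also have "\<dots> = (\<Sum>b<n. D $$ (i, b) * A $$ (b, b) * D $$ (i, b))"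
      by (rule char2_sum_symmetric[OF char2]) (simp add: alt(1) mult_ac)
    also have "\<dots> = 0"
      by (simp add: alt(2))
    finally show ?thesis .
  qed
  then show ?thesis
    using sym D A by (subst alternating_mat_iff[of _ n]) (auto simp: symmetric_mats_iff)
qed

end

lemma congruence_GL: "D \<in> GL n \<Longrightarrow> A \<in> GL n \<Longrightarrow> congruence D A \<in> GL n"
  by (simp add: congruence_def GL_mult GL_transpose)

definition border_one :: "nat \<Rightarrow> 'a :: {zero, one} mat \<Rightarrow> 'a mat" where
  "border_one n g = four_block_mat g (0\<^sub>m n 1) (0\<^sub>m 1 n) (1\<^sub>m 1)"

lemma border_one_mult:
  assumes "g \<in> carrier_mat n n" "g' \<in> carrier_mat n n"
  shows "border_one n g * border_one n g' = border_one n (g * g' :: 'a :: field mat)"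
proof -
  have "border_one n g * border_one n g' = four_block_mat (g * g' + 0\<^sub>m n 1 * 0\<^sub>m 1 n)
      (g * 0\<^sub>m n 1 + 0\<^sub>m n 1 * 1\<^sub>m 1) (0\<^sub>m 1 n * g' + 1\<^sub>m 1 * 0\<^sub>m 1 n) (0\<^sub>m 1 n * 0\<^sub>m n 1 + 1\<^sub>m 1 * 1\<^sub>m 1)"
    unfolding border_one_def using assms by (intro mult_four_block_mat) auto
  then show ?thesis
    using assms by (simp add: border_one_def)
qed

lemma border_one_one: "border_one n (1\<^sub>m n) = 1\<^sub>m (Suc n)"
  by (intro eq_matI) (auto simp: border_one_def)

lemma border_one_GL: "g \<in> GL n \<Longrightarrow> border_one n g \<in> GL (Suc n)"
proof -
  assume g: "g \<in> GL n"
  then have "det (border_one n g) = det g * det (1\<^sub>m 1)"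
    unfolding border_one_def
    by (intro det_four_block_mat_upper_right_zero_col) (auto dest: GL_carrier)
  moreover have "border_one n g \<in> carrier_mat (Suc n) (Suc n)"
    using g by (intro carrier_matI) (auto simp: border_one_def dest: GL_carrier)
  ultimately show ?thesis
    using g by (simp add: GL_def)
qed

text \<open>
  Congruence by a matrix that fixes the last coordinate acts on the last column, up to
  its corner entry, as on a vector; this is the action used to sort alternating matrices by
  their last column.
\<close>

lemma congruence_border_one_column:
  assumes g: "g \<in> carrier_mat n n" and A: "A \<in> carrier_mat (Suc n) (Suc n)"
  shows "vec n (\<lambda>i. congruence (border_one n g) A $$ (i, n)) = g *\<^sub>v vec n (\<lambda>i. (A :: 'a :: field mat) $$ (i, n))"
proof (rule eq_vecI)
  let ?D = "border_one n g"
  have D: "?D \<in> carrier_mat (Suc n) (Suc n)"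
    using g by (intro carrier_matI) (auto simp: border_one_def)
  fix i assume "i < dim_vec (g *\<^sub>v vec n (\<lambda>i. A $$ (i, n)))"
  then have i: "i < n"
    using g by simp
  have "congruence ?D A $$ (i, n) = (\<Sum>b<Suc n. (?D * A) $$ (i, b) * ?D $$ (n, b))"
    unfolding congruence_def using D A i
    by (subst index_mult_mat_sum[of _ "Suc n" "Suc n" _ "Suc n"]) (auto intro!: sum.cong)
  also have "\<dots> = (\<Sum>b<Suc n. if b = n then (?D * A) $$ (i, n) else 0)"
    using g by (intro sum.cong) (auto simp: border_one_def)
  also have "\<dots> = (?D * A) $$ (i, n)"
    by simp
  also have "\<dots> = (\<Sum>a<Suc n. ?D $$ (i, a) * A $$ (a, n))"
    using D A i by (subst index_mult_mat_sum[of _ "Suc n" "Suc n" _ "Suc n"]) auto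
  also have "\<dots> = (\<Sum>a<n. g $$ (i, a) * A $$ (a, n))"
    using g i by (auto simp: border_one_def intro!: sum.cong)
  also have "\<dots> = (g *\<^sub>v vec n (\<lambda>i. A $$ (i, n))) $ i"
    using g i by (auto simp: scalar_prod_def atLeast0LessThan intro!: sum.cong)
  finally show "vec n (\<lambda>i. congruence ?D A $$ (i, n)) $ i = (g *\<^sub>v vec n (\<lambda>i. A $$ (i, n))) $ i"
    using i by simp
qed (use g in auto)

text \<open>
  Besides the leading block, only the next to last column is free, and it does not
  influence the determinant.
\<close>

lemma card_alternating_unit_last_column:
  "card {A \<in> GL_alternating (Suc (Suc k)) :: 'a mat set. vec (Suc k) (\<lambda>i. A $$ (i, Suc k)) = unit_vec (Suc k) k} =
     card (GL_alternating k :: 'a :: {field, finite} mat set) * CARD('a) ^ k"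
proof -
  let ?n = "Suc (Suc k)"
  let ?X = "{A \<in> GL_alternating ?n. vec (Suc k) (\<lambda>i. A $$ (i, Suc k)) = unit_vec (Suc k) k} :: 'a mat set"
  let ?f = "\<lambda>(A', x). mat ?n ?n (\<lambda>(i, j). if i < k \<and> j < k then A' $$ (i, j)
      else if i < k \<and> j = k then x $ i else if i = k \<and> j < k then x $ j
      else if i = k \<and> j = Suc k \<or> i = Suc k \<and> j = k then 1 else 0)"
  have X: "A \<in> ?X \<longleftrightarrow> A \<in> carrier_mat ?n ?n \<and> alternating_mat A \<and>
      (\<forall>i<?n. A $$ (i, Suc k) = (if i = k then 1 else 0)) \<and>
      (\<forall>j<?n. A $$ (Suc k, j) = (if j = k then 1 else 0)) \<and> det (leading_block k A) \<noteq> 0" for A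
  proof (cases "A \<in> carrier_mat ?n ?n \<and> alternating_mat A")
    case True
    then have A: "\<And>i j. i < ?n \<Longrightarrow> j < ?n \<Longrightarrow> A $$ (i, j) = A $$ (j, i)"
        "\<And>i. i < ?n \<Longrightarrow> A $$ (i, i) = 0"
      by (auto simp: alternating_mat_iff)
    have "vec (Suc k) (\<lambda>i. A $$ (i, Suc k)) = unit_vec (Suc k) k \<longleftrightarrow>
        (\<forall>i<Suc k. A $$ (i, Suc k) = (if i = k then 1 else 0))"
      by (auto simp: vec_eq_iff unit_vec_def)
    also have "\<dots> \<longleftrightarrow> (\<forall>i<?n. A $$ (i, Suc k) = (if i = k then 1 else 0)) \<and>
        (\<forall>j<?n. A $$ (Suc k, j) = (if j = k then 1 else 0))" (is "_ \<longleftrightarrow> ?C \<and> ?R")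
    proof -
      have "?R \<longleftrightarrow> ?C"
        using A(1) by (metis lessI)
      moreover have "?C \<longleftrightarrow> (\<forall>i<Suc k. A $$ (i, Suc k) = (if i = k then 1 else 0))"
        using A(2)[of "Suc k"] by (subst All_less_Suc) simp
      ultimately show ?thesis
        by argo
    qed
    moreover have "?C \<and> ?R \<longrightarrow> (det A \<noteq> 0 \<longleftrightarrow> det (leading_block k A) \<noteq> 0)"
    proof
      assume "?C \<and> ?R"
      then have "det A = - det (leading_block k A)"
        using True by (intro det_last_row_and_column_unit) blast+
      then show "det A \<noteq> 0 \<longleftrightarrow> det (leading_block k A) \<noteq> 0"
        by simp
    qed
    moreover have "A \<in> ?X \<longleftrightarrow> det A \<noteq> 0 \<and> vec (Suc k) (\<lambda>i. A $$ (i, Suc k)) = unit_vec (Suc k) k"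
      using True by (simp add: GL_alternating_def GL_def)
    ultimately show ?thesis
      using True by argo
  qed (auto simp: GL_alternating_def GL_def)
  have lead: "alternating_mat (leading_block k A)"
    if "A \<in> carrier_mat ?n ?n" "alternating_mat A" for A :: "'a mat"
    using that by (auto simp: alternating_mat_iff[of _ ?n] alternating_mat_iff[of _ k])
  have "bij_betw (\<lambda>A. (leading_block k A, vec k (\<lambda>i. A $$ (i, k)))) ?X
      ((GL_alternating k :: 'a mat set) \<times> (carrier_vec k :: 'a vec set))"
  proof (rule bij_betw_byWitness[of _ ?f])
    show "\<forall>A\<in>?X. ?f (leading_block k A, vec k (\<lambda>i. A $$ (i, k))) = A"
    proof
      fix A assume A: "A \<in> ?X"
      then have A1: "A \<in> carrier_mat ?n ?n"
        and "alternating_mat A" "\<And>i. i < ?n \<Longrightarrow> A $$ (i, Suc k) = (if i = k then 1 else 0)"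
        "\<And>j. j < ?n \<Longrightarrow> A $$ (Suc k, j) = (if j = k then 1 else 0)"
        by (simp_all only: X)
      moreover have "A $$ (k, j) = A $$ (j, k)" if "j < k" for j
        using A1 \<open>alternating_mat A\<close> that by (auto simp: alternating_mat_iff)
      moreover have "A $$ (k, k) = 0"
        using A1 \<open>alternating_mat A\<close> by (auto simp: alternating_mat_iff)
      ultimately show "?f (leading_block k A, vec k (\<lambda>i. A $$ (i, k))) = A"
        by (intro eq_matI) (auto simp: less_Suc_eq)
    qed
    have inv: "?f (A', x) \<in> ?X \<and> leading_block k (?f (A', x)) = A' \<and>
        vec k (\<lambda>i. ?f (A', x) $$ (i, k)) = x"
      if "A' \<in> GL_alternating k" "x \<in> carrier_vec k" for A' x
    proof -
      have A': "A' \<in> carrier_mat k k" "det A' \<noteq> 0" "\<And>i. i < k \<Longrightarrow> A' $$ (i, i) = 0"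
          "\<And>i j. i < k \<Longrightarrow> j < k \<Longrightarrow> A' $$ (i, j) = A' $$ (j, i)"
        using that(1) by (auto simp: GL_alternating_def GL_def alternating_mat_iff)
      have "leading_block k (?f (A', x)) = A'"
        using A' by (intro eq_matI) auto
      moreover have "alternating_mat (?f (A', x))"
        using A' by (subst alternating_mat_iff[of _ ?n]) (auto simp: less_Suc_eq)
      ultimately show ?thesis
        unfolding X using A' that(2) by (auto simp: less_Suc_eq intro!: eq_vecI)
    qed
    show "\<forall>p\<in>(GL_alternating k :: 'a mat set) \<times> (carrier_vec k :: 'a vec set).
        (leading_block k (?f p), vec k (\<lambda>i. ?f p $$ (i, k))) = p"
    proof (rule ballI)
      fix p assume "p \<in> (GL_alternating k :: 'a mat set) \<times> (carrier_vec k :: 'a vec set)"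
      then obtain A' x where p: "p = (A', x)" "A' \<in> GL_alternating k" "x \<in> carrier_vec k"
        by auto
      show "(leading_block k (?f p), vec k (\<lambda>i. ?f p $$ (i, k))) = p"
        unfolding p(1) prod.inject using inv[OF p(2,3)] by (simp only:)
    qed
    show "?f ` (GL_alternating k \<times> carrier_vec k) \<subseteq> ?X"
    proof (rule image_subsetI)
      fix p assume "p \<in> (GL_alternating k :: 'a mat set) \<times> (carrier_vec k :: 'a vec set)"
      then obtain A' x where p: "p = (A', x)" "A' \<in> GL_alternating k" "x \<in> carrier_vec k"
        by auto
      show "?f p \<in> ?X"
        unfolding p(1) using inv[OF p(2,3)] by (simp only:)
    qed
    show "(\<lambda>A. (leading_block k A, vec k (\<lambda>i. A $$ (i, k)))) ` ?X
        \<subseteq> GL_alternating k \<times> carrier_vec k"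
      unfolding image_subset_iff Ball_def X
      by (simp add: GL_alternating_def GL_def lead)
  qed
  then have "card ?X = card ((GL_alternating k :: 'a mat set) \<times> (carrier_vec k :: 'a vec set))"
    by (rule bij_betw_same_card)
  then show ?thesis
    by (simp only: card_cartesian_product card_carrier_vec)
qed

text \<open>
  As for the general linear group, but with congruence in place of left multiplication: the last
  diagonal entry is zero, so the last column is an arbitrary nonzero vector of length \<open>k + 1\<close>.
\<close>

lemma card_GL_alternating_Suc_Suc:
  assumes char2: "(2 :: 'a :: {field, finite}) = 0"
  shows "card (GL_alternating (Suc (Suc k)) :: 'a mat set) =
     (CARD('a) ^ Suc k - 1) * (card (GL_alternating k :: 'a mat set) * CARD('a) ^ k)"
proof -
  let ?n = "Suc k"
  let ?G = "GL_alternating (Suc ?n) :: 'a mat set"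
  let ?c = "\<lambda>A :: 'a mat. vec ?n (\<lambda>i. A $$ (i, ?n))"
  let ?e = "unit_vec ?n k :: 'a vec"
  have G: "A \<in> carrier_mat (Suc ?n) (Suc ?n)" "A \<in> GL (Suc ?n)" "alternating_mat A" if "A \<in> ?G" for A
    using that by (auto simp: GL_alternating_def GL_def)
  have fibre: "card {A \<in> ?G. ?c A = v} = card (GL_alternating k :: 'a mat set) * CARD('a) ^ k"
    if v: "v \<in> carrier_vec ?n - {0\<^sub>v ?n}" for v :: "'a vec"
  proof -
    obtain g where g: "g \<in> GL ?n" "col g k = v"
      using v GL_transitive[of v k] by auto
    obtain g' where g': "g' \<in> GL ?n" "g * g' = 1\<^sub>m ?n" "g' * g = 1\<^sub>m ?n"
      using GL_inverse[OF g(1)] .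
    note c = GL_carrier[OF g(1)] GL_carrier[OF g'(1)]
    let ?D = "border_one ?n g" and ?D' = "border_one ?n g'"
    note D = border_one_GL[OF g(1)] border_one_GL[OF g'(1)]
    note Dc = D[THEN GL_carrier]
    have DD: "?D * ?D' = 1\<^sub>m (Suc ?n)" "?D' * ?D = 1\<^sub>m (Suc ?n)"
      using c g'(2,3) by (simp_all add: border_one_mult border_one_one)
    have ge: "g *\<^sub>v ?e = v"
      using c(1) g(2) by (intro eq_vecI) auto
    have g'v: "g' *\<^sub>v v = ?e"
      unfolding ge[symmetric] using c g'(3) by (simp add: assoc_mult_mat_vec[symmetric])
    have closed: "congruence B A \<in> ?G" if "B \<in> GL (Suc ?n)" "A \<in> ?G" for B A
      using that G[OF that(2)]
      by (auto simp: GL_alternating_def congruence_GL congruence_alternating[OF char2] dest: GL_carrier)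
    have "bij_betw (congruence ?D) {A \<in> ?G. ?c A = ?e} {A \<in> ?G. ?c A = v}"
    proof (rule bij_betw_byWitness[of _ "congruence ?D'"])
      show "\<forall>A\<in>{A \<in> ?G. ?c A = ?e}. congruence ?D' (congruence ?D A) = A"
        using G(1) Dc DD by (auto simp: congruence_mult[of _ "Suc ?n"] congruence_one)
      show "\<forall>A\<in>{A \<in> ?G. ?c A = v}. congruence ?D (congruence ?D' A) = A"
        using G(1) Dc DD by (auto simp: congruence_mult[of _ "Suc ?n"] congruence_one)
      show "congruence ?D ` {A \<in> ?G. ?c A = ?e} \<subseteq> {A \<in> ?G. ?c A = v}"
      proof (rule image_subsetI)
        fix A assume "A \<in> {A \<in> ?G. ?c A = ?e}"
        then show "congruence ?D A \<in> {A \<in> ?G. ?c A = v}"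
          using closed[OF D(1), of A] congruence_border_one_column[OF c(1) G(1), of A] ge
          unfolding mem_Collect_eq by (simp only:)
      qed
      show "congruence ?D' ` {A \<in> ?G. ?c A = v} \<subseteq> {A \<in> ?G. ?c A = ?e}"
      proof (rule image_subsetI)
        fix A assume "A \<in> {A \<in> ?G. ?c A = v}"
        then show "congruence ?D' A \<in> {A \<in> ?G. ?c A = ?e}"
          using closed[OF D(2), of A] congruence_border_one_column[OF c(2) G(1), of A] g'v
          unfolding mem_Collect_eq by (simp only:)
      qed
    qed
    then have "card {A \<in> ?G. ?c A = v} = card {A \<in> ?G. ?c A = ?e}"
      by (simp add: bij_betw_same_card)
    then show ?thesis
      by (simp only: card_alternating_unit_last_column)
  qed
  have "?c A \<noteq> 0\<^sub>v ?n" if "A \<in> ?G" for A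
  proof
    assume *: "?c A = 0\<^sub>v ?n"
    have "A $$ (i, ?n) = 0" if "i < Suc ?n" for i
    proof (cases "i = ?n")
      case True
      then show ?thesis
        using G[OF \<open>A \<in> ?G\<close>] by (auto simp: alternating_mat_iff)
    next
      case False
      then show ?thesis
        using * that by (metis index_vec index_zero_vec(1) less_antisym)
    qed
    then have "col A ?n = 0\<^sub>v (Suc ?n)"
      using G[OF \<open>A \<in> ?G\<close>] by (intro eq_vecI) auto
    then show False
      using last_column_nonzero[OF G(2)[OF \<open>A \<in> ?G\<close>]] by simp
  qed
  moreover have "finite ?G"
    by (rule finite_subset[OF _ finite_GL[of "Suc ?n"]]) (auto simp: GL_alternating_def)
  ultimately have "card ?G =
      card (carrier_vec ?n - {0\<^sub>v ?n} :: 'a vec set) * (card (GL_alternating k :: 'a mat set) * CARD('a) ^ k)"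
    by (intro card_equal_fibres[of _ _ ?c] fibre) (auto simp: finite_carrier_vec)
  then show ?thesis
    by (simp only: card_Diff_singleton zero_carrier_vec card_carrier_vec finite_carrier_vec)
qed

lemma card_GL_alternating:
  assumes char2: "(2 :: 'a :: {field, finite}) = 0"
  shows "card (GL_alternating (2 * m) :: 'a mat set) =
    CARD('a) ^ (m * (m - 1)) * (\<Prod>j=1..m. CARD('a) ^ (2 * j - 1) - 1)"
proof (induction m)
  case 0
  have "(GL_alternating 0 :: 'a mat set) = {1\<^sub>m 0}"
    by (auto simp: GL_alternating_def GL_def alternating_mat_def)
  then show ?case
    by simp
next
  case (Suc m)
  have exp: "Suc m * (Suc m - 1) = m * (m - 1) + 2 * m"
    by (cases m) auto
  have prod: "(\<Prod>j=1..Suc m. CARD('a) ^ (2 * j - 1) - 1) =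
      (\<Prod>j=1..m. CARD('a) ^ (2 * j - 1) - 1) * (CARD('a) ^ Suc (2 * m) - 1)"
    by simp
  have "2 * Suc m = Suc (Suc (2 * m))"
    by simp
  then show ?case
    unfolding exp prod power_add
    using card_GL_alternating_Suc_Suc[OF char2, of "2 * m"] Suc.IH by (simp only: mult_ac)
qed

section \<open>A linear functional on symmetric matrices\<close>

definition mat_inv :: "'a :: field mat \<Rightarrow> 'a mat" where
  "mat_inv M = (SOME M'. M' \<in> GL (dim_row M) \<and> M * M' = 1\<^sub>m (dim_row M) \<and> M' * M = 1\<^sub>m (dim_row M))"

lemma mat_inv:
  assumes "M \<in> GL n"
  shows "mat_inv M \<in> GL n" "M * mat_inv M = 1\<^sub>m n" "mat_inv M * M = 1\<^sub>m n"
proof -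
  have "dim_row M = n"
    using GL_carrier[OF assms] by simp
  then have "\<exists>M'. M' \<in> GL (dim_row M) \<and> M * M' = 1\<^sub>m (dim_row M) \<and> M' * M = 1\<^sub>m (dim_row M)"
    using GL_inverse[OF assms] by metis
  from someI_ex[OF this] show "mat_inv M \<in> GL n" "M * mat_inv M = 1\<^sub>m n" "mat_inv M * M = 1\<^sub>m n"
    by (simp_all add: mat_inv_def \<open>dim_row M = n\<close>)
qed

lemma mat_inv_unique:
  assumes "M \<in> carrier_mat n n" "M' \<in> carrier_mat n n" "M * M' = 1\<^sub>m n"
  shows "mat_inv M = M'"
proof -
  have M: "M \<in> GL n"
    using GL_I[OF assms] .
  note c = GL_carrier[OF mat_inv(1)[OF M]]
  have "mat_inv M * (M * M') = mat_inv M * M * M'"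
    using assms(1,2) c by (simp only: assoc_mult_mat[of _ n n _ n _ n])
  then show ?thesis
    using assms mat_inv(3)[OF M] c by simp
qed

text \<open>
  The trace of \<open>M E\<close> restricted to the first \<open>k\<close> diagonal entries: the part of \<open>Tr (\<sigma> p)\<close>
  that depends on \<open>E\<close>.
\<close>

definition partial_trace :: "nat \<Rightarrow> 'a :: semiring_0 mat \<Rightarrow> 'a mat \<Rightarrow> 'a" where
  "partial_trace k M E = (\<Sum>i<k. (M * E) $$ (i, i))"

lemma partial_trace_sum:
  assumes "M \<in> carrier_mat n n" "E \<in> carrier_mat n n" "k \<le> n"
  shows "partial_trace k M E = (\<Sum>i<k. \<Sum>j<n. M $$ (i, j) * E $$ (j, i))"
  unfolding partial_trace_def using assms
  by (intro sum.cong) (auto simp: index_mult_mat_sum[of _ n n _ n] simp del: index_mult_mat)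

lemma partial_trace_add_smult:
  fixes M :: "'a :: field mat"
  assumes "M \<in> carrier_mat n n" "E \<in> carrier_mat n n" "E' \<in> carrier_mat n n" "k \<le> n"
  shows "partial_trace k M (E + c \<cdot>\<^sub>m E') = partial_trace k M E + c * partial_trace k M E'"
proof -
  have "E + c \<cdot>\<^sub>m E' \<in> carrier_mat n n"
    using assms by simp
  then have "partial_trace k M (E + c \<cdot>\<^sub>m E') =
      (\<Sum>i<k. \<Sum>j<n. M $$ (i, j) * E $$ (j, i) + c * (M $$ (i, j) * E' $$ (j, i)))"
    using assms by (auto simp: partial_trace_sum algebra_simps intro!: sum.cong)
  then show ?thesis
    using assms by (simp add: partial_trace_sum[OF assms(1)] sum.distrib sum_distrib_left)
qed

lemma symmetric_mats_add_smult:
  "E \<in> symmetric_mats n \<Longrightarrow> E' \<in> symmetric_mats n \<Longrightarrow> E + c \<cdot>\<^sub>m E' \<in> symmetric_mats n"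
  by (auto simp: symmetric_mats_iff)

text \<open>
  The fibres of a nonzero linear functional are translates of each other.
\<close>

lemma card_partial_trace_fibre:
  fixes M :: "'a :: {field, finite} mat"
  assumes M: "M \<in> carrier_mat n n" and "k \<le> n"
    and E0: "E0 \<in> symmetric_mats n" "partial_trace k M E0 \<noteq> 0"
  shows "CARD('a) * card {E \<in> symmetric_mats n. partial_trace k M E = \<gamma>} =
    card (symmetric_mats n :: 'a mat set)"
proof -
  let ?S = "\<lambda>\<gamma>. {E \<in> symmetric_mats n. partial_trace k M E = \<gamma>}"
  have car: "E \<in> carrier_mat n n" if "E \<in> symmetric_mats n" for E :: "'a mat"
    using that by (simp add: symmetric_mats_def)
  have "card (?S \<delta>) = card (?S \<gamma>)" for \<delta>
  proof -
    define c where "c = (\<gamma> - \<delta>) / partial_trace k M E0"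
    have c: "c * partial_trace k M E0 = \<gamma> - \<delta>"
      using E0 by (simp add: c_def)
    have cancel: "E + a \<cdot>\<^sub>m E0 + b \<cdot>\<^sub>m E0 = E" if "E \<in> symmetric_mats n" "a + b = 0" for E a b
    proof -
      have "a * x + b * x = 0" for x
        using that(2) by (metis distrib_right mult_zero_left)
      then show ?thesis
        using car[OF that(1)] car[OF E0(1)] by (intro eq_matI) (auto simp: add.assoc)
    qed
    have "bij_betw (\<lambda>E. E + c \<cdot>\<^sub>m E0) (?S \<delta>) (?S \<gamma>)"
      by (rule bij_betw_byWitness[of _ "\<lambda>E. E + (- c) \<cdot>\<^sub>m E0"])
         (auto simp: cancel symmetric_mats_add_smult E0(1) c
            partial_trace_add_smult[OF M car car[OF E0(1)] assms(2)])
    then show ?thesis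
      by (rule bij_betw_same_card)
  qed
  then have "card (symmetric_mats n :: 'a mat set) = CARD('a) * card (?S \<gamma>)"
    by (intro card_equal_fibres[of _ _ "partial_trace k M"]) (auto simp: finite_symmetric_mats)
  then show ?thesis ..
qed

definition symmetric_unit :: "nat \<Rightarrow> nat \<Rightarrow> nat \<Rightarrow> 'a :: {zero, one} mat" where
  "symmetric_unit n i j = mat n n (\<lambda>(a, b). if a = i \<and> b = j \<or> a = j \<and> b = i then 1 else 0)"

lemma symmetric_unit_symmetric: "symmetric_unit n i j \<in> symmetric_mats n"
  by (auto simp: symmetric_unit_def symmetric_mats_iff)

lemma partial_trace_symmetric_unit:
  fixes M :: "'a :: field mat"
  assumes "M \<in> carrier_mat n n" "k \<le> n" "i < k" "j < n"
  shows "partial_trace k M (symmetric_unit n i j) =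
    M $$ (i, j) + (if j < k \<and> i \<noteq> j then M $$ (j, i) else 0)"
proof -
  have "partial_trace k M (symmetric_unit n i j) = (\<Sum>a<k. \<Sum>b<n.
      (if a = i then if b = j then M $$ (a, b) else 0 else 0) +
      (if a = j then if b = i then if i \<noteq> j then M $$ (a, b) else 0 else 0 else 0))"
    using assms by (subst partial_trace_sum[of _ n])
      (auto simp: symmetric_unit_def intro!: sum.cong)
  also have "\<dots> = (\<Sum>a<k. (if a = i then M $$ (a, j) else 0) +
      (if a = j then if i \<noteq> j then M $$ (a, i) else 0 else 0))"
    using assms by (intro sum.cong) (auto simp: sum.distrib)
  also have "\<dots> = M $$ (i, j) + (if j < k \<and> i \<noteq> j then M $$ (j, i) else 0)"
    using assms by (auto simp: sum.distrib)
  finally show ?thesis .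
qed

context
  assumes char2: "(2 :: 'a :: field) = 0"
begin

text \<open>
  Only the leading blocks matter, and the product of an alternating and a symmetric matrix has
  trace zero.
\<close>

lemma partial_trace_alternating_block:
  fixes M :: "'a mat"
  assumes M: "M \<in> carrier_mat (Suc k) (Suc k)" and E: "E \<in> symmetric_mats (Suc k)"
    and zero: "\<forall>i<k. M $$ (i, k) = 0" and alt: "alternating_mat (leading_block k M)"
  shows "partial_trace k M E = 0"
proof -
  have E': "E \<in> carrier_mat (Suc k) (Suc k)"
    "\<And>i j. i < Suc k \<Longrightarrow> j < Suc k \<Longrightarrow> E $$ (i, j) = E $$ (j, i)"
    using E by (auto simp: symmetric_mats_iff)
  have alt': "M $$ (i, j) = M $$ (j, i)" "M $$ (i, i) = 0" if "i < k" "j < k" for i j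
    using alt that by (auto simp: alternating_mat_iff[OF leading_block_carrier])
  have "partial_trace k M E = (\<Sum>i<k. \<Sum>j<k. M $$ (i, j) * E $$ (j, i))"
    using zero by (subst partial_trace_sum[OF M E'(1)]) auto
  also have "\<dots> = (\<Sum>i<k. M $$ (i, i) * E $$ (i, i))"
    using alt'(1) E'(2) by (intro char2_sum_symmetric[OF char2]) simp
  also have "\<dots> = 0"
    using alt'(2) by simp
  finally show ?thesis .
qed

text \<open>
  The matrix units \<open>E i i\<close> and \<open>E i j + E j i\<close> detect each way in which the condition can fail.
\<close>

lemma partial_trace_nonzero_witness:
  fixes M :: "'a mat"
  assumes M: "M \<in> carrier_mat (Suc k) (Suc k)"
    and not_alt: "\<not> ((\<forall>i<k. M $$ (i, k) = 0) \<and> alternating_mat (leading_block k M))"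
  obtains E where "E \<in> symmetric_mats (Suc k)" "partial_trace k M E \<noteq> 0"
proof -
  note pt = partial_trace_symmetric_unit[OF M]
  from not_alt consider i where "i < k" "M $$ (i, k) \<noteq> 0"
    | i where "i < k" "M $$ (i, i) \<noteq> 0"
    | i j where "i < k" "j < k" "M $$ (i, j) \<noteq> M $$ (j, i)"
    by (auto simp: alternating_mat_iff[OF leading_block_carrier])
  then show ?thesis
  proof cases
    case (1 i)
    then show ?thesis
      using that[OF symmetric_unit_symmetric, of i k] by (simp add: pt)
  next
    case (2 i)
    then show ?thesis
      using that[OF symmetric_unit_symmetric, of i i] by (simp add: pt)
  next
    case (3 i j)
    then have "i \<noteq> j"
      by auto
    then show ?thesis
      using that[OF symmetric_unit_symmetric, of i j] 3
      by (simp add: pt char2_add_eq_0_iff[OF char2])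
  qed
qed

end

lemma mat_inv_last_entry:
  assumes M: "M \<in> GL (Suc k)" and zero: "\<forall>i<k. M $$ (i, k) = 0"
  shows "mat_inv M $$ (k, k) = inverse (M $$ (k, k))"
proof -
  note c = GL_carrier[OF M] GL_carrier[OF mat_inv(1)[OF M]]
  have "(mat_inv M * M) $$ (k, k) = 1"
    by (simp add: mat_inv(3)[OF M])
  moreover have "(mat_inv M * M) $$ (k, k) = mat_inv M $$ (k, k) * M $$ (k, k)"
    using c zero by (subst index_mult_mat_sum[of _ "Suc k" "Suc k" _ "Suc k"]) auto
  ultimately have "mat_inv M $$ (k, k) * M $$ (k, k) = 1"
    by simp
  then show ?thesis
    by (metis inverse_unique mult.commute)
qed

text \<open>
  The matrices \<open>M\<close> are split according to whether the functional of \<open>E\<close> vanishes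
  identically. If it does, \<open>M\<close> is block triangular with corner entry \<open>m\<close> and the value is \<open>m + 1/m\<close>
  for every \<open>E\<close>; otherwise the value is uniformly distributed over \<open>E\<close>.
\<close>

lemma card_levi_trace:
  fixes \<beta> :: "'a :: {field, finite}" and k :: nat
  assumes char2: "(2 :: 'a) = 0"
  defines "q \<equiv> CARD('a)"
    and "Sym \<equiv> symmetric_mats (Suc k) :: 'a mat set"
  shows "q * card {(M, E). M \<in> GL (Suc k) \<and> E \<in> Sym \<and>
      M $$ (k, k) + mat_inv M $$ (k, k) + partial_trace k M E = \<beta>} =
    card Sym * (q * (card (GL_alternating k :: 'a mat set) * q ^ k *
        card {m :: 'a. m \<noteq> 0 \<and> m + inverse m = \<beta>})
      + (card (GL (Suc k) :: 'a mat set) - card (GL_alternating k :: 'a mat set) * q ^ k * (q - 1)))"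
proof -
  let ?G = "GL (Suc k) :: 'a mat set"
  let ?Z = "\<lambda>T. {M \<in> ?G. (\<forall>i<k. M $$ (i, k) = 0) \<and>
      leading_block k M \<in> GL_alternating k \<and> M $$ (k, k) \<in> T}"
  let ?U = "- {0 :: 'a}"
  let ?F = "\<lambda>M. {E \<in> Sym. M $$ (k, k) + mat_inv M $$ (k, k) + partial_trace k M E = \<beta>}"
  let ?T = "{m :: 'a. m \<noteq> 0 \<and> m + inverse m = \<beta>}"
  have Z: "M \<in> ?Z ?U \<longleftrightarrow> (\<forall>i<k. M $$ (i, k) = 0) \<and> alternating_mat (leading_block k M)"
    if "M \<in> ?G" for M
  proof -
    have "det (leading_block k M) * M $$ (k, k) \<noteq> 0" if "\<forall>i<k. M $$ (i, k) = 0"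
      using \<open>M \<in> ?G\<close> that det_last_column_zero[of M k] by (simp add: GL_def)
    then show ?thesis
      using that by (auto simp: GL_alternating_def GL_def)
  qed
  have cardZ: "card (?Z T) = card (GL_alternating k :: 'a mat set) * q ^ k * card T"
    if "0 \<notin> T" for T
    unfolding q_def using that by (intro card_GL_last_column_zero) (auto simp: GL_alternating_def)
  have in_Z: "q * card (?F M) = (if M \<in> ?Z ?T then q * card Sym else 0)" if "M \<in> ?Z ?U" for M
  proof -
    have M: "M \<in> ?G" "\<forall>i<k. M $$ (i, k) = 0" "alternating_mat (leading_block k M)" "M $$ (k, k) \<noteq> 0"
      using that Z[of M] by auto
    have "partial_trace k M E = 0" if "E \<in> Sym" for E
      using partial_trace_alternating_block[OF char2 GL_carrier[OF M(1)] _ M(2,3)] that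
      by (simp add: Sym_def)
    then have "?F M = (if M $$ (k, k) + inverse (M $$ (k, k)) = \<beta> then Sym else {})"
      using mat_inv_last_entry[OF M(1,2)] by auto
    then show ?thesis
      using that by auto
  qed
  have not_Z: "q * card (?F M) = card Sym" if "M \<in> ?G - ?Z ?U" for M
  proof -
    have M: "M \<in> ?G" "\<not> ((\<forall>i<k. M $$ (i, k) = 0) \<and> alternating_mat (leading_block k M))"
      using that Z[of M] by auto
    obtain E0 where "E0 \<in> symmetric_mats (Suc k)" "partial_trace k M E0 \<noteq> 0"
      using partial_trace_nonzero_witness[OF char2 GL_carrier[OF M(1)] M(2)] .
    then have "q * card {E \<in> Sym. partial_trace k M E = \<beta> - (M $$ (k, k) + mat_inv M $$ (k, k))} = card Sym"
      unfolding q_def Sym_def by (intro card_partial_trace_fibre GL_carrier[OF M(1)]) auto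
    moreover have "?F M = {E \<in> Sym. partial_trace k M E = \<beta> - (M $$ (k, k) + mat_inv M $$ (k, k))}"
      by (auto simp: algebra_simps)
    ultimately show ?thesis
      by simp
  qed
  have finG: "finite ?G" and finS: "finite Sym"
    by (simp_all add: finite_GL Sym_def finite_symmetric_mats)
  have sub: "?Z ?U \<subseteq> ?G" "?Z ?T \<subseteq> ?Z ?U"
    by auto
  have "{(M, E). M \<in> ?G \<and> E \<in> Sym \<and>
      M $$ (k, k) + mat_inv M $$ (k, k) + partial_trace k M E = \<beta>} = (SIGMA M:?G. ?F M)"
    by auto
  then have "q * card {(M, E). M \<in> ?G \<and> E \<in> Sym \<and>
      M $$ (k, k) + mat_inv M $$ (k, k) + partial_trace k M E = \<beta>} = (\<Sum>M\<in>?G. q * card (?F M))"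
    using finG finS by (simp add: sum_distrib_left)
  also have "\<dots> = (\<Sum>M\<in>?G - ?Z ?U. q * card (?F M)) + (\<Sum>M\<in>?Z ?U. q * card (?F M))"
    by (rule sum.subset_diff[OF sub(1) finG])
  also have "(\<Sum>M\<in>?Z ?U. q * card (?F M)) = (\<Sum>M\<in>?Z ?U. if M \<in> ?Z ?T then q * card Sym else 0)"
    by (intro sum.cong in_Z) auto
  also have "\<dots> = (\<Sum>M\<in>{M \<in> ?Z ?U. M \<in> ?Z ?T}. q * card Sym)"
    by (intro sum.inter_filter[symmetric] finite_subset[OF sub(1) finG])
  also have "{M \<in> ?Z ?U. M \<in> ?Z ?T} = ?Z ?T"
    using sub(2) by auto
  also have "(\<Sum>M\<in>?G - ?Z ?U. q * card (?F M)) = (\<Sum>M\<in>?G - ?Z ?U. card Sym)"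
    by (intro sum.cong not_Z) auto
  also have "(\<Sum>M\<in>?G - ?Z ?U. card Sym) = card Sym * (card ?G - card (?Z ?U))"
    using card_Diff_subset[OF finite_subset[OF sub(1) finG] sub(1)] by simp
  also have "(\<Sum>M\<in>?Z ?T. q * card Sym) = card Sym * (q * card (?Z ?T))"
    by simp
  also have "card (?Z ?T) = card (GL_alternating k :: 'a mat set) * q ^ k * card ?T"
    by (rule cardZ) simp
  also have "card (?Z ?U) = card (GL_alternating k :: 'a mat set) * q ^ k * (q - 1)"
    using cardZ[of ?U] by (simp add: Compl_eq_Diff_UNIV card_Diff_singleton q_def)
  finally show ?thesis
    by (simp add: distrib_left)
qed

section \<open>Double cosets and the Siegel parabolic subgroup\<close>

text \<open>
  Pairs \<open>(p, p')\<close> in \<open>H \<times> H\<close> with \<open>f (p s p') = \<beta>\<close> are counted in two ways. Since \<open>f\<close> is a class function, the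
  value is \<open>f (s (p' p))\<close>, so that \<open>p\<close> is free and \<open>p' p\<close> is restricted. On the other hand every
  element of the double coset comes from equally many pairs, one for each element of the
  intersection of \<open>H\<close> with its conjugate by \<open>s\<close>.
\<close>

lemma (in group) card_double_coset_fibre:
  assumes H: "subgroup H G" and fin: "finite H" and s: "s \<in> carrier G"
    and f: "\<And>x y. x \<in> carrier G \<Longrightarrow> y \<in> carrier G \<Longrightarrow> f (x \<otimes> y) = f (y \<otimes> x)"
  shows "card {w \<in> {p \<otimes> s \<otimes> p' | p p'. p \<in> H \<and> p' \<in> H}. f w = \<beta>}
      * card {x \<in> H. inv s \<otimes> x \<otimes> s \<in> H} = card H * card {p \<in> H. f (s \<otimes> p) = \<beta>}"
proof -
  let ?Y = "{(p, p'). p \<in> H \<and> p' \<in> H \<and> f (p \<otimes> s \<otimes> p') = \<beta>}"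
  let ?D = "{w \<in> {p \<otimes> s \<otimes> p' | p p'. p \<in> H \<and> p' \<in> H}. f w = \<beta>}"
  let ?K = "{x \<in> H. inv s \<otimes> x \<otimes> s \<in> H}"
  note G = subgroup.mem_carrier[OF H] and cl = subgroup.m_closed[OF H] subgroup.m_inv_closed[OF H]
  have cancel: "u \<otimes> (inv u \<otimes> v) = v" if "u \<in> carrier G" "v \<in> carrier G" for u v
    using that by (simp add: m_assoc[symmetric])
  have finY: "finite ?Y"
    by (rule finite_subset[of _ "H \<times> H"]) (use fin in auto)
  have rot: "f (p \<otimes> s \<otimes> p') = f (s \<otimes> (p' \<otimes> p))" if "p \<in> H" "p' \<in> H" for p p'
    using f[of p "s \<otimes> p'"] that s G by (simp add: m_assoc)
  have "bij_betw (\<lambda>(p, p'). (p, p' \<otimes> p)) ?Y (H \<times> {p \<in> H. f (s \<otimes> p) = \<beta>})"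
  proof (rule bij_betw_byWitness[of _ "\<lambda>(p, h). (p, h \<otimes> inv p)"])
    show "(\<lambda>(p, h). (p, h \<otimes> inv p)) ` (H \<times> {p \<in> H. f (s \<otimes> p) = \<beta>}) \<subseteq> ?Y"
      using G cl by (auto simp: rot m_assoc)
  qed (use G cl in \<open>auto simp: rot m_assoc\<close>)
  then have "card ?Y = card H * card {p \<in> H. f (s \<otimes> p) = \<beta>}"
    by (simp add: bij_betw_same_card card_cartesian_product)
  moreover have "card ?Y = card ?D * card ?K"
  proof (rule card_equal_fibres[of _ _ "\<lambda>(p, p'). p \<otimes> s \<otimes> p'"])
    show "(\<lambda>(p, p'). p \<otimes> s \<otimes> p') ` ?Y \<subseteq> ?D"
      by auto
    have "?D \<subseteq> (\<lambda>(p, p'). p \<otimes> s \<otimes> p') ` ?Y"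
      by auto
    then show "finite ?D"
      by (rule finite_subset) (intro finite_imageI finY)
    fix w assume "w \<in> ?D"
    then obtain a b where w: "w = a \<otimes> s \<otimes> b" "a \<in> H" "b \<in> H" "f w = \<beta>"
      by auto
    have "bij_betw (\<lambda>x. (a \<otimes> x, inv (inv s \<otimes> x \<otimes> s) \<otimes> b)) ?K
        {y \<in> ?Y. (case y of (p, p') \<Rightarrow> p \<otimes> s \<otimes> p') = w}"
    proof (rule bij_betw_byWitness[of _ "\<lambda>(p, p'). inv a \<otimes> p"])
      show "\<forall>x\<in>?K. (case (a \<otimes> x, inv (inv s \<otimes> x \<otimes> s) \<otimes> b) of (p, p') \<Rightarrow> inv a \<otimes> p) = x"
        using G w(2) by (auto simp: m_assoc[symmetric])
      have key: "inv s \<otimes> (inv a \<otimes> p) \<otimes> s = b \<otimes> inv p'"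
        if "p \<in> H" "p' \<in> H" "p \<otimes> s \<otimes> p' = w" for p p'
      proof -
        have "inv s \<otimes> (inv a \<otimes> p) \<otimes> s = inv s \<otimes> inv a \<otimes> (p \<otimes> s \<otimes> p') \<otimes> inv p'"
          using that(1,2) G s w(2) by (simp add: m_assoc)
        also have "\<dots> = inv s \<otimes> inv a \<otimes> (a \<otimes> (s \<otimes> b)) \<otimes> inv p'"
          using that(2,3) w(1-3) G s by (simp add: m_assoc)
        also have "\<dots> = b \<otimes> inv p'"
          using that(2) w(2,3) G s by (simp add: m_assoc inv_solve_left')
        finally show ?thesis .
      qed
      show "\<forall>y\<in>{y \<in> ?Y. (case y of (p, p') \<Rightarrow> p \<otimes> s \<otimes> p') = w}.
          (\<lambda>x. (a \<otimes> x, inv (inv s \<otimes> x \<otimes> s) \<otimes> b)) (case y of (p, p') \<Rightarrow> inv a \<otimes> p) = y"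
        using G w(2,3) by (auto simp: key inv_mult_group m_assoc cancel)
      show "(\<lambda>x. (a \<otimes> x, inv (inv s \<otimes> x \<otimes> s) \<otimes> b)) ` ?K
          \<subseteq> {y \<in> ?Y. (case y of (p, p') \<Rightarrow> p \<otimes> s \<otimes> p') = w}"
      proof (rule image_subsetI)
        fix x assume x: "x \<in> ?K"
        have "a \<otimes> x \<otimes> s \<otimes> (inv (inv s \<otimes> x \<otimes> s) \<otimes> b) = w"
          using x s G w(1-3) by (simp add: inv_mult_group m_assoc cancel)
        then show "(a \<otimes> x, inv (inv s \<otimes> x \<otimes> s) \<otimes> b) \<in>
            {y \<in> ?Y. (case y of (p, p') \<Rightarrow> p \<otimes> s \<otimes> p') = w}"
          using x w(2-4) cl by auto
      qed
      show "(\<lambda>(p, p'). inv a \<otimes> p) ` {y \<in> ?Y. (case y of (p, p') \<Rightarrow> p \<otimes> s \<otimes> p') = w} \<subseteq> ?K"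
        using w(2,3) cl by (auto simp: key)
    qed
    then show "card {y \<in> ?Y. (case y of (p, p') \<Rightarrow> p \<otimes> s \<otimes> p') = w} = card ?K"
      by (simp add: bij_betw_same_card)
  qed (rule finY)
  ultimately show ?thesis
    by simp
qed

definition matrix_group :: "'a :: field itself \<Rightarrow> nat \<Rightarrow> 'a mat monoid" where
  "matrix_group T m = units_of (ring_mat T m ())"

lemma matrix_group_carrier: "carrier (matrix_group TYPE('a :: field) m) = GL m"
proof -
  have "M \<in> Units (ring_mat TYPE('a) m ()) \<longleftrightarrow> M \<in> GL m" for M
    using det_non_zero_imp_unit[of M m "()"] unit_imp_det_non_zero[of M m "()"]
    by (auto simp: GL_def Units_def ring_mat_def)
  then show ?thesis
    by (auto simp: matrix_group_def units_of_carrier)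
qed

lemma matrix_group_mult: "x \<otimes>\<^bsub>matrix_group T m\<^esub> y = x * y"
  by (simp add: matrix_group_def units_of_mult ring_mat_def)

lemma matrix_group_one: "\<one>\<^bsub>matrix_group T m\<^esub> = 1\<^sub>m m"
  by (simp add: matrix_group_def units_of_one ring_mat_def)

lemma matrix_group_group: "group (matrix_group TYPE('a :: field) m)"
proof -
  interpret ring "ring_mat TYPE('a) m ()"
    by (rule ring_mat)
  show ?thesis
    unfolding matrix_group_def by (rule units_group)
qed

lemma mat_trace_mult_commute:
  fixes x y :: "'a :: field mat"
  assumes "x \<in> carrier_mat m m" "y \<in> carrier_mat m m"
  shows "mat_trace (x * y) = mat_trace (y * x)"
proof -
  have "mat_trace (x * y) = (\<Sum>i<m. \<Sum>a<m. x $$ (i, a) * y $$ (a, i))"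
    using assms by (auto simp: mat_trace_def index_mult_mat_sum[of _ m m _ m]
        simp del: index_mult_mat(1) intro!: sum.cong)
  also have "\<dots> = (\<Sum>a<m. \<Sum>i<m. y $$ (a, i) * x $$ (i, a))"
    by (subst sum.swap) (simp add: mult.commute)
  also have "\<dots> = mat_trace (y * x)"
    using assms by (auto simp: mat_trace_def index_mult_mat_sum[of _ m m _ m]
        simp del: index_mult_mat(1) intro!: sum.cong)
  finally show ?thesis .
qed

definition perm_mat :: "nat \<Rightarrow> (nat \<Rightarrow> nat) \<Rightarrow> 'a :: semiring_1 mat" where
  "perm_mat m \<pi> = mat m m (\<lambda>(i, j). if j = \<pi> i then 1 else 0)"

lemma perm_mat_carrier [simp]: "perm_mat m \<pi> \<in> carrier_mat m m"
  by (simp add: perm_mat_def)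

context
  fixes m :: nat and \<pi> :: "nat \<Rightarrow> nat"
  assumes invol: "\<And>i. i < m \<Longrightarrow> \<pi> i < m" "\<And>i. i < m \<Longrightarrow> \<pi> (\<pi> i) = i"
begin

lemma perm_mat_mult_left:
  assumes "X \<in> carrier_mat m l" "i < m" "j < l"
  shows "(perm_mat m \<pi> * X) $$ (i, j) = (X :: 'a :: semiring_1 mat) $$ (\<pi> i, j)"
proof -
  have "(perm_mat m \<pi> * X) $$ (i, j) = (\<Sum>a<m. perm_mat m \<pi> $$ (i, a) * X $$ (a, j))"
    using assms by (intro index_mult_mat_sum) auto
  also have "\<dots> = (\<Sum>a<m. if a = \<pi> i then X $$ (a, j) else 0)"
    using assms by (intro sum.cong) (auto simp: perm_mat_def)
  finally show ?thesis
    using invol assms by simp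
qed

lemma perm_mat_mult_right:
  assumes "X \<in> carrier_mat l m" "i < l" "j < m"
  shows "(X * perm_mat m \<pi>) $$ (i, j) = (X :: 'a :: semiring_1 mat) $$ (i, \<pi> j)"
proof -
  have eq: "j = \<pi> a \<longleftrightarrow> a = \<pi> j" if "a < m" for a
    using invol that assms by metis
  have "(X * perm_mat m \<pi>) $$ (i, j) = (\<Sum>a<m. X $$ (i, a) * perm_mat m \<pi> $$ (a, j))"
    using assms by (intro index_mult_mat_sum) auto
  also have "\<dots> = (\<Sum>a<m. if a = \<pi> j then X $$ (i, a) else 0)"
    using assms eq by (intro sum.cong) (auto simp: perm_mat_def)
  finally show ?thesis
    using invol assms by simp
qed

lemma perm_mat_square: "perm_mat m \<pi> * perm_mat m \<pi> = (1\<^sub>m m :: 'a :: semiring_1 mat)"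
proof (rule eq_matI)
  fix i j assume ij: "i < dim_row (1\<^sub>m m :: 'a mat)" "j < dim_col (1\<^sub>m m :: 'a mat)"
  then have "(perm_mat m \<pi> * perm_mat m \<pi> :: 'a mat) $$ (i, j) = perm_mat m \<pi> $$ (\<pi> i, j)"
    by (intro perm_mat_mult_left[of _ m]) auto
  then show "(perm_mat m \<pi> * perm_mat m \<pi> :: 'a mat) $$ (i, j) = 1\<^sub>m m $$ (i, j)"
    using ij invol by (auto simp: perm_mat_def)
qed (simp_all add: perm_mat_def)

end

text \<open>
  The form matrix \<open>J\<close> is the permutation matrix of this involution of \<open>{..<2 * n}\<close>.
\<close>

definition half_swap :: "nat \<Rightarrow> nat \<Rightarrow> nat" where
  "half_swap n i = (if i < n then i + n else i - n)"

text \<open>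
  This is \<open>J w\<^sup>T J\<close>, so that \<open>w\<close> is symplectic if and only if it is the inverse of \<open>w\<close>.
\<close>

definition symp_adjoint :: "nat \<Rightarrow> 'a mat \<Rightarrow> 'a mat" where
  "symp_adjoint n w = mat (2 * n) (2 * n) (\<lambda>(i, j). w $$ (half_swap n j, half_swap n i))"

definition symplectic :: "nat \<Rightarrow> 'a :: semiring_1 mat set" where
  "symplectic n = {w \<in> carrier_mat (2 * n) (2 * n). symp_adjoint n w * w = 1\<^sub>m (2 * n)}"

lemma half_swap_involution:
  "i < 2 * n \<Longrightarrow> half_swap n i < 2 * n" "i < 2 * n \<Longrightarrow> half_swap n (half_swap n i) = i"
  by (auto simp: half_swap_def)

lemma symp_adjoint_carrier [simp]: "symp_adjoint n w \<in> carrier_mat (2 * n) (2 * n)"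
  by (simp add: symp_adjoint_def)

lemma symp_adjoint_adjoint: "w \<in> carrier_mat (2 * n) (2 * n) \<Longrightarrow> symp_adjoint n (symp_adjoint n w) = w"
  by (intro eq_matI) (auto simp: symp_adjoint_def half_swap_involution)

lemma symp_adjoint_one: "symp_adjoint n (1\<^sub>m (2 * n)) = 1\<^sub>m (2 * n)"
proof -
  have "half_swap n j = half_swap n i \<longleftrightarrow> j = i" if "i < 2 * n" "j < 2 * n" for i j
    using that by (metis half_swap_involution(2))
  then show ?thesis
    by (intro eq_matI) (auto simp: symp_adjoint_def half_swap_involution)
qed

lemma symp_adjoint_mult:
  fixes x y :: "'a :: field mat"
  assumes x: "x \<in> carrier_mat (2 * n) (2 * n)" and y: "y \<in> carrier_mat (2 * n) (2 * n)"
  shows "symp_adjoint n (x * y) = symp_adjoint n y * symp_adjoint n x"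
proof (rule eq_matI)
  fix i j assume "i < dim_row (symp_adjoint n y * symp_adjoint n x)"
    "j < dim_col (symp_adjoint n y * symp_adjoint n x)"
  then have ij: "i < 2 * n" "j < 2 * n"
    by (auto simp: symp_adjoint_def)
  have "(symp_adjoint n y * symp_adjoint n x) $$ (i, j) =
      (\<Sum>a<2 * n. y $$ (half_swap n a, half_swap n i) * x $$ (half_swap n j, half_swap n a))"
    using ij by (subst index_mult_mat_sum[OF symp_adjoint_carrier symp_adjoint_carrier])
      (auto simp: symp_adjoint_def intro!: sum.cong)
  also have "\<dots> = (\<Sum>a<2 * n. x $$ (half_swap n j, a) * y $$ (a, half_swap n i))"
    by (rule sum.reindex_bij_witness[of _ "half_swap n" "half_swap n"])
       (auto simp: half_swap_involution mult.commute[of "y $$ p" for p])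
  also have "\<dots> = (x * y) $$ (half_swap n j, half_swap n i)"
    using ij by (subst index_mult_mat_sum[OF x y]) (auto simp: half_swap_involution)
  finally show "symp_adjoint n (x * y) $$ (i, j) = (symp_adjoint n y * symp_adjoint n x) $$ (i, j)"
    using ij by (simp add: symp_adjoint_def)
qed (auto simp: symp_adjoint_def)

lemma symp_adjoint_four_block:
  assumes "a \<in> carrier_mat n n" "b \<in> carrier_mat n n" "c \<in> carrier_mat n n" "d \<in> carrier_mat n n"
  shows "symp_adjoint n (four_block_mat a b c d) =
    four_block_mat (transpose_mat d) (transpose_mat b) (transpose_mat c) (transpose_mat a)"
  using assms by (intro eq_matI) (auto simp: symp_adjoint_def half_swap_def)

lemma symplectic_mult:
  fixes x y :: "'a :: field mat"
  assumes "x \<in> symplectic n" "y \<in> symplectic n"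
  shows "x * y \<in> symplectic n"
proof -
  let ?m = "2 * n"
  have c: "x \<in> carrier_mat ?m ?m" "y \<in> carrier_mat ?m ?m"
    using assms by (auto simp: symplectic_def)
  have "symp_adjoint n (x * y) * (x * y) = symp_adjoint n y * (symp_adjoint n x * (x * y))"
    unfolding symp_adjoint_mult[OF c]
    by (rule assoc_mult_mat[OF symp_adjoint_carrier symp_adjoint_carrier]) (use c in auto)
  also have "symp_adjoint n x * (x * y) = symp_adjoint n x * x * y"
    using c by (simp add: assoc_mult_mat[OF symp_adjoint_carrier c])
  also have "\<dots> = y"
    using assms c by (simp add: symplectic_def)
  finally show ?thesis
    using assms c by (simp add: symplectic_def)
qed

lemma symplectic_adjoint:
  fixes w :: "'a :: field mat"
  assumes "w \<in> symplectic n"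
  shows "symp_adjoint n w \<in> symplectic n" "w * symp_adjoint n w = 1\<^sub>m (2 * n)"
proof -
  have w: "w \<in> carrier_mat (2 * n) (2 * n)" "symp_adjoint n w * w = 1\<^sub>m (2 * n)"
    using assms by (auto simp: symplectic_def)
  then show 1: "w * symp_adjoint n w = 1\<^sub>m (2 * n)"
    using mat_mult_left_right_inverse[OF symp_adjoint_carrier] by blast
  then show "symp_adjoint n w \<in> symplectic n"
    using w by (simp add: symplectic_def symp_adjoint_adjoint)
qed

definition lower_left_zero :: "nat \<Rightarrow> 'a :: zero mat \<Rightarrow> bool" where
  "lower_left_zero n w \<longleftrightarrow> (\<forall>i<n. \<forall>j<n. w $$ (n + i, j) = 0)"

lemma lower_left_zero_mult:
  fixes x y :: "'a :: field mat"
  assumes "x \<in> carrier_mat (2 * n) (2 * n)" "y \<in> carrier_mat (2 * n) (2 * n)"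
    and "lower_left_zero n x" "lower_left_zero n y"
  shows "lower_left_zero n (x * y)"
  unfolding lower_left_zero_def
proof (intro allI impI)
  fix i j assume ij: "i < n" "j < n"
  have zero: "x $$ (n + i, a) * y $$ (a, j) = 0" if "a < 2 * n" for a
  proof (cases "a < n")
    case True
    then show ?thesis
      using assms(3) ij by (simp add: lower_left_zero_def)
  next
    case False
    then have "y $$ (n + (a - n), j) = 0"
      using ij that by (intro assms(4)[unfolded lower_left_zero_def, rule_format]) auto
    then show ?thesis
      using False by simp
  qed
  have "(x * y) $$ (n + i, j) = (\<Sum>a<2 * n. x $$ (n + i, a) * y $$ (a, j))"
    using ij by (intro index_mult_mat_sum[OF assms(1,2)]) auto
  also have "\<dots> = 0"
    using zero by (intro sum.neutral) blast
  finally show "(x * y) $$ (n + i, j) = 0" .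
qed

definition parabolic_elt :: "'a :: field mat \<Rightarrow> 'a mat \<Rightarrow> 'a mat" where
  "parabolic_elt M E = four_block_mat M (M * E) (0\<^sub>m (dim_row M) (dim_row M)) (transpose_mat (mat_inv M))"

lemma parabolic_Sp_eq: "parabolic_Sp n = (\<lambda>(M, E). parabolic_elt M E) ` (GL n \<times> symmetric_mats n)"
proof -
  have prod: "four_block_mat M (0\<^sub>m n n) (0\<^sub>m n n) (transpose_mat M') *
      four_block_mat (1\<^sub>m n) E (0\<^sub>m n n) (1\<^sub>m n) = parabolic_elt M E"
    if "M \<in> carrier_mat n n" "M' \<in> carrier_mat n n" "E \<in> carrier_mat n n" "mat_inv M = M'"
    for M M' E :: "'a mat"
  proof -
    have "four_block_mat M (0\<^sub>m n n) (0\<^sub>m n n) (transpose_mat M') *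
      four_block_mat (1\<^sub>m n) E (0\<^sub>m n n) (1\<^sub>m n) =
      four_block_mat (M * 1\<^sub>m n + 0\<^sub>m n n * 0\<^sub>m n n) (M * E + 0\<^sub>m n n * 1\<^sub>m n)
       (0\<^sub>m n n * 1\<^sub>m n + transpose_mat M' * 0\<^sub>m n n) (0\<^sub>m n n * E + transpose_mat M' * 1\<^sub>m n)"
      using that by (intro mult_four_block_mat) auto
    then show ?thesis
      using that by (simp add: parabolic_elt_def)
  qed
  show ?thesis
  proof (intro equalityI subsetI)
    fix w :: "'a mat" assume "w \<in> parabolic_Sp n"
    then obtain M M' E where w: "w = four_block_mat M (0\<^sub>m n n) (0\<^sub>m n n) (transpose_mat M') *
        four_block_mat (1\<^sub>m n) E (0\<^sub>m n n) (1\<^sub>m n)"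
      and *: "M \<in> carrier_mat n n" "M' \<in> carrier_mat n n" "inverts_mat M M'" "E \<in> symmetric_mats n"
      by (auto simp: parabolic_Sp_def symmetric_mats_def)
    then have M: "M \<in> GL n" "mat_inv M = M'"
      by (auto simp: inverts_mat_def intro: GL_I mat_inv_unique)
    then have "w = parabolic_elt M E"
      using * prod[of M M' E] w by (simp add: symmetric_mats_def)
    then show "w \<in> (\<lambda>(M, E). parabolic_elt M E) ` (GL n \<times> symmetric_mats n)"
      using M * by auto
  next
    fix w :: "'a mat" assume "w \<in> (\<lambda>(M, E). parabolic_elt M E) ` (GL n \<times> symmetric_mats n)"
    then obtain M E where *: "M \<in> GL n" "E \<in> symmetric_mats n" "w = parabolic_elt M E"
      by auto
    note c = GL_carrier[OF *(1)] GL_carrier[OF mat_inv(1)[OF *(1)]]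
    have "inverts_mat M (mat_inv M)" "inverts_mat (mat_inv M) M"
      using c mat_inv[OF *(1)] by (auto simp: inverts_mat_def)
    then show "w \<in> parabolic_Sp n"
      using prod[of M "mat_inv M" E] * c
      unfolding parabolic_Sp_def symmetric_mats_def mem_Collect_eq
      by (intro exI[of _ M] exI[of _ "mat_inv M"] exI[of _ E]) simp
  qed
qed

lemma parabolic_elt_carrier:
  "M \<in> GL n \<Longrightarrow> parabolic_elt M E \<in> carrier_mat (2 * n) (2 * n)"
  using GL_carrier[of M n] GL_carrier[OF mat_inv(1), of M n]
  by (intro carrier_matI) (auto simp: parabolic_elt_def)

lemma parabolic_elt_index:
  assumes "M \<in> GL n" "E \<in> carrier_mat n n" "i < n" "j < n"
  shows "parabolic_elt M E $$ (i, j) = M $$ (i, j)"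
    "parabolic_elt M E $$ (i, n + j) = (M * E) $$ (i, j)"
    "parabolic_elt M E $$ (n + i, j) = 0"
    "parabolic_elt M E $$ (n + i, n + j) = mat_inv M $$ (j, i)"
  using assms GL_carrier[OF assms(1)] GL_carrier[OF mat_inv(1)[OF assms(1)]]
  by (auto simp: parabolic_elt_def simp del: index_mult_mat(1))

lemma inj_on_parabolic_elt: "inj_on (\<lambda>(M, E). parabolic_elt M E) (GL n \<times> symmetric_mats n)"
proof (rule inj_onI)
  fix x y :: "'a mat \<times> 'a mat"
  assume "x \<in> GL n \<times> symmetric_mats n" "y \<in> GL n \<times> symmetric_mats n"
    and eq: "(\<lambda>(M, E). parabolic_elt M E) x = (\<lambda>(M, E). parabolic_elt M E) y"
  then obtain M E M' E' where xy: "x = (M, E)" "y = (M', E')"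
    and M: "M \<in> GL n" "M' \<in> GL n" "E \<in> carrier_mat n n" "E' \<in> carrier_mat n n"
    by (auto simp: symmetric_mats_def)
  note c = GL_carrier[OF M(1)] GL_carrier[OF M(2)]
  have eq': "parabolic_elt M E = parabolic_elt M' E'"
    using eq xy by simp
  have "M = M'"
    using c parabolic_elt_index(1)[OF M(1,3)] parabolic_elt_index(1)[OF M(2,4)] eq'
    by (intro eq_matI) auto
  have "M * E = M * E'"
  proof (rule eq_matI)
    fix i j assume "i < dim_row (M * E')" "j < dim_col (M * E')"
    then show "(M * E) $$ (i, j) = (M * E') $$ (i, j)"
      using c M(4) parabolic_elt_index(2)[OF M(1,3)] parabolic_elt_index(2)[OF M(2,4)] eq' \<open>M = M'\<close>
      by (auto simp del: index_mult_mat(1))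
  qed (use c M in auto)
  then have "mat_inv M * M * E = mat_inv M * M * E'"
    using c(1) M(3,4) GL_carrier[OF mat_inv(1)[OF M(1)]]
    by (simp add: assoc_mult_mat[of _ n n _ n _ n])
  then show "x = y"
    using xy \<open>M = M'\<close> M(3,4) mat_inv(3)[OF M(1)] by simp
qed

text \<open>
  The parabolic subgroup is the stabiliser of the isotropic subspace spanned by the first
  \<open>n\<close> basis vectors: for a block triangular matrix with diagonal blocks \<open>a\<close>, \<open>d\<close> and upper right
  block \<open>b\<close>, being symplectic means that \<open>d\<close> is the inverse transpose of \<open>a\<close> and that
  \<open>d\<^sup>T b\<close> is symmetric. This description makes closure under products and inverses easy.
\<close>

lemma parabolic_Sp_iff:
  assumes char2: "(2 :: 'a :: field) = 0"
  shows "(w :: 'a mat) \<in> parabolic_Sp n \<longleftrightarrow> w \<in> symplectic n \<and> lower_left_zero n w"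
proof
  have block: "symp_adjoint n (four_block_mat a b (0\<^sub>m n n) d) * four_block_mat a b (0\<^sub>m n n) d =
      four_block_mat (transpose_mat d * a) (transpose_mat d * b + transpose_mat b * d)
        (0\<^sub>m n n) (transpose_mat a * d)"
    if c: "a \<in> carrier_mat n n" "b \<in> carrier_mat n n" "d \<in> carrier_mat n n" for a b d :: "'a mat"
  proof -
    have "symp_adjoint n (four_block_mat a b (0\<^sub>m n n) d) =
        four_block_mat (transpose_mat d) (transpose_mat b) (0\<^sub>m n n) (transpose_mat a)"
      using c by (subst symp_adjoint_four_block) auto
    moreover have "four_block_mat (transpose_mat d) (transpose_mat b) (0\<^sub>m n n) (transpose_mat a)
        * four_block_mat a b (0\<^sub>m n n) d =
      four_block_mat (transpose_mat d * a + transpose_mat b * 0\<^sub>m n n) (transpose_mat d * b + transpose_mat b * d)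
       (0\<^sub>m n n * a + transpose_mat a * 0\<^sub>m n n) (0\<^sub>m n n * b + transpose_mat a * d)"
      using c by (intro mult_four_block_mat) auto
    ultimately show ?thesis
      using c by simp
  qed
  {
    assume "w \<in> parabolic_Sp n"
    then obtain M E where M: "M \<in> GL n" and E: "E \<in> symmetric_mats n" and w: "w = parabolic_elt M E"
      by (auto simp: parabolic_Sp_eq)
    let ?I = "mat_inv M"
    have c: "M \<in> carrier_mat n n" "?I \<in> carrier_mat n n" "E \<in> carrier_mat n n" "transpose_mat E = E"
      using GL_carrier[OF M] GL_carrier[OF mat_inv(1)[OF M]] E by (auto simp: symmetric_mats_def)
    have "w = four_block_mat M (M * E) (0\<^sub>m n n) (transpose_mat ?I)"
      using c by (simp add: w parabolic_elt_def)
    then have "symp_adjoint n w * w = four_block_mat (?I * M) (?I * (M * E) + transpose_mat (M * E) * transpose_mat ?I)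
        (0\<^sub>m n n) (transpose_mat M * transpose_mat ?I)"
      using block[of M "M * E" "transpose_mat ?I"] c by simp
    also have "?I * (M * E) = E"
      using c mat_inv(3)[OF M] by (simp add: assoc_mult_mat[symmetric, of _ n n _ n _ n])
    also have "transpose_mat (M * E) * transpose_mat ?I = transpose_mat (?I * (M * E))"
      using c by (intro transpose_mult[symmetric]) auto
    also have "?I * (M * E) = E"
      using c mat_inv(3)[OF M] by (simp add: assoc_mult_mat[symmetric, of _ n n _ n _ n])
    also have "E + transpose_mat E = 0\<^sub>m n n"
      using c by (intro eq_matI) (auto simp: char2_add_self[OF char2])
    also have "transpose_mat M * transpose_mat ?I = transpose_mat (?I * M)"
      using c by (intro transpose_mult[symmetric]) auto
    also have "?I * M = 1\<^sub>m n"
      by (rule mat_inv(3)[OF M])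
    also have "four_block_mat (1\<^sub>m n) (0\<^sub>m n n) (0\<^sub>m n n) (transpose_mat (1\<^sub>m n)) = (1\<^sub>m (2 * n) :: 'a mat)"
      by (simp add: mult_2)
    finally have "w \<in> symplectic n"
      using parabolic_elt_carrier[OF M] w by (simp add: symplectic_def)
    moreover have "lower_left_zero n w"
      unfolding lower_left_zero_def w using parabolic_elt_index(3)[OF M c(3)] by blast
    ultimately show "w \<in> symplectic n \<and> lower_left_zero n w"
      by blast
  next
    assume w: "w \<in> symplectic n \<and> lower_left_zero n w"
    then have wc: "w \<in> carrier_mat (2 * n) (2 * n)"
      by (simp add: symplectic_def)
    define a b d where "a = mat n n (\<lambda>(i, j). w $$ (i, j))" and "b = mat n n (\<lambda>(i, j). w $$ (i, n + j))"
      and "d = mat n n (\<lambda>(i, j). w $$ (n + i, n + j))"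
    have c: "a \<in> carrier_mat n n" "b \<in> carrier_mat n n" "d \<in> carrier_mat n n"
      by (simp_all add: a_def b_def d_def)
    have w_eq: "w = four_block_mat a b (0\<^sub>m n n) d"
    proof (rule eq_matI)
      fix i j assume "i < dim_row (four_block_mat a b (0\<^sub>m n n) d)" "j < dim_col (four_block_mat a b (0\<^sub>m n n) d)"
      then have ij: "i < 2 * n" "j < 2 * n"
        using c by auto
      have "w $$ (i, j) = 0" if "\<not> i < n" "j < n"
      proof -
        have "w $$ (n + (i - n), j) = 0"
          using ij that by (intro w[THEN conjunct2, unfolded lower_left_zero_def, rule_format]) auto
        then show ?thesis
          using that by simp
      qed
      then show "w $$ (i, j) = four_block_mat a b (0\<^sub>m n n) d $$ (i, j)"
        using c ij by (auto simp: a_def b_def d_def)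
    qed (use wc c in auto)
    have "four_block_mat (transpose_mat d * a) (transpose_mat d * b + transpose_mat b * d)
        (0\<^sub>m n n) (transpose_mat a * d) = 1\<^sub>m (2 * n)" (is "four_block_mat ?A ?B _ _ = _")
      using w block[OF c] w_eq by (simp add: symplectic_def)
    then have entries: "four_block_mat ?A ?B (0\<^sub>m n n) (transpose_mat a * d) $$ (i, j) = 1\<^sub>m (2 * n) $$ (i, j)" for i j
      by simp
    have Ac: "?A \<in> carrier_mat n n" "?B \<in> carrier_mat n n"
      using c by auto
    have A1: "?A = 1\<^sub>m n"
    proof (rule eq_matI)
      fix i j assume "i < dim_row (1\<^sub>m n :: 'a mat)" "j < dim_col (1\<^sub>m n :: 'a mat)"
      then show "?A $$ (i, j) = 1\<^sub>m n $$ (i, j)"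
        using entries[of i j] Ac c by (simp del: index_mult_mat(1))
    qed (use Ac in auto)
    have B0: "?B $$ (i, j) = 0" if "i < n" "j < n" for i j
      using entries[of i "n + j"] Ac c that by (simp del: index_mult_mat(1) index_add_mat(1))
    have sym: "transpose_mat d * b \<in> symmetric_mats n"
    proof -
      have "(transpose_mat d * b) $$ (i, j) = (transpose_mat b * d) $$ (i, j)" if "i < n" "j < n" for i j
        using B0[OF that] c that by (simp add: char2_add_eq_0_iff[OF char2] del: index_mult_mat(1))
      then have "transpose_mat d * b = transpose_mat b * d"
        using c by (intro eq_matI) (auto simp del: index_mult_mat(1))
      also have "transpose_mat b * d = transpose_mat (transpose_mat d * b)"
        using c by (simp add: transpose_mult[of _ n n _ n])
      finally show ?thesis
        using c by (simp add: symmetric_mats_def)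
    qed
    have ad: "a * transpose_mat d = 1\<^sub>m n"
      using mat_mult_left_right_inverse[OF _ _ A1] c by auto
    have a: "a \<in> GL n" "mat_inv a = transpose_mat d"
      using GL_I[OF c(1) _ ad] mat_inv_unique[OF c(1) _ ad] c by auto
    have "a * (transpose_mat d * b) = b"
      using c ad by (simp add: assoc_mult_mat[symmetric, of _ n n _ n _ n])
    then have "w = parabolic_elt a (transpose_mat d * b)"
      using c w_eq a by (simp add: parabolic_elt_def)
    then show "w \<in> parabolic_Sp n"
      using a sym by (auto simp: parabolic_Sp_eq)
  }
qed

section \<open>The Weyl element and its double coset in the symplectic group\<close>

text \<open>
  The involution whose permutation matrix is \<open>\<sigma>\<close>, for \<open>n = k + 1\<close>: it exchanges \<open>i\<close> and
  \<open>n + i\<close> for \<open>i < k\<close> and fixes \<open>k\<close> and \<open>n + k\<close>.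
\<close>

definition sigma_perm :: "nat \<Rightarrow> nat \<Rightarrow> nat" where
  "sigma_perm k i = (if i < k then i + Suc k else if Suc k \<le> i \<and> i < Suc k + k then i - Suc k else i)"

lemma sigma_perm_involution:
  "i < 2 * Suc k \<Longrightarrow> sigma_perm k i < 2 * Suc k" "i < 2 * Suc k \<Longrightarrow> sigma_perm k (sigma_perm k i) = i"
  by (auto simp: sigma_perm_def)

lemma sigma_Sp_eq: "sigma_Sp (Suc k) k = perm_mat (2 * Suc k) (sigma_perm k)"
  by (rule eq_matI) (auto simp: sigma_Sp_def perm_mat_def sigma_perm_def Let_def)

lemma sigma_Sp_symplectic: "(sigma_Sp (Suc k) k :: 'a :: field mat) \<in> symplectic (Suc k)"
proof -
  let ?n = "Suc k" and ?P = "perm_mat (2 * Suc k) (sigma_perm k) :: 'a mat"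
  have comm: "sigma_perm k (half_swap ?n i) = half_swap ?n (sigma_perm k i)" if "i < 2 * ?n" for i
    using that by (auto simp: sigma_perm_def half_swap_def)
  have "half_swap ?n i = sigma_perm k (half_swap ?n j) \<longleftrightarrow> j = sigma_perm k i"
    if "i < 2 * ?n" "j < 2 * ?n" for i j
    using that by (metis comm half_swap_involution sigma_perm_involution)
  then have "symp_adjoint ?n ?P = ?P"
    using half_swap_involution
    by (intro eq_matI) (auto simp: symp_adjoint_def perm_mat_def simp del: mult_Suc_right)
  then show ?thesis
    unfolding sigma_Sp_eq symplectic_def
    using perm_mat_square[OF sigma_perm_involution, of k, where ?'a = 'a] by simp
qed

lemma symplectic_GL: "w \<in> symplectic n \<Longrightarrow> (w :: 'a :: field mat) \<in> GL (2 * n)"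
  using symplectic_adjoint[of w n] by (intro GL_I[of w _ "symp_adjoint n w"]) (auto simp: symplectic_def)

lemma parabolic_Sp_subgroup:
  assumes char2: "(2 :: 'a :: field) = 0"
  shows "subgroup (parabolic_Sp n) (matrix_group TYPE('a) (2 * n))"
proof -
  let ?G = "matrix_group TYPE('a) (2 * n)"
  interpret group ?G
    by (rule matrix_group_group)
  note iff = parabolic_Sp_iff[OF char2]
  have inv: "inv\<^bsub>?G\<^esub> w = symp_adjoint n w" if "w \<in> symplectic n" for w
    using that symplectic_adjoint[OF that]
    by (intro inv_equality) (auto simp: matrix_group_carrier matrix_group_mult matrix_group_one
        symplectic_GL symplectic_def)
  show ?thesis
  proof
    show "parabolic_Sp n \<subseteq> carrier ?G"
      using symplectic_GL by (auto simp: iff matrix_group_carrier)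
    show "x \<otimes>\<^bsub>?G\<^esub> y \<in> parabolic_Sp n" if "x \<in> parabolic_Sp n" "y \<in> parabolic_Sp n" for x y
      using that symplectic_mult[of x n y]
      by (auto simp: iff matrix_group_mult symplectic_def intro!: lower_left_zero_mult)
    show "\<one>\<^bsub>?G\<^esub> \<in> parabolic_Sp n"
      by (auto simp: iff matrix_group_one symplectic_def symp_adjoint_one lower_left_zero_def)
    show "inv\<^bsub>?G\<^esub> x \<in> parabolic_Sp n" if "x \<in> parabolic_Sp n" for x
    proof -
      have "x $$ (n + j, i) = 0" if "i < n" "j < n" for i j
        using \<open>x \<in> parabolic_Sp n\<close> that by (auto simp: iff lower_left_zero_def)
      then have "lower_left_zero n (symp_adjoint n x)"
        by (auto simp: lower_left_zero_def symp_adjoint_def half_swap_def add.commute)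
      then show ?thesis
        using that inv symplectic_adjoint(1) by (auto simp: iff)
    qed
  qed
qed

lemma card_DC_Sp_trace_mult:
  fixes \<beta> :: "'a :: {field, finite}" and k :: nat
  assumes char2: "(2 :: 'a) = 0"
  defines "\<sigma> \<equiv> sigma_Sp (Suc k) k :: 'a mat" and "P \<equiv> parabolic_Sp (Suc k) :: 'a mat set"
  shows "card {w \<in> DC_Sp (Suc k). mat_trace w = \<beta>} * card {x \<in> P. \<sigma> * x * \<sigma> \<in> P} =
    card P * card {p \<in> P. mat_trace (\<sigma> * p) = \<beta>}"
proof -
  let ?m = "2 * Suc k"
  let ?G = "matrix_group TYPE('a) ?m"
  interpret group ?G
    by (rule matrix_group_group)
  have \<sigma>: "\<sigma> \<in> carrier ?G" "\<sigma> \<otimes>\<^bsub>?G\<^esub> \<sigma> = \<one>\<^bsub>?G\<^esub>"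
    using symplectic_GL[OF sigma_Sp_symplectic[of k, where ?'a = 'a]]
      perm_mat_square[OF sigma_perm_involution, of k, where ?'a = 'a]
    by (simp_all only: \<sigma>_def matrix_group_carrier matrix_group_mult matrix_group_one sigma_Sp_eq)
  then have inv\<sigma>: "inv\<^bsub>?G\<^esub> \<sigma> = \<sigma>"
    by (intro inv_equality)
  have "finite P"
    unfolding P_def parabolic_Sp_eq by (intro finite_imageI finite_cartesian_product finite_GL finite_symmetric_mats)
  then have "card {w \<in> {p * \<sigma> * p' | p p'. p \<in> P \<and> p' \<in> P}. mat_trace w = \<beta>}
      * card {x \<in> P. \<sigma> * x * \<sigma> \<in> P} = card P * card {p \<in> P. mat_trace (\<sigma> * p) = \<beta>}"
    using card_double_coset_fibre[of P \<sigma> mat_trace \<beta>, unfolded inv\<sigma> matrix_group_mult]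
      parabolic_Sp_subgroup[OF char2, of "Suc k"] \<sigma>(1) mat_trace_mult_commute[of _ ?m]
    by (auto simp: P_def matrix_group_carrier GL_def)
  moreover have "{p * \<sigma> * p' | p p'. p \<in> P \<and> p' \<in> P} = DC_Sp (Suc k)"
    by (simp add: DC_Sp_def \<sigma>_def P_def)
  ultimately show ?thesis
    by simp
qed

text \<open>
  Multiplication by \<open>\<sigma>\<close> moves the first \<open>k\<close> rows of the upper right block \<open>M E\<close> and the first \<open>k\<close>
  rows of the vanishing lower left block onto the diagonal.
\<close>

lemma mat_trace_sigma_parabolic:
  fixes M E :: "'a :: field mat" and k :: nat
  assumes M: "M \<in> GL (Suc k)" and E: "E \<in> carrier_mat (Suc k) (Suc k)"
  shows "mat_trace (sigma_Sp (Suc k) k * parabolic_elt M E) =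
    M $$ (k, k) + mat_inv M $$ (k, k) + partial_trace k M E"
proof -
  let ?n = "Suc k"
  let ?w = "parabolic_elt M E"
  note w = parabolic_elt_carrier[OF M, of E]
  note idx = parabolic_elt_index[OF M E]
  have split: "(\<Sum>i<n + n'. f i) = (\<Sum>i<n. f i) + (\<Sum>i<n'. f (n + i))" for n n' and f :: "nat \<Rightarrow> 'a"
    by (induction n') (simp_all add: add.assoc)
  have "mat_trace (sigma_Sp ?n k * ?w) = (\<Sum>i<2 * ?n. ?w $$ (sigma_perm k i, i))"
    unfolding mat_trace_def sigma_Sp_eq
    by (intro sum.cong perm_mat_mult_left[OF sigma_perm_involution w]) (simp_all add: perm_mat_def)
  also have "\<dots> = (\<Sum>i<?n. ?w $$ (sigma_perm k i, i)) + (\<Sum>i<?n. ?w $$ (sigma_perm k (?n + i), ?n + i))"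
    by (simp only: mult_2 split)
  also have "(\<Sum>i<?n. ?w $$ (sigma_perm k i, i)) = (\<Sum>i<k. ?w $$ (?n + i, i)) + ?w $$ (k, k)"
    by (simp add: sigma_perm_def add.commute)
  also have "(\<Sum>i<k. ?w $$ (?n + i, i)) = 0"
    using idx(3) by simp
  also have "(\<Sum>i<?n. ?w $$ (sigma_perm k (?n + i), ?n + i)) =
      (\<Sum>i<k. ?w $$ (i, ?n + i)) + ?w $$ (?n + k, ?n + k)"
    by (simp add: sigma_perm_def)
  also have "(\<Sum>i<k. ?w $$ (i, ?n + i)) = partial_trace k M E"
    unfolding partial_trace_def using idx(2) by (intro sum.cong) auto
  finally show ?thesis
    using idx(1)[of k k] idx(4)[of k k] by (simp add: add_ac)
qed

text \<open>
  Conjugation by \<open>\<sigma>\<close> permutes rows and columns, and only the lower left block of the result has to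
  vanish. Its entries come from the leading block of \<open>M E\<close>, from the last column of \<open>M\<close> above the
  corner, and from the inverse transpose of \<open>M\<close>, where they vanish as soon as those of the last
  column do. Then the
  leading block of \<open>M\<close> is invertible and can be cancelled from that of \<open>M E\<close>.
\<close>

lemma sigma_conjugate_parabolic_iff:
  fixes M E :: "'a :: field mat" and k :: nat
  assumes char2: "(2 :: 'a) = 0"
    and M: "M \<in> GL (Suc k)" and E: "E \<in> symmetric_mats (Suc k)"
  defines "\<sigma> \<equiv> sigma_Sp (Suc k) k"
  shows "\<sigma> * parabolic_elt M E * \<sigma> \<in> parabolic_Sp (Suc k) \<longleftrightarrow>
    (\<forall>i<k. M $$ (i, k) = 0) \<and> leading_block k E = 0\<^sub>m k k"
proof -
  let ?n = "Suc k" and ?w = "parabolic_elt M E"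
  have E': "E \<in> carrier_mat ?n ?n"
    using E by (simp add: symmetric_mats_def)
  note w = parabolic_elt_carrier[OF M, of E]
  note idx = parabolic_elt_index[OF M E']
  note c = GL_carrier[OF M] GL_carrier[OF mat_inv(1)[OF M]]
  have P: "?w \<in> parabolic_Sp ?n"
    using M E by (auto simp: parabolic_Sp_eq)
  have "\<sigma> * ?w * \<sigma> \<in> symplectic ?n"
    unfolding \<sigma>_def using P
    by (intro symplectic_mult sigma_Sp_symplectic) (simp add: parabolic_Sp_iff[OF char2])
  then have "\<sigma> * ?w * \<sigma> \<in> parabolic_Sp ?n \<longleftrightarrow> lower_left_zero ?n (\<sigma> * ?w * \<sigma>)"
    by (simp add: parabolic_Sp_iff[OF char2])
  also have "\<dots> \<longleftrightarrow> (\<forall>i<?n. \<forall>j<?n. ?w $$ (sigma_perm k (?n + i), sigma_perm k j) = 0)"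
  proof -
    have "(\<sigma> * ?w * \<sigma>) $$ (i, j) = ?w $$ (sigma_perm k i, sigma_perm k j)"
      if "i < 2 * ?n" "j < 2 * ?n" for i j
    proof -
      have "(\<sigma> * ?w * \<sigma>) $$ (i, j) = (\<sigma> * ?w) $$ (i, sigma_perm k j)"
        unfolding \<sigma>_def sigma_Sp_eq using that w
        by (intro perm_mat_mult_right[OF sigma_perm_involution mult_carrier_mat[OF perm_mat_carrier w]])
      also have "\<dots> = ?w $$ (sigma_perm k i, sigma_perm k j)"
        unfolding \<sigma>_def sigma_Sp_eq using that w sigma_perm_involution
        by (intro perm_mat_mult_left[OF sigma_perm_involution w]) auto
      finally show ?thesis .
    qed
    then show ?thesis
      unfolding lower_left_zero_def by auto
  qed
  also have "\<dots> \<longleftrightarrow> (\<forall>i<k. \<forall>j<k. ?w $$ (i, ?n + j) = 0) \<and> (\<forall>i<k. ?w $$ (i, k) = 0) \<and>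
      (\<forall>j<k. ?w $$ (?n + k, ?n + j) = 0) \<and> ?w $$ (?n + k, k) = 0"
  proof -
    have val: "sigma_perm k (Suc (k + i)) = i" "sigma_perm k i = Suc (k + i)" if "i < k" for i
      using that by (simp_all add: sigma_perm_def)
    have last: "sigma_perm k (Suc (k + k)) = Suc (k + k)" "sigma_perm k k = k"
      by (simp_all add: sigma_perm_def)
    show ?thesis
      by (auto simp: All_less_Suc val last)
  qed
  also have "\<dots> \<longleftrightarrow> (\<forall>i<k. \<forall>j<k. (M * E) $$ (i, j) = 0) \<and> (\<forall>i<k. M $$ (i, k) = 0) \<and>
      (\<forall>j<k. mat_inv M $$ (j, k) = 0)"
    using idx by (auto simp del: index_mult_mat(1))
  also have "\<dots> \<longleftrightarrow> (\<forall>i<k. M $$ (i, k) = 0) \<and> leading_block k E = 0\<^sub>m k k"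
  proof (cases "\<forall>i<k. M $$ (i, k) = 0")
    case True
    have det: "det (leading_block k M) \<noteq> 0" "M $$ (k, k) \<noteq> 0"
      using det_last_column_zero[OF c(1) True] M by (auto simp: GL_def)
    have lastcol: "mat_inv M $$ (j, k) = 0" if "j < k" for j
    proof -
      have "(mat_inv M * M) $$ (j, k) = mat_inv M $$ (j, k) * M $$ (k, k)"
        using c True that by (subst index_mult_mat_sum[of _ ?n ?n _ ?n]) auto
      then show ?thesis
        using mat_inv(3)[OF M] that det(2) by simp
    qed
    have ME: "(M * E) $$ (i, j) = (leading_block k M * leading_block k E) $$ (i, j)"
      if "i < k" "j < k" for i j
    proof -
      have "(M * E) $$ (i, j) = (\<Sum>a<k. M $$ (i, a) * E $$ (a, j))"
        using c E' True that by (subst index_mult_mat_sum[of _ ?n ?n _ ?n]) auto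
      also have "\<dots> = (leading_block k M * leading_block k E) $$ (i, j)"
        using that by (subst index_mult_mat_sum[of _ k k _ k]) auto
      finally show ?thesis .
    qed
    have "(\<forall>i<k. \<forall>j<k. (M * E) $$ (i, j) = 0) \<longleftrightarrow> leading_block k M * leading_block k E = 0\<^sub>m k k"
      unfolding mat_eq_iff using ME by (auto simp del: index_mult_mat(1))
    also have "\<dots> \<longleftrightarrow> leading_block k E = 0\<^sub>m k k"
    proof
      assume *: "leading_block k M * leading_block k E = 0\<^sub>m k k"
      obtain L where L: "L \<in> GL k" "L * leading_block k M = 1\<^sub>m k"
        using GL_inverse[of "leading_block k M" k] det(1) by (auto simp: GL_def)
      have "L * leading_block k M * leading_block k E = L * (leading_block k M * leading_block k E)"
        using GL_carrier[OF L(1)] by (intro assoc_mult_mat) auto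
      then show "leading_block k E = 0\<^sub>m k k"
        using L * GL_carrier[OF L(1)] by simp
    qed simp
    finally show ?thesis
      using True lastcol by simp
  next
    case False
    then show ?thesis
      by blast
  qed
  finally show ?thesis .
qed

lemma card_parabolic_elts:
  fixes Q :: "'a :: field mat \<Rightarrow> bool"
  shows "card {w \<in> parabolic_Sp n. Q w} = card {(M, E). M \<in> GL n \<and> E \<in> symmetric_mats n \<and> Q (parabolic_elt M E)}"
proof -
  let ?S = "{(M, E). M \<in> GL n \<and> E \<in> symmetric_mats n \<and> Q (parabolic_elt M E)}"
  have "{w \<in> parabolic_Sp n. Q w} = (\<lambda>(M, E). parabolic_elt M E) ` ?S"
    unfolding parabolic_Sp_eq by auto
  moreover have "inj_on (\<lambda>(M, E). parabolic_elt M E) ?S"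
    by (rule inj_on_subset[OF inj_on_parabolic_elt[of n]]) auto
  ultimately show ?thesis
    by (simp add: card_image)
qed

lemma card_parabolic_Sp:
  "card (parabolic_Sp n :: 'a :: field mat set) =
     card (GL n :: 'a mat set) * card (symmetric_mats n :: 'a mat set)"
proof -
  have "{(M, E). M \<in> GL n \<and> E \<in> symmetric_mats n \<and> True} =
      (GL n :: 'a mat set) \<times> (symmetric_mats n :: 'a mat set)"
    by auto
  then show ?thesis
    using card_parabolic_elts[of n "\<lambda>_ :: 'a mat. True"]
    by (simp add: card_cartesian_product)
qed

lemma card_parabolic_Sp_sigma_stable:
  fixes \<sigma> :: "'a :: {field, finite} mat" and k :: nat
  assumes char2: "(2 :: 'a) = 0"
  defines "q \<equiv> CARD('a)" and "\<sigma> \<equiv> sigma_Sp (Suc k) k"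
  shows "card {x \<in> parabolic_Sp (Suc k). \<sigma> * x * \<sigma> \<in> parabolic_Sp (Suc k)} =
    card (GL k :: 'a mat set) * q ^ k * (q - 1) * q ^ Suc k"
proof -
  let ?M = "{M \<in> GL (Suc k). (\<forall>i<k. M $$ (i, k) = 0) \<and> leading_block k M \<in> GL k \<and> M $$ (k, k) \<in> - {0 :: 'a}}"
  let ?E = "{E \<in> symmetric_mats (Suc k). leading_block k E \<in> {0\<^sub>m k k :: 'a mat}}"
  have M: "M \<in> ?M \<longleftrightarrow> M \<in> GL (Suc k) \<and> (\<forall>i<k. M $$ (i, k) = 0)" for M
    using det_last_column_zero[of M k] by (auto simp: GL_def)
  have "card {x \<in> parabolic_Sp (Suc k). \<sigma> * x * \<sigma> \<in> parabolic_Sp (Suc k)} =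
      card {(M, E). M \<in> GL (Suc k) \<and> E \<in> symmetric_mats (Suc k) \<and>
        \<sigma> * parabolic_elt M E * \<sigma> \<in> parabolic_Sp (Suc k)}"
    by (rule card_parabolic_elts)
  also have "{(M, E). M \<in> GL (Suc k) \<and> E \<in> symmetric_mats (Suc k) \<and>
        \<sigma> * parabolic_elt M E * \<sigma> \<in> parabolic_Sp (Suc k)} = ?M \<times> ?E"
    unfolding \<sigma>_def using sigma_conjugate_parabolic_iff[OF char2] M by auto
  also have "card \<dots> = card ?M * card ?E"
    by (rule card_cartesian_product)
  also have "card ?M = card (GL k :: 'a mat set) * q ^ k * card (- {0 :: 'a})"
    unfolding q_def by (rule card_GL_last_column_zero) auto
  also have "card (- {0 :: 'a}) = q - 1"
    by (simp add: Compl_eq_Diff_UNIV card_Diff_singleton q_def)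
  also have "card ?E = card {0\<^sub>m k k :: 'a mat} * q ^ Suc k"
    unfolding q_def by (rule card_symmetric_mats_leading_block) (auto simp: symmetric_mats_def)
  finally show ?thesis
    by (simp only: card.insert finite.emptyI card.empty mult_1 insert_absorb) simp
qed

section \<open>From the orthogonal to the symplectic group\<close>

definition embed_odd :: "nat \<Rightarrow> 'a :: {zero, one} mat \<Rightarrow> 'a mat \<Rightarrow> 'a mat" where
  "embed_odd n X y = four_block_mat X (0\<^sub>m (2 * n) 1) y (1\<^sub>m 1)"

definition hyperbolic_form :: "nat \<Rightarrow> 'a :: semiring_0 vec \<Rightarrow> 'a" where
  "hyperbolic_form n v = (\<Sum>i<n. v $ i * v $ (n + i))"

text \<open>
  The condition that the block matrix with rows \<open>(X, 0)\<close> and \<open>(y, 1)\<close> preserves the quadratic form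
  \<open>hyperbolic_form v + z\<^sup>2\<close>, written out with \<open>(y \<bullet> v + z)\<^sup>2 = (y \<bullet> v)\<^sup>2 + z\<^sup>2\<close>.
\<close>

definition isometry_row :: "nat \<Rightarrow> 'a :: field mat \<Rightarrow> 'a mat \<Rightarrow> bool" where
  "isometry_row n X y \<longleftrightarrow> X \<in> carrier_mat (2 * n) (2 * n) \<and> y \<in> carrier_mat 1 (2 * n) \<and>
     (\<forall>v\<in>carrier_vec (2 * n).
       ((y *\<^sub>v v) $ 0)\<^sup>2 = hyperbolic_form n (X *\<^sub>v v) + hyperbolic_form n v)"

lemma isometry_rowD:
  assumes "isometry_row n X y"
  shows "X \<in> carrier_mat (2 * n) (2 * n)" "y \<in> carrier_mat 1 (2 * n)"
    "v \<in> carrier_vec (2 * n) \<Longrightarrow>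
      ((y *\<^sub>v v) $ 0)\<^sup>2 = hyperbolic_form n (X *\<^sub>v v) + hyperbolic_form n v"
  using assms unfolding isometry_row_def by blast+

lemma zero_row_mult_vec: "v \<in> carrier_vec m \<Longrightarrow> (0\<^sub>m 1 m *\<^sub>v v) $ 0 = (0 :: 'a :: field)"
  by simp

lemma embed_odd_mult:
  fixes X X' y y' :: "'a :: field mat"
  assumes "X \<in> carrier_mat (2 * n) (2 * n)" "y \<in> carrier_mat 1 (2 * n)"
    "X' \<in> carrier_mat (2 * n) (2 * n)" "y' \<in> carrier_mat 1 (2 * n)"
  shows "embed_odd n X y * embed_odd n X' y' = embed_odd n (X * X') (y * X' + y')"
proof -
  have "embed_odd n X y * embed_odd n X' y' =
      four_block_mat (X * X' + 0\<^sub>m (2 * n) 1 * y') (X * 0\<^sub>m (2 * n) 1 + 0\<^sub>m (2 * n) 1 * 1\<^sub>m 1)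
        (y * X' + 1\<^sub>m 1 * y') (y * 0\<^sub>m (2 * n) 1 + 1\<^sub>m 1 * 1\<^sub>m 1)"
    unfolding embed_odd_def using assms by (intro mult_four_block_mat) auto
  then show ?thesis
    using assms by (simp add: embed_odd_def)
qed

lemma leading_block_embed_odd:
  "X \<in> carrier_mat (2 * n) (2 * n) \<Longrightarrow> leading_block (2 * n) (embed_odd n X y) = X"
  by (intro eq_matI) (auto simp: embed_odd_def)

lemma mat_trace_embed_odd:
  assumes "X \<in> carrier_mat (2 * n) (2 * n)"
  shows "mat_trace (embed_odd n X y) = mat_trace X + (1 :: 'a :: field)"
  using assms by (simp add: mat_trace_def embed_odd_def)

lemma odd_block_mat_embed:
  "odd_block_mat n A B C D h =
     embed_odd n (four_block_mat A B C D) (four_block_mat (0\<^sub>m 1 n) h (0\<^sub>m 0 n) (0\<^sub>m 0 n))"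
  by (simp add: odd_block_mat_def embed_odd_def)

lemma isometry_row_mult:
  fixes X X' y y' :: "'a :: field mat"
  assumes char2: "(2 :: 'a) = 0"
    and "isometry_row n X y" "isometry_row n X' y'"
  shows "isometry_row n (X * X') (y * X' + y')"
  unfolding isometry_row_def
proof (intro conjI ballI)
  have c: "X \<in> carrier_mat (2 * n) (2 * n)" "y \<in> carrier_mat 1 (2 * n)"
    "X' \<in> carrier_mat (2 * n) (2 * n)" "y' \<in> carrier_mat 1 (2 * n)"
    using assms by (auto simp: isometry_row_def)
  then show "X * X' \<in> carrier_mat (2 * n) (2 * n)" "y * X' + y' \<in> carrier_mat 1 (2 * n)"
    by auto
  fix v :: "'a vec" assume v: "v \<in> carrier_vec (2 * n)"
  let ?Q = "hyperbolic_form n"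
  have "(y * X' + y') *\<^sub>v v = y *\<^sub>v (X' *\<^sub>v v) + y' *\<^sub>v v"
    using c v by (simp add: add_mult_distrib_mat_vec[of _ 1 "2 * n"] assoc_mult_mat_vec[of y 1 "2 * n" X' "2 * n"])
  then have "(((y * X' + y') *\<^sub>v v) $ 0)\<^sup>2 = ((y *\<^sub>v (X' *\<^sub>v v)) $ 0)\<^sup>2 + ((y' *\<^sub>v v) $ 0)\<^sup>2"
    using c v by (simp add: char2_square_add[OF char2])
  also have "\<dots> = (?Q (X *\<^sub>v (X' *\<^sub>v v)) + ?Q (X' *\<^sub>v v)) + (?Q (X' *\<^sub>v v) + ?Q v)"
    using c v by (simp only: isometry_rowD(3)[OF assms(2)] isometry_rowD(3)[OF assms(3)] mult_mat_vec_carrier)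
  also have "\<dots> = ?Q (X * X' *\<^sub>v v) + (?Q (X' *\<^sub>v v) + ?Q (X' *\<^sub>v v)) + ?Q v"
    using c v by (simp add: assoc_mult_mat_vec[of X "2 * n" "2 * n" X' "2 * n"] add_ac)
  finally show "(((y * X' + y') *\<^sub>v v) $ 0)\<^sup>2 = ?Q (X * X' *\<^sub>v v) + ?Q v"
    by (simp add: char2_add_self[OF char2])
qed

text \<open>
  The values \<open>(y \<bullet> v)\<^sup>2\<close> are determined by \<open>X\<close>, and squaring is injective.
\<close>

lemma isometry_row_unique:
  fixes X y y' :: "'a :: field mat"
  assumes char2: "(2 :: 'a) = 0" and "isometry_row n X y" "isometry_row n X y'"
  shows "y = y'"
proof (rule eq_matI)
  have c: "y \<in> carrier_mat 1 (2 * n)" "y' \<in> carrier_mat 1 (2 * n)"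
    using assms by (auto simp: isometry_row_def)
  fix i j assume ij: "i < dim_row y'" "j < dim_col y'"
  let ?e = "unit_vec (2 * n) j :: 'a vec"
  have "((y *\<^sub>v ?e) $ 0)\<^sup>2 = ((y' *\<^sub>v ?e) $ 0)\<^sup>2"
    by (simp only: isometry_rowD(3)[OF assms(2)] isometry_rowD(3)[OF assms(3)] unit_vec_carrier)
  then have "(y *\<^sub>v ?e) $ 0 = (y' *\<^sub>v ?e) $ 0"
    by (simp only: char2_square_inject[OF char2])
  then show "y $$ (i, j) = y' $$ (i, j)"
    using c ij by simp
qed (use assms in \<open>auto simp: isometry_row_def\<close>)

lemma hyperbolic_form_append:
  assumes "a \<in> carrier_vec n" "b \<in> carrier_vec n"
  shows "hyperbolic_form n (a @\<^sub>v b) = a \<bullet> (b :: 'a :: field vec)"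
  using assms by (auto simp: hyperbolic_form_def scalar_prod_def atLeast0LessThan intro!: sum.cong)

lemma split_vec:
  assumes "v \<in> carrier_vec (2 * n)"
  obtains a b where "a \<in> carrier_vec n" "b \<in> carrier_vec n" "v = a @\<^sub>v (b :: 'a vec)"
proof
  show "v = vec n (\<lambda>i. v $ i) @\<^sub>v vec n (\<lambda>i. v $ (n + i))"
    using assms by (intro eq_vecI) auto
qed auto

lemma isometry_row_diagonal:
  fixes M M' :: "'a :: field mat"
  assumes char2: "(2 :: 'a) = 0"
    and M: "M \<in> carrier_mat n n" "M' \<in> carrier_mat n n" "M' * M = 1\<^sub>m n"
  shows "isometry_row n (four_block_mat M (0\<^sub>m n n) (0\<^sub>m n n) (transpose_mat M')) (0\<^sub>m 1 (2 * n))"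
  unfolding isometry_row_def
proof (intro conjI ballI)
  fix v :: "'a vec" assume vc: "v \<in> carrier_vec (2 * n)"
  then obtain a b where v: "a \<in> carrier_vec n" "b \<in> carrier_vec n" "v = a @\<^sub>v b"
    using split_vec by blast
  have "four_block_mat M (0\<^sub>m n n) (0\<^sub>m n n) (transpose_mat M') *\<^sub>v v =
      (M *\<^sub>v a + 0\<^sub>m n n *\<^sub>v b) @\<^sub>v (0\<^sub>m n n *\<^sub>v a + transpose_mat M' *\<^sub>v b)"
    unfolding v(3) using M v by (intro four_block_mat_mult_vec) auto
  also have "\<dots> = (M *\<^sub>v a) @\<^sub>v (transpose_mat M' *\<^sub>v b)"
  proof -
    have "0\<^sub>m n n *\<^sub>v x = 0\<^sub>v n" if "x \<in> carrier_vec n" for x :: "'a vec"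
      using that by (intro eq_vecI) auto
    then show ?thesis
      using M v by simp
  qed
  also have "hyperbolic_form n \<dots> = (M *\<^sub>v a) \<bullet> (transpose_mat M' *\<^sub>v b)"
    using M v by (intro hyperbolic_form_append) auto
  also have "\<dots> = (transpose_mat M' *\<^sub>v b) \<bullet> (M *\<^sub>v a)"
    using M v by (intro comm_scalar_prod[of _ n]) auto
  also have "\<dots> = b \<bullet> (M' *\<^sub>v (M *\<^sub>v a))"
    using M v by (intro transpose_vec_mult_scalar) auto
  also have "M' *\<^sub>v (M *\<^sub>v a) = a"
    using M v by (simp add: assoc_mult_mat_vec[symmetric, of M' n n M n])
  also have "b \<bullet> a = hyperbolic_form n v"
    using v by (simp add: hyperbolic_form_append comm_scalar_prod[of b n a])
  finally show "((0\<^sub>m 1 (2 * n) *\<^sub>v v) $ 0)\<^sup>2 =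
      hyperbolic_form n (four_block_mat M (0\<^sub>m n n) (0\<^sub>m n n) (transpose_mat M') *\<^sub>v v) + hyperbolic_form n v"
    by (simp only: zero_row_mult_vec[OF vc] char2_add_self[OF char2] zero_power2)
qed (use M in \<open>auto intro!: carrier_matI\<close>)

lemma char2_sum_square:
  fixes f :: "nat \<Rightarrow> 'a :: field"
  assumes char2: "(2 :: 'a) = 0"
  shows "(\<Sum>i<n. f i)\<^sup>2 = (\<Sum>i<n. (f i)\<^sup>2)"
  by (induction n) (simp_all add: char2_square_add[OF char2])

text \<open>
  The form changes by \<open>b\<^sup>T E b\<close>, where \<open>b\<close> is the second half of the vector. In characteristic two
  only the diagonal of \<open>E\<close> contributes to this, giving a square that the row \<open>h\<close> compensates.
\<close>

lemma isometry_row_unipotent: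
  fixes E h :: "'a :: field mat"
  assumes char2: "(2 :: 'a) = 0"
    and E: "E \<in> symmetric_mats n" and h: "h \<in> carrier_mat 1 n"
    and diag: "\<And>i. i < n \<Longrightarrow> (h $$ (0, i))\<^sup>2 = E $$ (i, i)"
  shows "isometry_row n (four_block_mat (1\<^sub>m n) E (0\<^sub>m n n) (1\<^sub>m n))
    (four_block_mat (0\<^sub>m 1 n) h (0\<^sub>m 0 n) (0\<^sub>m 0 n))"
  unfolding isometry_row_def
proof (intro conjI ballI)
  have Ec: "E \<in> carrier_mat n n" "\<And>i j. i < n \<Longrightarrow> j < n \<Longrightarrow> E $$ (i, j) = E $$ (j, i)"
    using E by (auto simp: symmetric_mats_iff)
  show "four_block_mat (1\<^sub>m n) E (0\<^sub>m n n) (1\<^sub>m n) \<in> carrier_mat (2 * n) (2 * n)"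
    "four_block_mat (0\<^sub>m 1 n) h (0\<^sub>m 0 n) (0\<^sub>m 0 n) \<in> carrier_mat 1 (2 * n)"
    using h by (auto intro!: carrier_matI)
  fix v :: "'a vec" assume "v \<in> carrier_vec (2 * n)"
  then obtain a b where v: "a \<in> carrier_vec n" "b \<in> carrier_vec n" "v = a @\<^sub>v b"
    using split_vec by blast
  have zero: "0\<^sub>m m n *\<^sub>v x = 0\<^sub>v m" if "x \<in> carrier_vec n" for x :: "'a vec" and m
    using that by (intro eq_vecI) auto
  have "four_block_mat (1\<^sub>m n) E (0\<^sub>m n n) (1\<^sub>m n) *\<^sub>v v =
      (1\<^sub>m n *\<^sub>v a + E *\<^sub>v b) @\<^sub>v (0\<^sub>m n n *\<^sub>v a + 1\<^sub>m n *\<^sub>v b)"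
    unfolding v(3) using Ec v by (intro four_block_mat_mult_vec) auto
  also have "\<dots> = (a + E *\<^sub>v b) @\<^sub>v b"
    using Ec v zero by simp
  also have "hyperbolic_form n \<dots> = (a + E *\<^sub>v b) \<bullet> b"
    using Ec v by (intro hyperbolic_form_append) auto
  also have "\<dots> = a \<bullet> b + (E *\<^sub>v b) \<bullet> b"
    using Ec v by (intro add_scalar_prod_distrib) auto
  also have "(E *\<^sub>v b) \<bullet> b = (\<Sum>i<n. \<Sum>j<n. E $$ (i, j) * b $ j * b $ i)"
    using Ec(1) v by (auto simp: scalar_prod_def atLeast0LessThan sum_distrib_right intro!: sum.cong)
  also have "\<dots> = (\<Sum>i<n. E $$ (i, i) * b $ i * b $ i)"
    using Ec(2) by (intro char2_sum_symmetric[OF char2]) (simp add: mult_ac)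
  also have "\<dots> = (\<Sum>i<n. (h $$ (0, i) * b $ i)\<^sup>2)"
    using diag by (intro sum.cong) (auto simp: power2_eq_square[of "_ * _"] power2_eq_square mult_ac)
  also have "\<dots> = (\<Sum>i<n. h $$ (0, i) * b $ i)\<^sup>2"
    by (simp add: char2_sum_square[OF char2])
  finally have Q: "hyperbolic_form n (four_block_mat (1\<^sub>m n) E (0\<^sub>m n n) (1\<^sub>m n) *\<^sub>v v) =
      a \<bullet> b + (\<Sum>i<n. h $$ (0, i) * b $ i)\<^sup>2" .
  have "four_block_mat (0\<^sub>m 1 n) h (0\<^sub>m 0 n) (0\<^sub>m 0 n) *\<^sub>v v =
      (0\<^sub>m 1 n *\<^sub>v a + h *\<^sub>v b) @\<^sub>v (0\<^sub>m 0 n *\<^sub>v a + 0\<^sub>m 0 n *\<^sub>v b)"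
    unfolding v(3) using h v by (intro four_block_mat_mult_vec) auto
  then have "(four_block_mat (0\<^sub>m 1 n) h (0\<^sub>m 0 n) (0\<^sub>m 0 n) *\<^sub>v v) $ 0 = (h *\<^sub>v b) $ 0"
    using h v(1,2) zero by simp
  also have "\<dots> = (\<Sum>i<n. h $$ (0, i) * b $ i)"
    using h v by (auto simp: scalar_prod_def atLeast0LessThan intro!: sum.cong)
  finally have hv: "(four_block_mat (0\<^sub>m 1 n) h (0\<^sub>m 0 n) (0\<^sub>m 0 n) *\<^sub>v v) $ 0 =
      (\<Sum>i<n. h $$ (0, i) * b $ i)" .
  have Qv: "hyperbolic_form n v = a \<bullet> b"
    using v by (simp add: hyperbolic_form_append)
  have "x + y + x = y" for x y :: 'a
    using char2_add_self[OF char2, of x] by (simp add: add.commute add.left_commute)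
  then show "((four_block_mat (0\<^sub>m 1 n) h (0\<^sub>m 0 n) (0\<^sub>m 0 n) *\<^sub>v v) $ 0)\<^sup>2 =
      hyperbolic_form n (four_block_mat (1\<^sub>m n) E (0\<^sub>m n n) (1\<^sub>m n) *\<^sub>v v) + hyperbolic_form n v"
    unfolding hv Q Qv by (rule sym)
qed

lemma sigma_O_embed:
  "sigma_O (Suc k) k = embed_odd (Suc k) (sigma_Sp (Suc k) k) (0\<^sub>m 1 (2 * Suc k))"
  unfolding sigma_O_def sigma_Sp_def odd_block_mat_embed
  by (intro arg_cong[of _ _ "embed_odd (Suc k) _"] eq_matI) auto

lemma isometry_row_sigma:
  assumes char2: "(2 :: 'a :: field) = 0"
  shows "isometry_row (Suc k) (sigma_Sp (Suc k) k :: 'a mat) (0\<^sub>m 1 (2 * Suc k))"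
  unfolding isometry_row_def
proof (intro conjI ballI)
  let ?n = "Suc k"
  let ?s = "sigma_Sp ?n k :: 'a mat"
  fix v :: "'a vec" assume v: "v \<in> carrier_vec (2 * ?n)"
  have sv: "(?s *\<^sub>v v) $ i = v $ sigma_perm k i" if i: "i < 2 * ?n" for i
  proof -
    have "(?s *\<^sub>v v) $ i = (\<Sum>a<2 * ?n. perm_mat (2 * ?n) (sigma_perm k) $$ (i, a) * v $ a)"
      unfolding sigma_Sp_eq using i v
      by (simp add: scalar_prod_def atLeast0LessThan perm_mat_def del: mult_Suc_right sum.lessThan_Suc)
    also have "\<dots> = (\<Sum>a<2 * ?n. if a = sigma_perm k i then v $ a else 0)"
      using i by (intro sum.cong) (auto simp: perm_mat_def)
    also have "\<dots> = v $ sigma_perm k i"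
      using sigma_perm_involution(1)[OF i] by (simp del: mult_Suc_right)
    finally show ?thesis .
  qed
  have "hyperbolic_form ?n (?s *\<^sub>v v) = (\<Sum>i<?n. v $ sigma_perm k i * v $ sigma_perm k (?n + i))"
    unfolding hyperbolic_form_def by (intro sum.cong) (auto simp: sv)
  also have "\<dots> = hyperbolic_form ?n v"
    unfolding hyperbolic_form_def by (intro sum.cong) (auto simp: sigma_perm_def add.commute mult.commute)
  finally show "((0\<^sub>m 1 (2 * ?n) *\<^sub>v v) $ 0)\<^sup>2 = hyperbolic_form ?n (?s *\<^sub>v v) + hyperbolic_form ?n v"
    by (simp only: zero_row_mult_vec[OF v] char2_add_self[OF char2] zero_power2)
qed (auto simp: sigma_Sp_eq)

lemma parabolic_O_embed:
  assumes char2: "(2 :: 'a :: field) = 0" and "(w :: 'a mat) \<in> parabolic_O n"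
  obtains X y where "w = embed_odd n X y" "X \<in> parabolic_Sp n" "isometry_row n X y"
proof -
  from assms(2) obtain M M' E h where
    w: "w = odd_block_mat n M (0\<^sub>m n n) (0\<^sub>m n n) (transpose_mat M') (0\<^sub>m 1 n)
        * odd_block_mat n (1\<^sub>m n) E (0\<^sub>m n n) (1\<^sub>m n) h"
    and M: "M \<in> carrier_mat n n" "M' \<in> carrier_mat n n" "inverts_mat M M'" "inverts_mat M' M"
    and E: "E \<in> carrier_mat n n" and h: "h \<in> carrier_mat 1 n"
    and alt: "alternating_mat (E + transpose_mat h * h)"
    unfolding parabolic_O_def by blast
  have hh: "(transpose_mat h * h) $$ (i, j) = h $$ (0, i) * h $$ (0, j)" if "i < n" "j < n" for i j
    using h that by (subst index_mult_mat_sum[of _ n 1 _ n]) auto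
  have Ehh: "E + transpose_mat h * h \<in> carrier_mat n n"
    using E h by simp
  have sum_idx: "(E + transpose_mat h * h) $$ (i, j) = E $$ (i, j) + h $$ (0, i) * h $$ (0, j)"
    if "i < n" "j < n" for i j
    using E h hh[OF that] that by (simp del: index_mult_mat(1))
  note alt' = alt[unfolded alternating_mat_iff[OF Ehh]]
  have diag: "(h $$ (0, i))\<^sup>2 = E $$ (i, i)" if "i < n" for i
    using alt' that sum_idx[of i i] char2_add_eq_0_iff[OF char2, of "E $$ (i, i)" "(h $$ (0, i))\<^sup>2"]
    by (simp add: power2_eq_square)
  have "E $$ (a, b) = E $$ (b, a)" if "a < n" "b < n" for a b
    using alt' that sum_idx[of a b] sum_idx[of b a] by (metis add_right_cancel mult.commute)
  then have Esym: "E \<in> symmetric_mats n"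
    using E by (simp add: symmetric_mats_iff)
  let ?D = "four_block_mat M (0\<^sub>m n n) (0\<^sub>m n n) (transpose_mat M')"
  let ?U = "four_block_mat (1\<^sub>m n) E (0\<^sub>m n n) (1\<^sub>m n)"
  let ?h = "four_block_mat (0\<^sub>m 1 n) h (0\<^sub>m 0 n) (0\<^sub>m 0 n)"
  have zero: "four_block_mat (0\<^sub>m 1 n) (0\<^sub>m 1 n) (0\<^sub>m 0 n) (0\<^sub>m 0 n) = (0\<^sub>m 1 (2 * n) :: 'a mat)"
    by (intro eq_matI) auto
  have iso: "isometry_row n ?D (0\<^sub>m 1 (2 * n))" "isometry_row n ?U ?h"
    using M isometry_row_diagonal[OF char2] isometry_row_unipotent[OF char2 Esym h diag]
    by (auto simp: inverts_mat_def)
  have "w = embed_odd n (?D * ?U) (0\<^sub>m 1 (2 * n) * ?U + ?h)"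
    unfolding w odd_block_mat_embed zero
    by (rule embed_odd_mult) (use iso in \<open>auto simp: isometry_row_def\<close>)
  moreover have "?D * ?U \<in> parabolic_Sp n"
    unfolding parabolic_Sp_def using M Esym by (auto simp: symmetric_mats_def)
  ultimately show ?thesis
    using that isometry_row_mult[OF char2 iso] by blast
qed

text \<open>
  The row \<open>h\<close> has to consist of square roots of the diagonal entries of \<open>E\<close>.
\<close>

lemma parabolic_O_lift:
  fixes X :: "'a :: {field, finite} mat"
  assumes card: "CARD('a) = 2 ^ r" and "X \<in> parabolic_Sp n"
  obtains y where "embed_odd n X y \<in> parabolic_O n"
proof -
  from assms(2) obtain M M' E where
    X: "X = four_block_mat M (0\<^sub>m n n) (0\<^sub>m n n) (transpose_mat M') * four_block_mat (1\<^sub>m n) E (0\<^sub>m n n) (1\<^sub>m n)"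
    and M: "M \<in> carrier_mat n n" "M' \<in> carrier_mat n n" "inverts_mat M M'" "inverts_mat M' M"
    and E: "E \<in> symmetric_mats n"
    unfolding parabolic_Sp_def symmetric_mats_def by blast
  have "\<exists>z :: 'a. z\<^sup>2 = x" for x
    using square_surj[OF card] by (metis surjD)
  then obtain root :: "'a \<Rightarrow> 'a" where root: "(root x)\<^sup>2 = x" for x
    by metis
  define h where "h = mat 1 n (\<lambda>(_, i). root (E $$ (i, i)))"
  have Ec: "E \<in> carrier_mat n n" and h: "h \<in> carrier_mat 1 n"
    using E by (auto simp: symmetric_mats_def h_def)
  have idx: "(E + transpose_mat h * h) $$ (i, j) = E $$ (i, j) + root (E $$ (i, i)) * root (E $$ (j, j))"
    if "i < n" "j < n" for i j
  proof -
    have "(transpose_mat h * h) $$ (i, j) = root (E $$ (i, i)) * root (E $$ (j, j))"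
      using h that by (subst index_mult_mat_sum[of _ n 1 _ n]) (auto simp: h_def)
    then show ?thesis
      using Ec h that by (simp del: index_mult_mat(1))
  qed
  have "alternating_mat (E + transpose_mat h * h)"
  proof (subst alternating_mat_iff[of _ n], goal_cases)
    case 1
    then show ?case
      using Ec h by simp
  next
    case 2
    have "E $$ (i, j) = E $$ (j, i)" if "i < n" "j < n" for i j
      using E that unfolding symmetric_mats_iff by blast
    moreover have "E $$ (i, i) + root (E $$ (i, i)) * root (E $$ (i, i)) = 0" for i
      using root[of "E $$ (i, i)"] char2_add_self[OF char_two_of_card[OF card]]
      by (simp only: power2_eq_square)
    ultimately show ?case
      using idx by (metis mult.commute)
  qed
  then have "odd_block_mat n M (0\<^sub>m n n) (0\<^sub>m n n) (transpose_mat M') (0\<^sub>m 1 n)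
        * odd_block_mat n (1\<^sub>m n) E (0\<^sub>m n n) (1\<^sub>m n) h \<in> parabolic_O n"
    unfolding parabolic_O_def using M Ec h by blast
  moreover have "odd_block_mat n M (0\<^sub>m n n) (0\<^sub>m n n) (transpose_mat M') (0\<^sub>m 1 n)
        * odd_block_mat n (1\<^sub>m n) E (0\<^sub>m n n) (1\<^sub>m n) h = embed_odd n X
          (four_block_mat (0\<^sub>m 1 n) (0\<^sub>m 1 n) (0\<^sub>m 0 n) (0\<^sub>m 0 n) * four_block_mat (1\<^sub>m n) E (0\<^sub>m n n) (1\<^sub>m n)
            + four_block_mat (0\<^sub>m 1 n) h (0\<^sub>m 0 n) (0\<^sub>m 0 n))"
    unfolding odd_block_mat_embed X
    by (rule embed_odd_mult) (use M Ec h in \<open>auto intro!: carrier_matI\<close>)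
  ultimately show ?thesis
    using that by metis
qed

text \<open>
  Deleting the last row and column is multiplicative on block triangular matrices, sends the
  factors of one double coset onto those of the other, and is injective because the last row
  of an isometry is determined by the remaining block.
\<close>

lemma bij_betw_DC_O_DC_Sp:
  assumes card: "CARD('a :: {field, finite}) = 2 ^ r"
  shows "bij_betw (leading_block (2 * Suc k)) (DC_O (Suc k) :: 'a mat set) (DC_Sp (Suc k))"
    and "\<And>w. w \<in> (DC_O (Suc k) :: 'a mat set) \<Longrightarrow>
      mat_trace w = mat_trace (leading_block (2 * Suc k) w) + 1"
proof -
  let ?n = "Suc k"
  let ?s = "sigma_Sp ?n k :: 'a mat"
  note char2 = char_two_of_card[OF card]
  have lead: "leading_block (2 * ?n) (embed_odd ?n X y) = X" if "isometry_row ?n X y" for X y :: "'a mat"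
    using leading_block_embed_odd[OF isometry_rowD(1)[OF that]] .
  have prod: "embed_odd ?n X y * sigma_O ?n k * embed_odd ?n X' y' =
        embed_odd ?n (X * ?s * X') ((y * ?s + 0\<^sub>m 1 (2 * ?n)) * X' + y')"
      "isometry_row ?n (X * ?s * X') ((y * ?s + 0\<^sub>m 1 (2 * ?n)) * X' + y')"
    if "isometry_row ?n X y" "isometry_row ?n X' y'" for X y X' y' :: "'a mat"
  proof -
    note s = isometry_row_sigma[OF char2, of k]
    note i1 = isometry_row_mult[OF char2 that(1) s]
    show "embed_odd ?n X y * sigma_O ?n k * embed_odd ?n X' y' =
        embed_odd ?n (X * ?s * X') ((y * ?s + 0\<^sub>m 1 (2 * ?n)) * X' + y')"
      unfolding sigma_O_embed embed_odd_mult[OF isometry_rowD(1,2)[OF that(1)] isometry_rowD(1,2)[OF s]]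
      by (rule embed_odd_mult[OF isometry_rowD(1,2)[OF i1] isometry_rowD(1,2)[OF that(2)]])
    show "isometry_row ?n (X * ?s * X') ((y * ?s + 0\<^sub>m 1 (2 * ?n)) * X' + y')"
      by (rule isometry_row_mult[OF char2 i1 that(2)])
  qed
  have elt: "\<exists>X y. w = embed_odd ?n X y \<and> X \<in> DC_Sp ?n \<and> isometry_row ?n X y"
    if w: "w \<in> (DC_O ?n :: 'a mat set)" for w
  proof -
    obtain p p' where w: "w = p * sigma_O ?n k * p'" "p \<in> parabolic_O ?n" "p' \<in> parabolic_O ?n"
      using w unfolding DC_O_def diff_Suc_1 by blast
    obtain X y where X: "p = embed_odd ?n X y" "X \<in> parabolic_Sp ?n" "isometry_row ?n X y"
      using parabolic_O_embed[OF char2 w(2)] .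
    obtain X' y' where X': "p' = embed_odd ?n X' y'" "X' \<in> parabolic_Sp ?n" "isometry_row ?n X' y'"
      using parabolic_O_embed[OF char2 w(3)] .
    have "X * ?s * X' \<in> DC_Sp ?n"
      unfolding DC_Sp_def diff_Suc_1 using X(2) X'(2) by blast
    then show ?thesis
      unfolding w(1) X(1) X'(1) using prod[OF X(3) X'(3)] by blast
  qed
  show "mat_trace w = mat_trace (leading_block (2 * ?n) w) + 1" if w: "w \<in> (DC_O ?n :: 'a mat set)" for w
  proof -
    obtain X y where "w = embed_odd ?n X y" "isometry_row ?n X y"
      using elt[OF w] by blast
    then show ?thesis
      by (simp only: lead mat_trace_embed_odd[OF isometry_rowD(1)])
  qed
  show "bij_betw (leading_block (2 * ?n)) (DC_O ?n :: 'a mat set) (DC_Sp ?n)"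
  proof (rule bij_betwI')
    fix w w' :: "'a mat" assume w: "w \<in> DC_O ?n" "w' \<in> DC_O ?n"
    obtain X y where X: "w = embed_odd ?n X y" "isometry_row ?n X y"
      using elt[OF w(1)] by blast
    obtain X' y' where X': "w' = embed_odd ?n X' y'" "isometry_row ?n X' y'"
      using elt[OF w(2)] by blast
    show "leading_block (2 * ?n) w = leading_block (2 * ?n) w' \<longleftrightarrow> w = w'"
      unfolding X(1) X'(1) lead[OF X(2)] lead[OF X'(2)]
      using isometry_row_unique[OF char2] X(2) X'(2) lead by metis
  next
    fix w :: "'a mat" assume "w \<in> DC_O ?n"
    then show "leading_block (2 * ?n) w \<in> DC_Sp ?n"
      using elt[of w] lead by metis
  next
    fix X :: "'a mat" assume "X \<in> DC_Sp ?n"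
    then obtain a b where X: "X = a * ?s * b" "a \<in> parabolic_Sp ?n" "b \<in> parabolic_Sp ?n"
      unfolding DC_Sp_def diff_Suc_1 by blast
    have carr: "x \<in> carrier_mat (2 * ?n) (2 * ?n)" if "x \<in> parabolic_Sp ?n" for x :: "'a mat"
      using that unfolding parabolic_Sp_iff[OF char2] symplectic_def by blast
    have lift: "\<exists>y. embed_odd ?n x y \<in> parabolic_O ?n \<and> isometry_row ?n x y"
      if x: "x \<in> parabolic_Sp ?n" for x :: "'a mat"
    proof -
      obtain y where y: "embed_odd ?n x y \<in> parabolic_O ?n"
        using parabolic_O_lift[OF card x] .
      obtain x1 y1 where 1: "embed_odd ?n x y = embed_odd ?n x1 y1" "isometry_row ?n x1 y1"
        using parabolic_O_embed[OF char2 y] .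
      have "x1 = x"
        using lead[OF 1(2)] leading_block_embed_odd[OF carr[OF x], of y] 1(1) by simp
      then show ?thesis
        using y 1 by metis
    qed
    obtain ya yb where y: "embed_odd ?n a ya \<in> parabolic_O ?n" "isometry_row ?n a ya"
        "embed_odd ?n b yb \<in> parabolic_O ?n" "isometry_row ?n b yb"
      using lift[OF X(2)] lift[OF X(3)] by blast
    let ?w = "embed_odd ?n a ya * sigma_O ?n k * embed_odd ?n b yb"
    have "?w \<in> DC_O ?n"
      unfolding DC_O_def diff_Suc_1 using y by blast
    moreover have "leading_block (2 * ?n) ?w = X"
      unfolding prod(1)[OF y(2,4)] X(1) by (rule lead[OF prod(2)[OF y(2,4)]])
    ultimately show "\<exists>w\<in>DC_O ?n. X = leading_block (2 * ?n) w"
      by blast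
  qed
qed

lemma card_DC_O_trace:
  fixes \<beta> :: "'a :: {field, finite}"
  assumes card: "CARD('a) = 2 ^ r"
  shows "card {w \<in> DC_O (Suc k). mat_trace w = \<beta>} = card {w \<in> DC_Sp (Suc k). mat_trace w = \<beta> - 1}"
proof -
  let ?l = "leading_block (2 * Suc k) :: 'a mat \<Rightarrow> 'a mat"
  note bij = bij_betw_DC_O_DC_Sp(1)[OF card, of k]
  have "bij_betw ?l {w \<in> DC_O (Suc k). mat_trace w = \<beta>} {w \<in> DC_Sp (Suc k). mat_trace w = \<beta> - 1}"
  proof (rule bij_betw_subset[OF bij])
    show "?l ` {w \<in> DC_O (Suc k). mat_trace w = \<beta>} = {w \<in> DC_Sp (Suc k). mat_trace w = \<beta> - 1}"
    proof (intro equalityI subsetI)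
      fix X assume X: "X \<in> {w \<in> DC_Sp (Suc k). mat_trace w = \<beta> - 1}"
      then obtain w where w: "w \<in> DC_O (Suc k)" "X = ?l w"
        using bij unfolding bij_betw_def by blast
      then have "mat_trace w = \<beta>"
        using X bij_betw_DC_O_DC_Sp(2)[OF card w(1)] by simp
      then show "X \<in> ?l ` {w \<in> DC_O (Suc k). mat_trace w = \<beta>}"
        using w by blast
    next
      fix X assume "X \<in> ?l ` {w \<in> DC_O (Suc k). mat_trace w = \<beta>}"
      then obtain w where w: "w \<in> DC_O (Suc k)" "X = ?l w" "mat_trace w = \<beta>"
        by blast
      moreover have "X \<in> DC_Sp (Suc k)"
        using bij w unfolding bij_betw_def by blast
      moreover have "mat_trace X = \<beta> - 1"
        using w(2,3) bij_betw_DC_O_DC_Sp(2)[OF card w(1)] by (metis add_diff_cancel_right')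
      ultimately show "X \<in> {w \<in> DC_Sp (Suc k). mat_trace w = \<beta> - 1}"
        by blast
    qed
  qed auto
  then show ?thesis
    by (rule bij_betw_same_card)
qed

section \<open>The distribution of the trace on the symplectic double coset\<close>

lemma num_B_odd: "num_B (Suc (2 * m)) q = q ^ (m\<^sup>2) * (q ^ Suc (2 * m) - 1) * (\<Prod>j=1..m. q ^ (2 * j) - 1)"
proof -
  have "(2 * m)\<^sup>2 div 4 = m\<^sup>2"
    by (simp add: power_mult_distrib)
  then show ?thesis
    by (simp add: num_B_def)
qed

lemma num_A_odd: "num_A (Suc (2 * m)) q = q ^ (5 * m\<^sup>2 + 5 * m + 1) * ((q ^ Suc (2 * m) - 1) div (q - 1))
    * (\<Prod>j=1..m. q ^ (2 * j - 1) - 1)"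
proof -
  have "5 * (Suc (2 * m))\<^sup>2 - 1 = 4 * (5 * m\<^sup>2 + 5 * m + 1)"
    by (simp add: power2_eq_square algebra_simps)
  then have "(5 * (Suc (2 * m))\<^sup>2 - 1) div 4 = 5 * m\<^sup>2 + 5 * m + 1"
    by simp
  moreover have "(Suc (2 * m) - 1) div 2 = m"
    by simp
  ultimately show ?thesis
    by (simp only: num_A_def)
qed

text \<open>
  In the recursion for the order of \<open>GL\<close>, two steps at a time, the factors \<open>q ^ (2 * j - 1) - 1\<close> belong to
  the alternating matrices; what is left makes up \<open>B\<close>.
\<close>

lemma card_GL_odd:
  assumes char2: "(2 :: 'a :: {field, finite}) = 0"
  defines "q \<equiv> CARD('a)"
  shows "card (GL (Suc (2 * m)) :: 'a mat set) =
    num_B (Suc (2 * m)) q * (card (GL_alternating (2 * m) :: 'a mat set) * q ^ (2 * m))"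
proof (induction m)
  case 0
  have "(GL 0 :: 'a mat set) = {1\<^sub>m 0}" "(GL_alternating 0 :: 'a mat set) = {1\<^sub>m 0}"
    by (auto simp: GL_def GL_alternating_def alternating_mat_def)
  then show ?case
    using card_GL_Suc[of 0, where ?'a = 'a] by (simp add: num_B_def q_def)
next
  case (Suc m)
  let ?G = "\<lambda>n. card (GL n :: 'a mat set)" and ?A = "\<lambda>n. card (GL_alternating n :: 'a mat set)"
  define p where "p = (\<Prod>j=1..m. q ^ (2 * j) - 1)"
  define u v w where "u = q ^ Suc (2 * m) - 1" and "v = q ^ Suc (Suc (2 * m)) - 1"
    and "w = q ^ Suc (Suc (Suc (2 * m))) - 1"
  have two: "2 * Suc m = Suc (Suc (2 * m))"
    by simp
  have G: "?G (Suc (Suc (Suc (2 * m)))) = w * (v * (?G (Suc (2 * m)) * q ^ Suc (2 * m)) * q ^ Suc (Suc (2 * m)))"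
    using card_GL_Suc[of "Suc (Suc (2 * m))", where ?'a = 'a] card_GL_Suc[of "Suc (2 * m)", where ?'a = 'a]
    unfolding q_def v_def w_def by (simp only:)
  have A: "?A (Suc (Suc (2 * m))) = u * (?A (2 * m) * q ^ (2 * m))"
    unfolding q_def u_def by (rule card_GL_alternating_Suc_Suc[OF char2])
  have B: "num_B (Suc (2 * m)) q = q ^ (m\<^sup>2) * u * p"
    unfolding num_B_odd u_def p_def ..
  have B': "num_B (Suc (Suc (Suc (2 * m)))) q = q ^ ((Suc m)\<^sup>2) * w * (p * v)"
    using num_B_odd[of "Suc m" q] unfolding w_def p_def v_def two by simp
  have e: "m\<^sup>2 + 2 * m + Suc (2 * m) + Suc (Suc (2 * m)) = (Suc m)\<^sup>2 + 2 * m + Suc (Suc (2 * m))"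
    by (simp add: power2_eq_square)
  have "?G (Suc (Suc (Suc (2 * m)))) =
      w * v * u * p * ?A (2 * m) * q ^ (m\<^sup>2 + 2 * m + Suc (2 * m) + Suc (Suc (2 * m)))"
    unfolding G Suc.IH B power_add by (simp only: mult_ac)
  also have "\<dots> = num_B (Suc (Suc (Suc (2 * m)))) q * (?A (Suc (Suc (2 * m))) * q ^ Suc (Suc (2 * m)))"
    unfolding e B' A power_add by (simp only: mult_ac)
  finally show ?case
    unfolding two .
qed

lemma card_field_ge_2: "CARD('a :: {field, finite}) \<ge> 2"
proof -
  have "card {0, 1 :: 'a} \<le> CARD('a)"
    by (intro card_mono) auto
  then show ?thesis
    by simp
qed

lemma num_B_ge: "q \<ge> 2 \<Longrightarrow> num_B (Suc (2 * m)) q \<ge> q - 1"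
proof -
  assume q: "q \<ge> 2"
  have "1 \<le> (\<Prod>j=1..m. q ^ (2 * j) - 1)"
  proof (rule prod_ge_1)
    fix j assume "j \<in> {1..m}"
    then have "q ^ 1 \<le> q ^ (2 * j)"
      using q by (intro power_increasing) auto
    then show "1 \<le> q ^ (2 * j) - 1"
      using q by simp
  qed
  moreover have "1 \<le> q ^ (m\<^sup>2)"
    using q by simp
  moreover have "q ^ 1 \<le> q ^ Suc (2 * m)"
    using q by (intro power_increasing) auto
  then have "q - 1 \<le> q ^ Suc (2 * m) - 1"
    unfolding power_one_right by (rule diff_le_mono)
  ultimately have "1 * (q - 1) * 1 \<le> q ^ (m\<^sup>2) * (q ^ Suc (2 * m) - 1) * (\<Prod>j=1..m. q ^ (2 * j) - 1)"
    by (intro mult_mono) (assumption | simp)+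
  then show ?thesis
    by (simp only: num_B_odd mult_1 mult_1_right)
qed

lemma geometric_div: "(q - 1) * ((q ^ n - 1) div (q - 1)) = q ^ n - (1 :: nat)"
proof -
  have "q - 1 dvd q ^ n - 1"
  proof (cases "q = 0")
    case False
    have "int (q - 1) dvd int (q ^ n - 1)"
      using False power_diff_1_eq[of "int q" n] by (simp add: of_nat_diff)
    then show ?thesis
      by (simp only: of_nat_dvd_iff)
  qed (cases n, auto)
  then show ?thesis
    by simp
qed

lemma num_A_pos: "q \<ge> 2 \<Longrightarrow> num_A (Suc (2 * m)) q > 0"
proof -
  assume q: "q \<ge> 2"
  have "1 < q ^ Suc (2 * m)"
    using q by (intro one_less_power) auto
  then have "(q - 1) * ((q ^ Suc (2 * m) - 1) div (q - 1)) > 0"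
    unfolding geometric_div by (rule zero_less_diff[THEN iffD2])
  then have "(q ^ Suc (2 * m) - 1) div (q - 1) > 0"
    by (metis gr0I mult_0_right)
  moreover have "(\<Prod>j=1..m. q ^ (2 * j - 1) - 1) > 0"
    unfolding prod_pos_nat_iff[OF finite_atLeastAtMost]
  proof
    fix j assume "j \<in> {1..m}"
    then have "q ^ 1 \<le> q ^ (2 * j - 1)"
      using q by (intro power_increasing) auto
    then show "0 < q ^ (2 * j - 1) - 1"
      using q by simp
  qed
  moreover have "q ^ (5 * m\<^sup>2 + 5 * m + 1) > 0"
    using q by simp
  ultimately show ?thesis
    unfolding num_A_odd by (intro mult_pos_pos)
qed

text \<open>
  The counts of pairs \<open>(M, E)\<close> are divided by the order of the intersection of the parabolic
  subgroup with its conjugate. The rest is bookkeeping: the constant factor is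
  \<open>A\<close>, by comparison of the exponents of \<open>q\<close>.
\<close>

lemma card_DC_Sp_trace:
  fixes \<beta> :: "'a :: {field, finite}" and m :: nat
  assumes char2: "(2 :: 'a) = 0"
  defines "q \<equiv> CARD('a)" and "n \<equiv> Suc (2 * m)"
  shows "q * card {w \<in> DC_Sp n. mat_trace w = \<beta>} =
    num_A n q * (num_B n q + 1 - q + q * card {x :: 'a. x \<noteq> 0 \<and> x + inverse x = \<beta>})"
proof -
  define k where "k = 2 * m"
  define a S g where "a = card (GL_alternating k :: 'a mat set)"
    and "S = card (symmetric_mats n :: 'a mat set)" and "g = card (GL k :: 'a mat set)"
  define B sol D where "B = num_B n q" and "sol = card {x :: 'a. x \<noteq> 0 \<and> x + inverse x = \<beta>}"
    and "D = card {w \<in> DC_Sp n. mat_trace w = \<beta>}"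
  define C where "C = card {p \<in> parabolic_Sp n. mat_trace (sigma_Sp n k * p) = \<beta>}"
  define P where "P = (\<Prod>j=1..m. q ^ (2 * j - 1) - 1)"
  have q: "q \<ge> 2"
    unfolding q_def by (rule card_field_ge_2)
  have n: "n = Suc k"
    by (simp add: n_def k_def)
  have G_rec: "card (GL n :: 'a mat set) = (q ^ n - 1) * (g * q ^ k)"
    unfolding n q_def g_def by (rule card_GL_Suc)
  have G_B: "card (GL n :: 'a mat set) = B * (a * q ^ k)"
    unfolding B_def n_def q_def a_def k_def by (rule card_GL_odd[OF char2])
  have "C = card {(M, E). M \<in> GL n \<and> E \<in> symmetric_mats n \<and>
      M $$ (k, k) + mat_inv M $$ (k, k) + partial_trace k M E = \<beta>}"
    unfolding C_def card_parabolic_elts n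
    by (intro arg_cong[of _ _ card] Collect_cong)
       (auto simp: mat_trace_sigma_parabolic symmetric_mats_def)
  then have "q * C = S * (q * (a * q ^ k * sol) + (B * (a * q ^ k) - a * q ^ k * (q - 1)))"
    using card_levi_trace[OF char2, of k \<beta>]
    unfolding n[symmetric] q_def[symmetric] G_B S_def a_def sol_def by (simp only:)
  also have "B * (a * q ^ k) - a * q ^ k * (q - 1) = a * q ^ k * (B - (q - 1))"
    by (simp only: diff_mult_distrib2 mult.commute[of B])
  also have "B - (q - 1) = B + 1 - q"
    using q by simp
  finally have C: "q * C = S * (a * q ^ k) * (B + 1 - q + q * sol)"
    by (simp only: distrib_left mult_ac add.commute)
  have "D * (g * q ^ k * (q - 1) * q ^ n) = ((q ^ n - 1) * (g * q ^ k) * S) * C"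
    using card_DC_Sp_trace_mult[OF char2, of k \<beta>] card_parabolic_Sp_sigma_stable[OF char2, of k]
    unfolding n[symmetric] q_def[symmetric] card_parabolic_Sp G_rec D_def C_def S_def g_def by (simp only:)
  then have "(g * q ^ k) * (D * ((q - 1) * q ^ n)) = (g * q ^ k) * ((q ^ n - 1) * S * C)"
    by (simp only: mult_ac)
  moreover have "card (GL n :: 'a mat set) > 0"
  proof -
    have "1\<^sub>m n \<in> (GL n :: 'a mat set)"
      by (simp add: GL_def)
    then show ?thesis
      by (auto simp: card_gt_0_iff finite_GL)
  qed
  ultimately have "D * ((q - 1) * q ^ n) = (q ^ n - 1) * S * C"
    unfolding G_rec by (metis mult_cancel1 mult_eq_0_iff less_irrefl)
  then have "q * (D * ((q - 1) * q ^ n)) = q * ((q ^ n - 1) * S * C)"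
    by (rule arg_cong)
  then have "(q * D) * ((q - 1) * q ^ n) = (q ^ n - 1) * S * (q * C)"
    by (simp only: mult_ac)
  also have "\<dots> = (q ^ n - 1) * (S * S * (a * q ^ k)) * (B + 1 - q + q * sol)"
    unfolding C by (simp only: mult_ac)
  also have "(q ^ n - 1) * (S * S * (a * q ^ k)) = num_A n q * ((q - 1) * q ^ n)"
  proof -
    have "S * S * (a * q ^ k) = q ^ (n * (n + 1) div 2 + n * (n + 1) div 2 + m * (m - 1) + k) * P"
      unfolding S_def a_def k_def q_def card_symmetric_mats card_GL_alternating[OF char2] P_def power_add
      by (simp only: mult_ac)
    (* The exponent (5 * n^2 - 1) / 4 of A equals 5 * m^2 + 5 * m + 1 for n = 2 * m + 1. *)
    also have "n * (n + 1) div 2 + n * (n + 1) div 2 + m * (m - 1) + k = 5 * m\<^sup>2 + 5 * m + 1 + n"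
    proof -
      have "n * (n + 1) div 2 = (2 * m + 1) * (m + 1)"
        by (simp add: n_def)
      moreover have "m * (m - 1) + m = m * m"
        by (cases m) auto
      ultimately show ?thesis
        by (simp add: n_def k_def power2_eq_square algebra_simps)
    qed
    finally have "(q ^ n - 1) * (S * S * (a * q ^ k)) =
        (q - 1) * ((q ^ n - 1) div (q - 1)) * (q ^ (5 * m\<^sup>2 + 5 * m + 1 + n) * P)"
      by (simp only: geometric_div)
    then show ?thesis
      unfolding num_A_odd n_def P_def power_add by (simp only: mult_ac)
  qed
  finally have eq: "(q - 1) * q ^ n * (q * D) = (q - 1) * q ^ n * (num_A n q * (B + 1 - q + q * sol))"
    by (simp only: mult_ac)
  have "(q - 1) * q ^ n \<noteq> 0"
    using q by simp
  then have "q * D = num_A n q * (B + 1 - q + q * sol)"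
    using eq by (rule mult_left_cancel[THEN iffD1])
  then show ?thesis
    unfolding B_def sol_def D_def .
qed

section \<open>Weight distributions and Kloosterman moments\<close>

context
  fixes r :: nat
  assumes card: "CARD('a :: {field, finite}) = 2 ^ r"
begin

lemma field_tr_one_partition:
  fixes c :: 'a
  shows "UNIV = insert c ({\<beta>. \<beta> \<noteq> c \<and> field_tr r (inverse (\<beta> - c)) = 0} \<union>
    {\<beta>. \<beta> \<noteq> c \<and> field_tr r (inverse (\<beta> - c)) = 1})"
  using field_tr_in_prime_field[OF card] by auto

lemma prod_field_by_trace:
  fixes c :: 'a and f :: "'a \<Rightarrow> nat"
  shows "(\<Prod>\<beta>\<in>UNIV. f \<beta>) = f c
    * (\<Prod>\<beta>\<in>{\<beta>. \<beta> \<noteq> c \<and> field_tr r (inverse (\<beta> - c)) = 0}. f \<beta>)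
    * (\<Prod>\<beta>\<in>{\<beta>. \<beta> \<noteq> c \<and> field_tr r (inverse (\<beta> - c)) = 1}. f \<beta>)"
proof -
  let ?X = "\<lambda>x. {\<beta>. \<beta> \<noteq> c \<and> field_tr r (inverse (\<beta> - c)) = x}"
  have "(\<Prod>\<beta>\<in>UNIV. f \<beta>) = f c * (\<Prod>\<beta>\<in>?X 0 \<union> ?X 1. f \<beta>)"
    by (subst field_tr_one_partition[of c], subst prod.insert) auto
  also have "(\<Prod>\<beta>\<in>?X 0 \<union> ?X 1. f \<beta>) = (\<Prod>\<beta>\<in>?X 0. f \<beta>) * (\<Prod>\<beta>\<in>?X 1. f \<beta>)"
    by (intro prod.union_disjoint) auto
  finally show ?thesis
    by (simp only: mult.assoc)
qed

text \<open>
  The parameter \<open>c\<close> is the shift of the trace: zero in the symplectic and one in the orthogonal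
  case. The same holds in the lemmas below.
\<close>

lemma weight_dist_by_trace_values:
  fixes g :: "nat \<Rightarrow> 'a mat" and c :: 'a
  assumes bij: "bij_betw g {..<card X} X" and "q > 0"
    and cnt: "\<And>\<beta>. q * card {w \<in> X. mat_trace w = \<beta>} =
      A * (B + 1 - q + q * card {x :: 'a. x \<noteq> 0 \<and> x + inverse x = \<beta> - c})"
    and B: "q \<le> B + 1"
  shows "weight_dist (trace_code (card X) g) j = (\<Sum>\<nu>\<in>(weight_families j :: ('a \<Rightarrow> nat) set).
      ((A * (B + 1) div q) choose \<nu> c)
        * (\<Prod>\<beta>\<in>{\<beta>. \<beta> \<noteq> c \<and> field_tr r (inverse (\<beta> - c)) = 0}. (A * (B + q + 1) div q) choose \<nu> \<beta>)
        * (\<Prod>\<beta>\<in>{\<beta>. \<beta> \<noteq> c \<and> field_tr r (inverse (\<beta> - c)) = 1}. (A * (B + 1 - q) div q) choose \<nu> \<beta>))"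
proof -
  have "card {i \<in> {..<card X}. mat_trace (g i) = \<beta>} = card {w \<in> X. mat_trace w = \<beta>}" for \<beta>
    by (rule bij_betw_same_card[of g], rule bij_betw_subset[OF bij]) (use bij in \<open>auto simp: bij_betw_def\<close>)
  moreover have "card {w \<in> X. mat_trace w = \<beta>} =
      (if \<beta> = c then A * (B + 1) div q
       else if field_tr r (inverse (\<beta> - c)) = 0 then A * (B + q + 1) div q else A * (B + 1 - q) div q)" for \<beta>
  proof -
    let ?s = "card {x :: 'a. x \<noteq> 0 \<and> x + inverse x = \<beta> - c}"
    have "card {w \<in> X. mat_trace w = \<beta>} = q * card {w \<in> X. mat_trace w = \<beta>} div q"
      using \<open>q > 0\<close> by simp
    then have "card {w \<in> X. mat_trace w = \<beta>} = A * (B + 1 - q + q * ?s) div q"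
      unfolding cnt .
    moreover have "B + 1 - q + q * ?s = (if \<beta> = c then B + 1
        else if field_tr r (inverse (\<beta> - c)) = 0 then B + q + 1 else B + 1 - q)"
      using B by (simp add: card_add_inverse_eq[OF card])
    ultimately show ?thesis
      by simp
  qed
  ultimately have n: "card {i \<in> {..<card X}. mat_trace (g i) = \<beta>} =
      (if \<beta> = c then A * (B + 1) div q
       else if field_tr r (inverse (\<beta> - c)) = 0 then A * (B + q + 1) div q else A * (B + 1 - q) div q)" for \<beta>
    by simp
  show ?thesis
    unfolding weight_dist_trace_code card_zero_sum_subsets[OF finite_lessThan] n
    by (intro sum.cong refl, subst prod_field_by_trace[of _ c])
       (auto intro!: arg_cong2[of _ _ _ _ "(*)"] prod.cong)
qed

lemma card_sum_units_add_inverse: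
  "(\<Sum>\<beta>\<in>UNIV. card {x :: 'a. x \<noteq> 0 \<and> x + inverse x = \<beta> - c}) = CARD('a) - 1"
proof -
  have "(\<Sum>\<beta>\<in>UNIV. card {x \<in> - {0}. x + inverse x + c = \<beta>}) = card (- {0 :: 'a})"
    using sum.group[of "- {0 :: 'a}" UNIV "\<lambda>x. x + inverse x + c" "\<lambda>_. 1 :: nat"] by simp
  moreover have "{x \<in> - {0}. x + inverse x + c = \<beta>} = {x. x \<noteq> 0 \<and> x + inverse x = \<beta> - c}" for \<beta>
    by (auto simp: algebra_simps)
  ultimately show ?thesis
    by (simp add: Compl_eq_Diff_UNIV card_Diff_singleton)
qed

lemma card_from_trace_counts:
  fixes X :: "'a mat set"
  assumes "finite X" and "q = CARD('a)" and B: "q \<le> B + 1"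
    and cnt: "\<And>\<beta>. q * card {w \<in> X. mat_trace w = \<beta>} =
      A * (B + 1 - q + q * card {x :: 'a. x \<noteq> 0 \<and> x + inverse x = \<beta> - c})"
  shows "card X = A * B"
proof -
  have q: "q \<ge> 2"
    using card_field_ge_2[where ?'a = 'a] assms(2) by simp
  have "card X = (\<Sum>\<beta>\<in>UNIV. card {w \<in> X. mat_trace w = \<beta>})"
    using sum.group[OF assms(1), of UNIV mat_trace "\<lambda>_. 1 :: nat"] by simp
  then have "q * card X = (\<Sum>\<beta>\<in>UNIV. A * (B + 1 - q + q * card {x :: 'a. x \<noteq> 0 \<and> x + inverse x = \<beta> - c}))"
    by (simp only: sum_distrib_left cnt)
  also have "\<dots> = A * (q * (B + 1 - q) + q * (q - 1))"
    by (simp only: sum_distrib_left[symmetric] sum.distrib card_sum_units_add_inverse) (simp add: assms(2))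
  also have "\<dots> = A * (q * ((B + 1 - q) + (q - 1)))"
    by (simp only: distrib_left)
  also have "(B + 1 - q) + (q - 1) = B"
    using B q by simp
  also have "A * (q * B) = q * (A * B)"
    by simp
  finally show ?thesis
    using q by simp
qed

text \<open>
  The part of the trace distribution that does not depend on \<open>\<beta>\<close> contributes nothing to a
  nontrivial character sum. What remains is a character sum over \<open>x + 1/x + c\<close>, that is, a
  Kloosterman sum times \<open>\<lambda>(a c)\<close>.
\<close>

lemma char_weight_by_trace_counts:
  fixes g :: "nat \<Rightarrow> 'a mat" and a c :: 'a
  assumes bij: "bij_betw g {..<card X} X" and q: "q = CARD('a)" and B: "q \<le> B + 1" and "finite X"
    and cnt: "\<And>\<beta>. q * card {w \<in> X. mat_trace w = \<beta>} =
      A * (B + 1 - q + q * card {x :: 'a. x \<noteq> 0 \<and> x + inverse x = \<beta> - c})"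
    and a: "a \<noteq> 0"
  shows "real (card {i \<in> {..<card X}. add_char r (a * mat_trace (g i)) = - 1}) =
    A / 2 * (B - add_char r (a * c) * kloosterman r (a\<^sup>2))"
proof -
  let ?l = "\<lambda>x. add_char r (x :: 'a)"
  let ?N = "card X"
  let ?s = "\<lambda>\<beta>. card {x :: 'a. x \<noteq> 0 \<and> x + inverse x = \<beta> - c}"
  have q2: "q \<ge> 2"
    using card_field_ge_2[where ?'a = 'a] q by simp
  have N: "?N = A * B"
    using card_from_trace_counts[OF \<open>finite X\<close> q B cnt] .
  have split: "?l x = 1 - 2 * (if ?l x = - 1 then 1 else 0)" for x
    by (simp add: add_char_def)
  have "(\<Sum>i<?N. ?l (a * mat_trace (g i))) =
      (\<Sum>i<?N. 1 - 2 * (if ?l (a * mat_trace (g i)) = - 1 then 1 else 0))"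
    by (intro sum.cong refl split)
  also have "\<dots> = ?N - 2 * real (card {i \<in> {..<?N}. ?l (a * mat_trace (g i)) = - 1})"
    by (simp add: sum_subtractf sum_distrib_left[symmetric] sum.If_cases Int_def)
  finally have W: "2 * real (card {i \<in> {..<?N}. ?l (a * mat_trace (g i)) = - 1}) =
      ?N - (\<Sum>i<?N. ?l (a * mat_trace (g i)))"
    by simp
  have cntg: "card {i \<in> {..<?N}. mat_trace (g i) = \<beta>} = card {w \<in> X. mat_trace w = \<beta>}" for \<beta>
    by (rule bij_betw_same_card[of g], rule bij_betw_subset[OF bij]) (use bij in \<open>auto simp: bij_betw_def\<close>)
  have "q * (\<Sum>i<?N. ?l (a * mat_trace (g i))) =
      (\<Sum>\<beta>\<in>UNIV. real (q * card {w \<in> X. mat_trace w = \<beta>}) * ?l (a * \<beta>))"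
  proof -
    have "(\<Sum>i<?N. ?l (a * mat_trace (g i))) =
        (\<Sum>\<beta>\<in>UNIV. real (card {w \<in> X. mat_trace w = \<beta>}) * ?l (a * \<beta>))"
      unfolding cntg[symmetric] by (rule sum_over_values) simp
    then show ?thesis
      by (simp add: sum_distrib_left mult.assoc)
  qed
  also have "\<dots> = (\<Sum>\<beta>\<in>UNIV. real (A * (B + 1 - q)) * ?l (\<beta> * a) + real (A * q) * (real (?s \<beta>) * ?l (a * \<beta>)))"
    unfolding cnt by (intro sum.cong refl) (simp add: algebra_simps)
  also have "\<dots> = real (A * (B + 1 - q)) * (\<Sum>\<beta>\<in>UNIV. ?l (\<beta> * a)) + real (A * q) * (\<Sum>\<beta>\<in>UNIV. real (?s \<beta>) * ?l (a * \<beta>))"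
    by (simp only: sum.distrib sum_distrib_left)
  also have "(\<Sum>\<beta>\<in>UNIV. ?l (\<beta> * a)) = 0"
    using a by (simp add: sum_add_char[OF card])
  also have "(\<Sum>\<beta>\<in>UNIV. real (?s \<beta>) * ?l (a * \<beta>)) = (\<Sum>x\<in>UNIV - {0}. ?l (a * (x + inverse x + c)))"
  proof -
    have "{x \<in> UNIV - {0}. x + inverse x + c = \<beta>} = {x. x \<noteq> 0 \<and> x + inverse x = \<beta> - c}" for \<beta>
      by (auto simp: algebra_simps)
    then show ?thesis
      using sum_over_values[of "UNIV - {0 :: 'a}" "\<lambda>\<beta>. ?l (a * \<beta>)" "\<lambda>x. x + inverse x + c"] by simp
  qed
  also have "\<dots> = ?l (a * c) * (\<Sum>x\<in>UNIV - {0}. ?l (a * (x + inverse x)))"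
    unfolding sum_distrib_left
    by (intro sum.cong refl) (simp only: distrib_left[of a "_ + _" c] add_char_add[OF card] mult.commute)
  also have "(\<Sum>x\<in>UNIV - {0}. ?l (a * (x + inverse x))) = kloosterman r (a\<^sup>2)"
    by (rule sum_add_char_add_inverse[OF card a])
  finally have "(\<Sum>i<?N. ?l (a * mat_trace (g i))) = A * (?l (a * c) * kloosterman r (a\<^sup>2))"
    using q2 by simp
  then show ?thesis
    using W by (simp add: N algebra_simps)
qed

text \<open>
  Squaring permutes the elements of trace one.
\<close>

lemma sum_kloosterman_squares:
  "(\<Sum>a | field_tr r a = 1. kloosterman r ((a :: 'a)\<^sup>2) ^ l) = T1K TYPE('a) r l"
proof -
  have bij: "bij_betw (\<lambda>a :: 'a. a\<^sup>2) UNIV UNIV"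
    using square_surj[OF card] char2_square_inject[OF char_two_of_card[OF card]]
    by (auto simp: bij_betw_def inj_on_def)
  have "bij_betw (\<lambda>a :: 'a. a\<^sup>2) {a. field_tr r a = 1} {a. a \<noteq> 0 \<and> field_tr r a = 1}"
  proof (rule bij_betw_subset[OF bij])
    show "(\<lambda>a. a\<^sup>2) ` {a :: 'a. field_tr r a = 1} = {a. a \<noteq> 0 \<and> field_tr r a = 1}"
    proof (intro equalityI subsetI)
      fix b :: 'a assume b: "b \<in> {a. a \<noteq> 0 \<and> field_tr r a = 1}"
      obtain a :: 'a where "b = a\<^sup>2"
        using square_surj[OF card] by (metis surjD)
      then show "b \<in> (\<lambda>a. a\<^sup>2) ` {a :: 'a. field_tr r a = 1}"
        using b by (auto simp: field_tr_square[OF card])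
    next
      fix b :: 'a assume "b \<in> (\<lambda>a. a\<^sup>2) ` {a :: 'a. field_tr r a = 1}"
      then obtain a :: 'a where "b = a\<^sup>2" "field_tr r a = 1"
        by auto
      then show "b \<in> {a. a \<noteq> 0 \<and> field_tr r a = 1}"
        by (auto simp: field_tr_square[OF card])
    qed
  qed auto
  then show ?thesis
    unfolding T1K_def by (rule sum.reindex_bij_betw)
qed

end

lemma odd_part_binomial:
  fixes x y :: real
  shows "(x + y) ^ h - (x - y) ^ h = 2 * (\<Sum>l | l \<le> h \<and> odd l. real (h choose l) * x ^ (h - l) * y ^ l)"
proof -
  have "(x + y) ^ h - (x - y) ^ h =
      (\<Sum>l\<le>h. real (h choose l) * x ^ (h - l) * y ^ l - real (h choose l) * x ^ (h - l) * (- y) ^ l)"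
    using binomial_ring[of y x h] binomial_ring[of "- y" x h]
    by (simp add: sum_subtractf add.commute mult_ac)
  also have "\<dots> = (\<Sum>l\<le>h. if odd l then 2 * (real (h choose l) * x ^ (h - l) * y ^ l) else 0)"
    by (intro sum.cong) (auto simp: power_minus_odd)
  also have "\<dots> = (\<Sum>l\<in>{l \<in> {..h}. odd l}. 2 * (real (h choose l) * x ^ (h - l) * y ^ l))"
    by (intro sum.inter_filter[symmetric]) simp
  finally show ?thesis
    by (simp add: sum_distrib_left)
qed

theorem theorem1p1:
  fixes r n q A B N :: nat
    and g g' :: "nat \<Rightarrow> 'a :: {field, finite} mat"
    and C C' :: "nat \<Rightarrow> nat" and D :: "nat \<Rightarrow> real"
  assumes "r \<ge> 1" and "q = 2 ^ r" and "CARD('a) = q"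
    and "(odd n \<and> n \<ge> 3) \<or> (n = 1 \<and> q \<ge> 8)"
    and "A = num_A n q" and "B = num_B n q" and "N = A * B"
    and "bij_betw g {..<card (DC_O n :: 'a mat set)} (DC_O n)"
    and "bij_betw g' {..<card (DC_Sp n :: 'a mat set)} (DC_Sp n)"
    and "C = weight_dist (trace_code (card (DC_O n :: 'a mat set)) g)"
    and "C' = weight_dist (trace_code (card (DC_Sp n :: 'a mat set)) g')"
    and "D = (\<lambda>j. real (C j) - real (C' j))"
  shows "card (DC_O n :: 'a mat set) = N \<and> card (DC_Sp n :: 'a mat set) = N \<and>
    (\<forall>h. odd h \<longrightarrow>
      T1K TYPE('a) r h =
        - (\<Sum>l\<in>{l. l + 2 \<le> h \<and> odd l}. real (h choose l) * real B ^ (h - l) * T1K TYPE('a) r l)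
        + real q * inverse (real A ^ h) *
          (\<Sum>j=0..min N h. (- 1) ^ j * D j *
            (\<Sum>t=j..h. fact t * real (Stirling h t) * 2 powi (int h - int t - 1)
               * real (int_binom (int N - int j) (int N - int t))))) \<and>
    (\<forall>j\<le>N. C j =
      (\<Sum>\<nu>\<in>(weight_families j :: ('a \<Rightarrow> nat) set).
        ((A * (B + 1) div q) choose \<nu> 1)
        * (\<Prod>\<beta>\<in>{\<beta>. \<beta> \<noteq> 1 \<and> field_tr r (inverse (\<beta> - 1)) = 0}.
             (A * (B + q + 1) div q) choose \<nu> \<beta>)
        * (\<Prod>\<beta>\<in>{\<beta>. \<beta> \<noteq> 1 \<and> field_tr r (inverse (\<beta> - 1)) = 1}.
             (A * (B + 1 - q) div q) choose \<nu> \<beta>))) \<and>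
    (\<forall>j\<le>N. C' j =
      (\<Sum>\<nu>\<in>(weight_families j :: ('a \<Rightarrow> nat) set).
        ((A * (B + 1) div q) choose \<nu> 0)
        * (\<Prod>\<beta>\<in>{\<beta>. \<beta> \<noteq> 0 \<and> field_tr r (inverse \<beta>) = 0}.
             (A * (B + q + 1) div q) choose \<nu> \<beta>)
        * (\<Prod>\<beta>\<in>{\<beta>. \<beta> \<noteq> 0 \<and> field_tr r (inverse \<beta>) = 1}.
             (A * (B + 1 - q) div q) choose \<nu> \<beta>)))"
proof -
  let ?X = "DC_O n :: 'a mat set" and ?Y = "DC_Sp n :: 'a mat set"
  have card: "CARD('a) = 2 ^ r"
    using assms(2,3) by simp
  note char2 = char_two_of_card[OF card]
  obtain m where n: "n = Suc (2 * m)"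
    using assms(4) by (auto elim!: oddE)
  have q2: "q \<ge> 2"
    using card_field_ge_2[where ?'a = 'a] assms(3) by simp
  have B: "q \<le> B + 1"
    using num_B_ge[OF q2, of m] by (simp add: assms(6) n)
  have A0: "A > 0"
    using num_A_pos[OF q2, of m] by (simp add: assms(5) n)
  have cntY: "q * card {w \<in> ?Y. mat_trace w = \<beta>} =
      A * (B + 1 - q + q * card {x :: 'a. x \<noteq> 0 \<and> x + inverse x = \<beta> - 0})" for \<beta>
    using card_DC_Sp_trace[OF char2, of m \<beta>] by (simp only: assms(3,5,6) n diff_zero)
  have cntX: "q * card {w \<in> ?X. mat_trace w = \<beta>} =
      A * (B + 1 - q + q * card {x :: 'a. x \<noteq> 0 \<and> x + inverse x = \<beta> - 1})" for \<beta>
    using cntY[of "\<beta> - 1"] card_DC_O_trace[OF card, of "2 * m" \<beta>] by (simp only: n diff_zero)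
  have fin: "finite ?X" "finite ?Y"
    using bij_betw_finite[OF assms(8)] bij_betw_finite[OF assms(9)] by simp_all
  have N: "card ?X = N" "card ?Y = N"
    using card_from_trace_counts[OF card fin(1) assms(3)[symmetric] B cntX]
      card_from_trace_counts[OF card fin(2) assms(3)[symmetric] B cntY] assms(7) by simp_all
  have "q > 0"
    using q2 by simp
  note weights = weight_dist_by_trace_values[OF card assms(8) this cntX B, folded assms(10)]
    weight_dist_by_trace_values[OF card assms(9) this cntY B, folded assms(11), unfolded diff_zero]
  have moment: "T1K TYPE('a) r h =
        - (\<Sum>l\<in>{l. l + 2 \<le> h \<and> odd l}. real (h choose l) * real B ^ (h - l) * T1K TYPE('a) r l)
        + real q * inverse (real A ^ h) *
          (\<Sum>j=0..min N h. (- 1) ^ j * D j *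
            (\<Sum>t=j..h. fact t * real (Stirling h t) * 2 powi (int h - int t - 1)
               * real (int_binom (int N - int j) (int N - int t))))" if h: "odd h" for h
  proof -
    define WX WY where "WX a = real (card {i \<in> {..<N}. add_char r (a * mat_trace (g i)) = - 1})"
      and "WY a = real (card {i \<in> {..<N}. add_char r (a * mat_trace (g' i)) = - 1})" for a :: 'a
    define I where "I j = (\<Sum>t=j..h. fact t * real (Stirling h t) / 2 ^ t
         * real (int_binom (int N - int j) (int N - int t)))" for j
    have wX: "WX a = A / 2 * (B - add_char r a * kloosterman r (a\<^sup>2))"
      and wY: "WY a = A / 2 * (B - kloosterman r (a\<^sup>2))" if "a \<noteq> 0" for a
      using char_weight_by_trace_counts[OF card assms(8) assms(3)[symmetric] B fin(1) cntX that]
        char_weight_by_trace_counts[OF card assms(9) assms(3)[symmetric] B fin(2) cntY that]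
      unfolding N WX_def WY_def by (simp_all add: add_char_def)
    (* For a = 0 both weights vanish, and field_tr r a = 0 makes them equal; only elements of trace
       one, where the character takes the value -1, contribute to the difference. *)
    have diff: "WX a ^ h - WY a ^ h = (if field_tr r a = 1
        then (A / 2) ^ h * ((B + kloosterman r (a\<^sup>2)) ^ h - (B - kloosterman r (a\<^sup>2)) ^ h) else 0)" for a
    proof (cases "a = 0")
      case True
      then show ?thesis
        by (simp add: WX_def WY_def add_char_def)
    next
      case False
      show ?thesis
      proof (cases "field_tr r a = 1")
        case True
        then have "add_char r a = - 1"
          by (simp add: add_char_def)
        then have w: "WX a = A / 2 * (B + kloosterman r (a\<^sup>2))" "WY a = A / 2 * (B - kloosterman r (a\<^sup>2))"
          unfolding wX[OF False] wY[OF False] by (simp_all only: mult_minus1 diff_minus_eq_add)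
        show ?thesis
          unfolding if_P[OF True] w power_mult_distrib by (rule right_diff_distrib[symmetric])
      next
        case not_one: False
        then have "add_char r a = 1"
          using field_tr_in_prime_field[OF card, of a] by (auto simp: add_char_def)
        then have "WX a = WY a"
          unfolding wX[OF False] wY[OF False] by (simp only: mult_1)
        then show ?thesis
          unfolding if_not_P[OF not_one] by (simp only: diff_self)
      qed
    qed
    have q': "real q = 2 ^ r"
      by (simp add: assms(2))
    have mX: "(\<Sum>a\<in>UNIV. WX a ^ h) = q * (\<Sum>j=0..min N h. (- 1) ^ j * real (C j) * I j)"
      unfolding WX_def I_def assms(10) N weight_dist_trace_code q'
      by (rule power_moment_identity[OF card])
    have mY: "(\<Sum>a\<in>UNIV. WY a ^ h) = q * (\<Sum>j=0..min N h. (- 1) ^ j * real (C' j) * I j)"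
      unfolding WY_def I_def assms(11) N weight_dist_trace_code q'
      by (rule power_moment_identity[OF card])
    (* As h is odd, the odd l up to h are h itself and the index set of the recursion. *)
    define L where "L = {l. l + 2 \<le> h \<and> odd l}"
    have L: "finite L" "h \<notin> L" "{l. l \<le> h \<and> odd l} = insert h L"
    proof -
      show "finite L"
        by (rule finite_subset[of _ "{..h}"]) (auto simp: L_def)
      show "h \<notin> L"
        by (simp add: L_def)
      have "l + 2 \<le> h" if "l \<le> h" "odd l" "l \<noteq> h" for l
        using that h by presburger
      then show "{l. l \<le> h \<and> odd l} = insert h L"
        using h by (auto simp: L_def)
    qed
    define R where "R = (\<Sum>l\<in>L. real (h choose l) * real B ^ (h - l) * T1K TYPE('a) r l)"
    have "(\<Sum>a\<in>UNIV. WX a ^ h) - (\<Sum>a\<in>UNIV. WY a ^ h) = (\<Sum>a\<in>(UNIV :: 'a set). if field_tr r a = 1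
        then (A / 2) ^ h * ((B + kloosterman r (a\<^sup>2)) ^ h - (B - kloosterman r (a\<^sup>2)) ^ h) else 0)"
      unfolding sum_subtractf[symmetric] diff by (rule refl)
    also have "\<dots> = (\<Sum>a\<in>{a :: 'a. field_tr r a = 1}.
        (A / 2) ^ h * ((B + kloosterman r (a\<^sup>2)) ^ h - (B - kloosterman r (a\<^sup>2)) ^ h))"
      by (subst sum.inter_filter[symmetric]) simp_all
    also have "\<dots> = (A / 2) ^ h * (2 * (\<Sum>a\<in>{a :: 'a. field_tr r a = 1}. \<Sum>l | l \<le> h \<and> odd l.
        real (h choose l) * real B ^ (h - l) * kloosterman r (a\<^sup>2) ^ l))"
      by (simp only: odd_part_binomial sum_distrib_left)
    also have "(\<Sum>a\<in>{a :: 'a. field_tr r a = 1}. \<Sum>l | l \<le> h \<and> odd l.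
        real (h choose l) * real B ^ (h - l) * kloosterman r (a\<^sup>2) ^ l) =
        (\<Sum>l | l \<le> h \<and> odd l. real (h choose l) * real B ^ (h - l) * T1K TYPE('a) r l)"
      by (subst sum.swap) (simp only: sum_distrib_left[symmetric] sum_kloosterman_squares[OF card])
    also have "\<dots> = T1K TYPE('a) r h + R"
      unfolding L(3) R_def by (subst sum.insert[OF L(1,2)]) simp
    finally have diff_sum: "(\<Sum>a\<in>UNIV. WX a ^ h) - (\<Sum>a\<in>UNIV. WY a ^ h) =
        (A / 2) ^ h * (2 * (T1K TYPE('a) r h + R))" .
    have "(A / 2) ^ h * (2 * (T1K TYPE('a) r h + R)) =
        q * (\<Sum>j=0..min N h. (- 1) ^ j * D j * I j)"
    proof -
      have "(- 1) ^ j * real (C j) * I j - (- 1) ^ j * real (C' j) * I j = (- 1) ^ j * D j * I j" for j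
        by (simp only: assms(12) right_diff_distrib left_diff_distrib)
      then show ?thesis
        unfolding diff_sum[symmetric] mX mY right_diff_distrib[symmetric] sum_subtractf[symmetric] by (simp only:)
    qed
    moreover have "x = q' * inverse (A' ^ h) * (2 ^ h / 2 * s)"
      if "(A' / 2) ^ h * (2 * x) = q' * s" "A' \<noteq> 0" for x s q' A' :: real
      using that by (simp add: power_divide field_simps)
    ultimately have "T1K TYPE('a) r h + R =
        q * inverse (real A ^ h) * (2 ^ h / 2 * (\<Sum>j=0..min N h. (- 1) ^ j * D j * I j))"
      using A0 by (metis of_nat_0_eq_iff less_irrefl)
    also have "2 ^ h / 2 * (\<Sum>j=0..min N h. (- 1) ^ j * D j * I j) =
        (\<Sum>j=0..min N h. (- 1) ^ j * D j * (\<Sum>t=j..h. fact t * real (Stirling h t)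
          * 2 powi (int h - int t - 1) * real (int_binom (int N - int j) (int N - int t))))"
    proof -
      have "2 powi (int h - int t - 1) = 2 ^ h / 2 / (2 :: real) ^ t" for t
        by (simp add: power_int_diff)
      then show ?thesis
        unfolding I_def sum_distrib_left by (intro sum.cong refl) simp
    qed
    finally show ?thesis
      unfolding R_def L_def by linarith
  qed
  show ?thesis
    by (intro conjI allI impI N weights moment)
qed

end
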